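(* Let an instance be given by a finite nonempty set $X$ of variables, a finite signature $\Sigma$, a finite output tuple $\mathbf t=(t_1,\dots,t_r)$ of terms and a finite list $\Delta$ of tests $u\ne v$ between terms. Let $\mathrm D_n(\mathbf t,\Delta)$ be its dispersion, $s$ the number of vertices of its term graph and $\rho$ its minimum term cut size, as defined in the context. If a test in $\Delta$ has syntactically identical sides, then $\mathrm D_n(\mathbf t,\Delta)=0$ for every $n\ge1$. Otherwise, for every $n\ge s$, $$\lfloor n/s\rfloor^{\rho}\le \mathrm D_n(\mathbf t,\Delta)\le n^{\rho}.$$ For each fixed instance without a test having syntactically identical sides, $$\mathrm D_n(\mathbf t,\Delta)=\Theta(n^\rho),\qquad \lim_{n\to\infty}\frac{\log \mathrm D_n(\mathbf t,\Delta)}{\log n}=\rho .$$ One can check for tests with identical sides and compute $\rho$ in polynomial time in the explicit input length.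
   Context: Terms. A signature is a finite set of function symbols each with a specified arity in $\{0,1,2,\dots\}$ (arity $0$ symbols are constants). Terms are finite rooted expressions over $X$ and $\Sigma$ with ordered arguments. Syntactic equality means literal equality of expressions; no algebraic identities are imposed. An interpretation $I$ on a nonempty set $A$ assigns to each $f\in\Sigma$ of arity $d$ one (total, otherwise arbitrary) function $I_f:A^d\to A$. For an assignment $a:X\to A$ the value $u^I(a)$ of a term is defined recursively; all occurrences of $f$ use the same $I_f$. Dispersion. Write $X=\{x_1,\dots,x_m\}$. For an interpretation $I$ on a finite nonempty set $A$ put $C_I=\{a\in A^m: u^I(a)\ne v^I(a)\text{ for every }(u\ne v)\in\Delta\}$ and $\mathbf t^I(a)=(t_1^I(a),\dots,t_r^I(a))$. For $n\ge1$, $\mathrm D_n(\mathbf t,\Delta)=\max_I|\mathbf t^I(C_I)|$ over all interpretations $I$ on $[n]=\{0,\dots,n-1\}$. Term graph. Let $S$ be the set of all distinct subterms of the outputs and tests together with every declared variable, and $s=|S|\ge1$. On $S$ draw a directed edge from each immediate argument to its parent term. $\rho$ is the minimum size of a subset of $S$ meeting every directed path from a variable to an output term, paths of length zero included (the subset may contain variables and outputs; repeated output terms designate the same vertex). Encoding. An instance is given by an explicit finite binary description listing names, arities, variables, output and test lists, and ordered argument lists; integers have canonical self-delimiting encodings and each list includes its length and all entries. Terms are represented by syntax trees or by an acyclic graph listed in topological order with arguments referring to earlier nodes (different nodes may represent the same expression). The input length is the bit length of this description. *)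

theory Defs
  imports Complex_Main "HOL-Library.FuncSet" "HOL-Library.Landau_Symbols"
begin

section \<open>Terms, instances, dispersion\<close>

datatype ('f, 'x) trm = Var 'x | Fun 'f "('f, 'x) trm list"

primrec subterms :: "('f, 'x) trm \<Rightarrow> ('f, 'x) trm set" where
  "subterms (Var x) = {Var x}"
| "subterms (Fun f us) = insert (Fun f us) (\<Union> (set (map subterms us)))"

primrec wf_trm :: "'x set \<Rightarrow> 'f set \<Rightarrow> ('f \<Rightarrow> nat) \<Rightarrow> ('f, 'x) trm \<Rightarrow> bool" where
  "wf_trm X F ar (Var x) \<longleftrightarrow> x \<in> X"
| "wf_trm X F ar (Fun f us) \<longleftrightarrow>
     f \<in> F \<and> length us = ar f \<and> list_all (\<lambda>b. b) (map (wf_trm X F ar) us)"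

record ('f, 'x) problem =
  variables :: "'x set"
  symbols :: "'f set"
  arity :: "'f \<Rightarrow> nat"  \<comment> \<open>only its values on \<open>symbols\<close> matter\<close>
  outputs :: "('f, 'x) trm list"
  tests :: "(('f, 'x) trm \<times> ('f, 'x) trm) list"  \<comment> \<open>\<open>(u, v)\<close> stands for the test \<open>u \<noteq> v\<close>\<close>

definition wf_problem :: "('f, 'x) problem \<Rightarrow> bool" where
  "wf_problem P \<longleftrightarrow>
     finite (variables P) \<and> variables P \<noteq> {} \<and> finite (symbols P) \<and>
     (\<forall>t\<in>set (outputs P). wf_trm (variables P) (symbols P) (arity P) t) \<and>
     (\<forall>(u, v)\<in>set (tests P).
        wf_trm (variables P) (symbols P) (arity P) u \<and>
        wf_trm (variables P) (symbols P) (arity P) v)"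

definition has_identical_test :: "('f, 'x) problem \<Rightarrow> bool" where
  "has_identical_test P \<longleftrightarrow> (\<exists>(u, v)\<in>set (tests P). u = v)"

text \<open>
  The operation \<open>I\<^sub>f\<close> on \<open>A\<close> is the restriction of \<^term>\<open>I f\<close> to argument lists over \<open>A\<close> of length
  \<open>arity P f\<close>; other values of \<open>I\<close> are never used.
\<close>

definition interpretation_on ::
  "('f, 'x) problem \<Rightarrow> 'a set \<Rightarrow> ('f \<Rightarrow> 'a list \<Rightarrow> 'a) \<Rightarrow> bool" where
  "interpretation_on P A I \<longleftrightarrow>
     (\<forall>f\<in>symbols P. \<forall>as. length as = arity P f \<and> set as \<subseteq> A \<longrightarrow> I f as \<in> A)"

primrec trm_value :: "('f \<Rightarrow> 'a list \<Rightarrow> 'a) \<Rightarrow> ('x \<Rightarrow> 'a) \<Rightarrow> ('f, 'x) trm \<Rightarrow> 'a" where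
  "trm_value I a (Var x) = a x"
| "trm_value I a (Fun f us) = I f (map (trm_value I a) us)"

definition admissible ::
  "('f, 'x) problem \<Rightarrow> 'a set \<Rightarrow> ('f \<Rightarrow> 'a list \<Rightarrow> 'a) \<Rightarrow> ('x \<Rightarrow> 'a) set" where
  "admissible P A I =
     {a \<in> variables P \<rightarrow>\<^sub>E A. \<forall>(u, v)\<in>set (tests P). trm_value I a u \<noteq> trm_value I a v}"

definition output_values ::
  "('f, 'x) problem \<Rightarrow> 'a set \<Rightarrow> ('f \<Rightarrow> 'a list \<Rightarrow> 'a) \<Rightarrow> 'a list set" where
  "output_values P A I = (\<lambda>a. map (trm_value I a) (outputs P)) ` admissible P A I"

definition dispersion :: "('f, 'x) problem \<Rightarrow> nat \<Rightarrow> nat" where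
  "dispersion P n =
     Max {card (output_values P {0..<n} I) | I. interpretation_on P {0..<n} I}"


section \<open>Term graph and minimum term cut\<close>

definition term_vertices :: "('f, 'x) problem \<Rightarrow> ('f, 'x) trm set" where
  "term_vertices P =
     (\<Union>t\<in>set (outputs P). subterms t) \<union>
     (\<Union>(u, v)\<in>set (tests P). subterms u \<union> subterms v) \<union>
     Var ` variables P"

definition term_edges :: "('f, 'x) problem \<Rightarrow> (('f, 'x) trm \<times> ('f, 'x) trm) set" where
  "term_edges P =
     {(u, w). u \<in> term_vertices P \<and> w \<in> term_vertices P \<and> (\<exists>f us. w = Fun f us \<and> u \<in> set us)}"

definition io_path :: "('f, 'x) problem \<Rightarrow> ('f, 'x) trm list \<Rightarrow> bool" where
  "io_path P p \<longleftrightarrow>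
     p \<noteq> [] \<and> set p \<subseteq> term_vertices P \<and>
     successively (\<lambda>u w. (u, w) \<in> term_edges P) p \<and>
     hd p \<in> Var ` variables P \<and> last p \<in> set (outputs P)"

definition term_cut :: "('f, 'x) problem \<Rightarrow> ('f, 'x) trm set \<Rightarrow> bool" where
  "term_cut P K \<longleftrightarrow> K \<subseteq> term_vertices P \<and> (\<forall>p. io_path P p \<longrightarrow> K \<inter> set p \<noteq> {})"

definition graph_size :: "('f, 'x) problem \<Rightarrow> nat" where
  "graph_size P = card (term_vertices P)"

definition min_cut_size :: "('f, 'x) problem \<Rightarrow> nat" where
  "min_cut_size P = Min (card ` {K. term_cut P K})"


section \<open>Binary descriptions of instances\<close>

text \<open>
  Names of variables and of function symbols are natural numbers. Terms are given either as syntax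
  trees, or as references into a list of nodes whose arguments are positions of earlier nodes; the
  node list may contain several nodes for one term, and nodes that no output or test uses.
\<close>

datatype node = VarNode nat | FunNode nat "nat list"

datatype body =
    Trees "(nat, nat) trm list" "((nat, nat) trm \<times> (nat, nat) trm) list"
  | Dag "node list" "nat list" "(nat \<times> nat) list"

datatype description =
  Description (var_names: "nat list") (signature: "(nat \<times> nat) list") (body: body)

fun node_term :: "(nat, nat) trm list \<Rightarrow> node \<Rightarrow> (nat, nat) trm" where
  "node_term ts (VarNode x) = Var x"
| "node_term ts (FunNode f js) = Fun f (map (\<lambda>j. ts ! j) js)"

definition dag_terms :: "node list \<Rightarrow> (nat, nat) trm list" where
  "dag_terms nds = foldl (\<lambda>ts nd. ts @ [node_term ts nd]) [] nds"

fun body_outputs :: "body \<Rightarrow> (nat, nat) trm list" where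
  "body_outputs (Trees ts ds) = ts"
| "body_outputs (Dag nds os ds) = map (\<lambda>j. dag_terms nds ! j) os"

fun body_tests :: "body \<Rightarrow> ((nat, nat) trm \<times> (nat, nat) trm) list" where
  "body_tests (Trees ts ds) = ds"
| "body_tests (Dag nds os ds) = map (\<lambda>(i, j). (dag_terms nds ! i, dag_terms nds ! j)) ds"

definition described_problem :: "description \<Rightarrow> (nat, nat) problem" where
  "described_problem d =
     \<lparr> variables = set (var_names d),
       symbols = fst ` set (signature d),
       arity = (\<lambda>f. the (map_of (signature d) f)),
       outputs = body_outputs (body d),
       tests = body_tests (body d) \<rparr>"

fun topological :: "node list \<Rightarrow> bool" where
  "topological nds \<longleftrightarrow>
     (\<forall>k < length nds. \<forall>f js. nds ! k = FunNode f js \<longrightarrow> (\<forall>j\<in>set js. j < k))"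

fun wf_body :: "nat set \<Rightarrow> nat set \<Rightarrow> (nat \<Rightarrow> nat) \<Rightarrow> body \<Rightarrow> bool" where
  "wf_body X F ar (Trees ts ds) \<longleftrightarrow> True"
| "wf_body X F ar (Dag nds os ds) \<longleftrightarrow>
     topological nds \<and>
     (\<forall>t\<in>set (dag_terms nds). wf_trm X F ar t) \<and>
     (\<forall>j\<in>set os. j < length nds) \<and>
     (\<forall>(i, j)\<in>set ds. i < length nds \<and> j < length nds)"

definition wf_description :: "description \<Rightarrow> bool" where
  "wf_description d \<longleftrightarrow>
     distinct (var_names d) \<and> distinct (map fst (signature d)) \<and>
     wf_problem (described_problem d) \<and>
     wf_body (set (var_names d)) (fst ` set (signature d))
       (arity (described_problem d)) (body d)"

text \<open>
  Self-delimiting code of an integer: its binary digits, least significant first, each preceded by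
  the bit \<open>1\<close>, and a final bit \<open>0\<close>.
\<close>

fun enc_nat :: "nat \<Rightarrow> bool list" where
  "enc_nat n = (if n = 0 then [False] else True # odd n # enc_nat (n div 2))"

declare enc_nat.simps [simp del]

definition enc_list :: "('a \<Rightarrow> bool list) \<Rightarrow> 'a list \<Rightarrow> bool list" where
  "enc_list e xs = enc_nat (length xs) @ concat (map e xs)"

definition enc_pair :: "('a \<Rightarrow> bool list) \<Rightarrow> ('b \<Rightarrow> bool list) \<Rightarrow> 'a \<times> 'b \<Rightarrow> bool list" where
  "enc_pair e e' p = e (fst p) @ e' (snd p)"

primrec enc_trm :: "(nat, nat) trm \<Rightarrow> bool list" where
  "enc_trm (Var x) = False # enc_nat x"
| "enc_trm (Fun f us) = True # enc_nat f @ enc_nat (length us) @ concat (map enc_trm us)"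

fun enc_node :: "node \<Rightarrow> bool list" where
  "enc_node (VarNode x) = False # enc_nat x"
| "enc_node (FunNode f js) = True # enc_nat f @ enc_list enc_nat js"

fun enc_body :: "body \<Rightarrow> bool list" where
  "enc_body (Trees ts ds) = False # enc_list enc_trm ts @ enc_list (enc_pair enc_trm enc_trm) ds"
| "enc_body (Dag nds os ds) =
     True # enc_list enc_node nds @ enc_list enc_nat os @ enc_list (enc_pair enc_nat enc_nat) ds"

definition enc_description :: "description \<Rightarrow> bool list" where
  "enc_description d =
     enc_list enc_nat (var_names d) @ enc_list (enc_pair enc_nat enc_nat) (signature d) @
     enc_body (body d)"


section \<open>Polynomial-time computability\<close>

text \<open>
  The machine model is a first-order call-by-value language over binary trees, in the style of the
  languages WHILE and F of N. D. Jones (Computability and Complexity from a Programming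
  Perspective, MIT Press 1997). A program is a list of function bodies that may call each other;
  the only data are the empty tree and pairs. Every evaluation step costs one unit. No
  primitive inspects or builds more than one cell: with values kept as pointers to immutable
  shared cells, a run of \<open>t\<close> steps allocates at most \<open>t\<close> cells and its recursion depth is at most
  \<open>t\<close>, so a Turing machine simulates it in time polynomial in \<open>t\<close> and the input length.
  Conversely the language simulates a Turing machine with constant overhead per step (a tape is a
  pair of lists). The functions on bit strings computable in polynomial time are therefore the
  usual ones.
\<close>

datatype tree = Tip | Cell tree tree

datatype expr =
    Arg nat
  | NilE
  | ConsE expr expr
  | HdE expr
  | TlE expr
  | IfE expr expr expr  \<comment> \<open>second branch iff the condition is \<^const>\<open>Tip\<close>\<close>
  | CallE nat "expr list"

type_synonym program = "expr list"

fun tree_hd :: "tree \<Rightarrow> tree" where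
  "tree_hd Tip = Tip"
| "tree_hd (Cell a b) = a"

fun tree_tl :: "tree \<Rightarrow> tree" where
  "tree_tl Tip = Tip"
| "tree_tl (Cell a b) = b"

text \<open>
  \<open>eval Q env e v t\<close>: in program \<open>Q\<close>, with arguments \<open>env\<close>, the expression \<open>e\<close> evaluates to \<open>v\<close> in
  exactly \<open>t\<close> steps. At most one rule applies to each expression and environment.
\<close>

inductive eval :: "program \<Rightarrow> tree list \<Rightarrow> expr \<Rightarrow> tree \<Rightarrow> nat \<Rightarrow> bool"
  and evals :: "program \<Rightarrow> tree list \<Rightarrow> expr list \<Rightarrow> tree list \<Rightarrow> nat \<Rightarrow> bool"
  for Q :: program
where
  eval_Arg: "i < length env \<Longrightarrow> eval Q env (Arg i) (env ! i) 1"
| eval_Nil: "eval Q env NilE Tip 1"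
| eval_Cons: "eval Q env e1 v1 t1 \<Longrightarrow> eval Q env e2 v2 t2 \<Longrightarrow>
    eval Q env (ConsE e1 e2) (Cell v1 v2) (1 + t1 + t2)"
| eval_Hd: "eval Q env e v t \<Longrightarrow> eval Q env (HdE e) (tree_hd v) (1 + t)"
| eval_Tl: "eval Q env e v t \<Longrightarrow> eval Q env (TlE e) (tree_tl v) (1 + t)"
| eval_If_true: "eval Q env c w t1 \<Longrightarrow> w \<noteq> Tip \<Longrightarrow> eval Q env e1 v t2 \<Longrightarrow>
    eval Q env (IfE c e1 e2) v (1 + t1 + t2)"
| eval_If_false: "eval Q env c Tip t1 \<Longrightarrow> eval Q env e2 v t2 \<Longrightarrow>
    eval Q env (IfE c e1 e2) v (1 + t1 + t2)"
| eval_Call: "evals Q env es vs t1 \<Longrightarrow> g < length Q \<Longrightarrow> eval Q vs (Q ! g) v t2 \<Longrightarrow>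
    eval Q env (CallE g es) v (1 + t1 + t2)"
| evals_Nil: "evals Q env [] [] 0"
| evals_Cons: "eval Q env e v t1 \<Longrightarrow> evals Q env es vs t2 \<Longrightarrow>
    evals Q env (e # es) (v # vs) (t1 + t2)"

fun bit_tree :: "bool \<Rightarrow> tree" where
  "bit_tree False = Tip"
| "bit_tree True = Cell Tip Tip"

fun bits_tree :: "bool list \<Rightarrow> tree" where
  "bits_tree [] = Tip"
| "bits_tree (b # bs) = Cell (bit_tree b) (bits_tree bs)"

definition runs_in :: "program \<Rightarrow> bool list \<Rightarrow> bool list \<Rightarrow> nat \<Rightarrow> bool" where
  "runs_in Q w w' t \<longleftrightarrow> eval Q [bits_tree w] (CallE 0 [Arg 0]) (bits_tree w') t"

text \<open>
  One program computes \<open>f\<close> on all objects in \<open>D\<close>, given through the encoding \<open>enc\<close>, with running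
  time polynomial in the bit length of the encoding. Nothing is required on bit strings that
  encode no object in \<open>D\<close>.
\<close>

definition poly_time_computable ::
  "('a \<Rightarrow> bool list) \<Rightarrow> 'a set \<Rightarrow> ('a \<Rightarrow> bool list) \<Rightarrow> bool" where
  "poly_time_computable enc D f \<longleftrightarrow>
     (\<exists>Q c k. \<forall>d\<in>D. \<exists>t. runs_in Q (enc d) (f d) t \<and> t \<le> c * length (enc d) ^ k + c)"

end

theory Submission
  imports Defs "HOL-Library.Sublist"
begin

text \<open>
  The values on a term cut determine all outputs, whence the upper bound. For the lower bound, split
  every vertex of the term graph into a left copy, omitted for outputs, and a right copy, omitted
  for variables, and join the left copy of \<open>u\<close> to the right copies of \<open>u\<close> and of the terms with
  immediate argument \<open>u\<close>. The proper edges of a matching form vertex-disjoint paths, while a vertex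
  off these paths can be matched to itself; a vertex cover yields a term cut. Koenig's equality of
  the matching number \<open>\<mu>\<close> and the cover number thus gives the minimum cut size
  \<open>\<mu> + #variables + #outputs - #vertices\<close>, and as many disjoint paths from variables to outputs.
  Let every value code a pair of a term and a payload, the payload being passed on unchanged along
  the paths: distinct terms then never get equal values, so all tests hold, while the payloads of
  the variables that start a path can be read off the outputs.

  The same formula computes the minimum cut size once equal terms of the description have been
  identified. A maximum matching is found by an auction in which left vertices bid for right
  vertices; its final prices exhibit a cover of the same size, so that no augmenting paths are
  needed. Polynomial time is proved on the level of functions: those computable in polynomial time
  are closed under composition and under list recursion with polynomially bounded intermediate
  results.
\<close>

section \<open>Polynomial-time functions on encodable types\<close>

text \<open>The loops make the matching formula independent of the ambient vertex set: enlarging the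
  term graph by one more term raises both the matching number and the number of vertices by one. The
  divisor s of the lower bound arises because the n values are cut into s blocks of
  \<open>n div s\<close> payloads, one block for each vertex.

  On the algorithmic side the obstacle is size. A node list may describe terms of exponential size,
  a name may be exponentially larger than its code, and shared values may double in every round of a
  loop. Hence terms are handled only as positions in a table of distinct keys, names only as digit
  lists, and every loop comes with an invariant that bounds its intermediate results.\<close>

declare add_2_eq_Suc [simp del] add_2_eq_Suc' [simp del]

section \<open>Data types and their encoding as trees\<close>

class tree_encodable =
  fixes to_tree :: "'a \<Rightarrow> tree"
  assumes inj_to_tree: "inj to_tree"
begin

lemma to_tree_eq_iff [simp]: "to_tree x = to_tree y \<longleftrightarrow> x = y"
  using inj_to_tree by (auto dest: injD)

definition tsize :: "'a \<Rightarrow> nat" where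
  "tsize x = size (to_tree x)"

end

instantiation bool :: tree_encodable
begin
definition to_tree_bool :: "bool \<Rightarrow> tree" where "to_tree_bool = bit_tree"
instance
proof
  have "bit_tree a = bit_tree b \<Longrightarrow> a = b" for a b by (cases a; cases b) auto
  then show "inj (to_tree :: bool \<Rightarrow> tree)" by (auto simp: to_tree_bool_def inj_def)
qed
end

instantiation unit :: tree_encodable
begin
definition to_tree_unit :: "unit \<Rightarrow> tree" where "to_tree_unit u = Tip"
instance by standard (auto simp: inj_def)
end

text \<open>In unary a number is its own size, so a number computed in polynomial time may serve as
  an iteration count. The price is that names of variables and symbols, which may be exponentially
  larger than their codes, must stay digit lists.\<close>

instantiation nat :: tree_encodable
begin
primrec to_tree_nat :: "nat \<Rightarrow> tree" where
  "to_tree_nat 0 = Tip"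
| "to_tree_nat (Suc n) = Cell Tip (to_tree_nat n)"
instance
proof
  have "to_tree a = to_tree b \<Longrightarrow> a = b" for a b :: nat
    by (induction a arbitrary: b) (case_tac b; auto)+
  then show "inj (to_tree :: nat \<Rightarrow> tree)" by (auto simp: inj_def)
qed
end

instantiation prod :: (tree_encodable, tree_encodable) tree_encodable
begin
definition to_tree_prod :: "'a \<times> 'b \<Rightarrow> tree" where
  "to_tree_prod p = Cell (to_tree (fst p)) (to_tree (snd p))"
instance by standard (auto simp: inj_def to_tree_prod_def)
end

instantiation list :: (tree_encodable) tree_encodable
begin
primrec to_tree_list :: "'a list \<Rightarrow> tree" where
  "to_tree_list [] = Tip"
| "to_tree_list (x # xs) = Cell (to_tree x) (to_tree_list xs)"
instance
proof
  have "to_tree a = to_tree b \<Longrightarrow> a = b" for a b :: "'a list"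
    by (induction a arbitrary: b) (case_tac b; auto)+
  then show "inj (to_tree :: 'a list \<Rightarrow> tree)" by (auto simp: inj_def)
qed
end

lemma to_tree_simps [simp]:
  "to_tree (x, y) = Cell (to_tree x) (to_tree y)"
  "to_tree True = Cell Tip Tip" "to_tree False = Tip" "to_tree () = Tip"
  by (auto simp: to_tree_prod_def to_tree_bool_def to_tree_unit_def)

lemma tsize_simps [simp]:
  "tsize (x, y) = Suc (tsize x + tsize y)"
  "tsize True = 1" "tsize False = 0" "tsize () = 0"
  "tsize (0::nat) = 0" "tsize (Suc n) = Suc (tsize n)"
  "tsize ([] :: 'a::tree_encodable list) = 0" "tsize (z # zs) = Suc (tsize z + tsize zs)"
  by (auto simp: tsize_def)

lemma tsize_nat [simp]: "tsize (n::nat) = n"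
  by (induction n) auto

lemma tsize_bool: "tsize (b::bool) \<le> 1"
  by (cases b) auto

lemma tsize_append [simp]: "tsize (xs @ ys) = tsize xs + tsize ys"
  by (induction xs) auto

lemma tsize_fst_le: "tsize (fst p) \<le> tsize p" and tsize_snd_le: "tsize (snd p) \<le> tsize p"
  by (cases p; simp)+

lemma length_le_tsize: "length xs \<le> tsize xs"
  by (induction xs) auto

lemma tsize_mem_le: "x \<in> set xs \<Longrightarrow> tsize x < tsize xs"
  by (induction xs) auto

lemma tsize_suffix_le: "suffix xs ys \<Longrightarrow> tsize xs \<le> tsize ys"
  by (auto simp: suffix_def)

lemma tsize_rev [simp]: "tsize (rev xs) = tsize xs"
  by (induction xs) auto

lemma tsize_list_le: "(\<And>x. x \<in> set xs \<Longrightarrow> tsize x \<le> b) \<Longrightarrow> tsize xs \<le> length xs * Suc b"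
proof (induction xs)
  case (Cons x xs)
  have "tsize x \<le> b" "tsize xs \<le> length xs * Suc b" using Cons by auto
  then show ?case by simp
qed simp

lemma to_tree_bits: "to_tree bs = bits_tree bs"
  by (induction bs) (auto simp: to_tree_bool_def)

lemma tsize_bits: "tsize (bs :: bool list) \<le> 2 * length bs"
  using tsize_list_le[of bs 1] tsize_bool by auto

section \<open>Polynomial bounds\<close>

definition poly_bounded :: "('a::tree_encodable \<Rightarrow> nat) \<Rightarrow> bool" where
  "poly_bounded N \<longleftrightarrow> (\<exists>k. \<forall>x. N x \<le> (tsize x + 2) ^ k)"

lemma poly_boundedI: "(\<And>x. N x \<le> (tsize x + 2) ^ k) \<Longrightarrow> poly_bounded N"
  by (auto simp: poly_bounded_def)

lemma poly_bounded_mono: "poly_bounded M \<Longrightarrow> (\<And>x. N x \<le> M x) \<Longrightarrow> poly_bounded N"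
  unfolding poly_bounded_def by (meson order_trans)

named_theorems poly_bounds

lemma poly_bounded_const [poly_bounds]: "poly_bounded (\<lambda>x. c)"
proof (rule poly_boundedI[where k = c])
  fix x :: 'a
  have "c < 2 ^ c" by simp
  also have "\<dots> \<le> (tsize x + 2) ^ c" by (intro power_mono) auto
  finally show "c \<le> (tsize x + 2) ^ c" by simp
qed

lemma poly_bounded_tsize_id [poly_bounds]: "poly_bounded (\<lambda>x. tsize x)"
  by (rule poly_boundedI[where k = 1]) auto

lemma poly_bounded_mult [poly_bounds]:
  assumes "poly_bounded M" "poly_bounded N" shows "poly_bounded (\<lambda>x. M x * N x)"
proof -
  from assms obtain j k where jk: "\<And>x. M x \<le> (tsize x + 2) ^ j" "\<And>x. N x \<le> (tsize x + 2) ^ k"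
    unfolding poly_bounded_def by blast
  show ?thesis
    by (rule poly_boundedI[where k = "j + k"]) (simp add: power_add mult_mono jk)
qed

text \<open>One more power absorbs the factor 2, since the base is at least 2; this is why bounds
  are powers of \<open>tsize x + 2\<close>.\<close>

lemma poly_bounded_add [poly_bounds]:
  assumes "poly_bounded M" "poly_bounded N" shows "poly_bounded (\<lambda>x. M x + N x)"
proof -
  from assms obtain j k where jk: "\<And>x. M x \<le> (tsize x + 2) ^ j" "\<And>x. N x \<le> (tsize x + 2) ^ k"
    unfolding poly_bounded_def by blast
  show ?thesis
  proof (rule poly_boundedI[where k = "Suc (j + k)"])
    fix x :: 'a
    let ?b = "tsize x + 2"
    have "M x \<le> ?b ^ (j + k)" by (rule order.trans[OF jk(1) power_increasing]) auto
    moreover have "N x \<le> ?b ^ (j + k)" by (rule order.trans[OF jk(2) power_increasing]) auto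
    ultimately have "M x + N x \<le> 2 * ?b ^ (j + k)" by linarith
    also have "\<dots> \<le> ?b * ?b ^ (j + k)" by (intro mult_right_mono) auto
    finally show "M x + N x \<le> ?b ^ Suc (j + k)" by simp
  qed
qed

lemma poly_bounded_Suc [poly_bounds]: "poly_bounded N \<Longrightarrow> poly_bounded (\<lambda>x. Suc (N x))"
  using poly_bounded_add[OF _ poly_bounded_const[of 1]] by simp

lemma poly_bounded_power [poly_bounds]: "poly_bounded N \<Longrightarrow> poly_bounded (\<lambda>x. N x ^ k)"
  by (induction k) (auto intro!: poly_bounds)

lemma poly_bounded_comp:
  assumes N: "poly_bounded N" and f: "poly_bounded (\<lambda>x. tsize (f x))"
  shows "poly_bounded (\<lambda>x. N (f x))"
proof -
  from N obtain k where k: "\<And>x. N x \<le> (tsize x + 2) ^ k" unfolding poly_bounded_def by blast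
  show ?thesis
    by (rule poly_bounded_mono[where M = "\<lambda>x. (tsize (f x) + 2) ^ k"])
       (use k f in \<open>auto intro!: poly_bounds\<close>)
qed

section \<open>Joining programs\<close>

lemmas eval_rules = eval_evals.intros[simplified]

text \<open>Calls name absolute positions in the program, so the code placed behind another program
  has to be renumbered.\<close>

primrec shift_calls :: "nat \<Rightarrow> expr \<Rightarrow> expr" where
  "shift_calls k (Arg i) = Arg i"
| "shift_calls k NilE = NilE"
| "shift_calls k (ConsE a b) = ConsE (shift_calls k a) (shift_calls k b)"
| "shift_calls k (HdE a) = HdE (shift_calls k a)"
| "shift_calls k (TlE a) = TlE (shift_calls k a)"
| "shift_calls k (IfE a b c) = IfE (shift_calls k a) (shift_calls k b) (shift_calls k c)"
| "shift_calls k (CallE g es) = CallE (k + g) (map (shift_calls k) es)"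

lemma eval_append_right:
  "eval Q env e v t \<Longrightarrow> eval (Q @ R) env e v t"
  "evals Q env es vs t \<Longrightarrow> evals (Q @ R) env es vs t"
proof (induction rule: eval_evals.inducts)
  case (eval_Call env es vs t1 g v t2)
  then show ?case
    using eval_evals.eval_Call[of "Q @ R" env es vs t1 g v t2] by (simp add: nth_append)
qed (auto intro: eval_rules)

lemma eval_append_left:
  "eval Q env e v t \<Longrightarrow>
    eval (R @ map (shift_calls (length R)) Q) env (shift_calls (length R) e) v t"
  "evals Q env es vs t \<Longrightarrow>
    evals (R @ map (shift_calls (length R)) Q) env (map (shift_calls (length R)) es) vs t"
proof (induction rule: eval_evals.inducts)
  case (eval_Call env es vs t1 g v t2)
  then show ?case
    using eval_evals.eval_Call[of "R @ map (shift_calls (length R)) Q" env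
        "map (shift_calls (length R)) es" vs t1 "length R + g" v t2] by simp
qed (auto intro: eval_rules)

text \<open>The size of the result needs its own bound: a step may use a value twice by sharing, so
  t steps can build a tree with exponentially many cells in t. Composition relies on both
  bounds.\<close>

definition ptime :: "('a::tree_encodable \<Rightarrow> 'b::tree_encodable) \<Rightarrow> bool" where
  "ptime f \<longleftrightarrow>
     (\<exists>Q e k. \<forall>x. \<exists>t. eval Q [to_tree x] e (to_tree (f x)) t \<and>
        t \<le> (tsize x + 2) ^ k \<and> tsize (f x) \<le> (tsize x + 2) ^ k)"

lemma ptimeI:
  assumes "poly_bounded T" "poly_bounded (\<lambda>x. tsize (f x))"
    "\<And>x. \<exists>t \<le> T x. eval Q [to_tree x] e (to_tree (f x)) t"
  shows "ptime f"
proof -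
  from poly_bounded_add[OF assms(1,2)] obtain k
    where k: "\<And>x. T x + tsize (f x) \<le> (tsize x + 2) ^ k" unfolding poly_bounded_def by blast
  show ?thesis unfolding ptime_def
  proof (rule exI[of _ Q], rule exI[of _ e], rule exI[of _ k], rule allI)
    fix x
    obtain t where "t \<le> T x" "eval Q [to_tree x] e (to_tree (f x)) t" using assms(3) by blast
    with k[of x] show "\<exists>t. eval Q [to_tree x] e (to_tree (f x)) t \<and>
        t \<le> (tsize x + 2) ^ k \<and> tsize (f x) \<le> (tsize x + 2) ^ k"
      by (intro exI[of _ t]) auto
  qed
qed

lemma ptime_tsize [poly_bounds]: "ptime f \<Longrightarrow> poly_bounded (\<lambda>x. tsize (f x))"
  unfolding ptime_def poly_bounded_def by meson

text \<open>Time is stated relative to any upper bound \<open>m\<close> of the size, since for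
  intermediate arguments only an estimate of the size is known.\<close>

definition evals_within ::
  "program \<Rightarrow> expr \<Rightarrow> nat \<Rightarrow> ('a::tree_encodable \<Rightarrow> 'b::tree_encodable) \<Rightarrow> bool" where
  "evals_within Q e k f \<longleftrightarrow> (\<forall>x m. tsize x \<le> m \<longrightarrow>
     (\<exists>t \<le> (m + 2) ^ k. eval Q [to_tree x] e (to_tree (f x)) t))"

lemma evals_withinD:
  "evals_within Q e k f \<Longrightarrow> tsize x \<le> m \<Longrightarrow> \<exists>t \<le> (m + 2) ^ k. eval Q [to_tree x] e (to_tree (f x)) t"
  by (simp add: evals_within_def)

lemma evals_within_mono: "evals_within Q e k f \<Longrightarrow> k \<le> l \<Longrightarrow> evals_within Q e l f"
proof -
  have "k \<le> l \<Longrightarrow> (m + 2 :: nat) ^ k \<le> (m + 2) ^ l" for m by (rule power_increasing) auto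
  then show "evals_within Q e k f \<Longrightarrow> k \<le> l \<Longrightarrow> evals_within Q e l f"
    unfolding evals_within_def by (meson order.trans)
qed

lemma evals_within_append_right: "evals_within Q e k f \<Longrightarrow> evals_within (Q @ R) e k f"
  unfolding evals_within_def using eval_append_right(1) by meson

lemma evals_within_append_left: "evals_within Q e k f \<Longrightarrow>
    evals_within (R @ map (shift_calls (length R)) Q) (shift_calls (length R) e) k f"
  unfolding evals_within_def using eval_append_left(1) by meson

lemma ptime_evals_within:
  assumes "ptime f" obtains Q e k where "evals_within Q e k f"
proof -
  obtain Q e k where k: "\<And>x. \<exists>t. eval Q [to_tree x] e (to_tree (f x)) t \<and> t \<le> (tsize x + 2) ^ k"
    using assms unfolding ptime_def by blast
  have mono: "tsize x \<le> m \<Longrightarrow> (tsize x + 2) ^ k \<le> (m + 2) ^ k" for x :: 'a and m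
    by (intro power_mono) auto
  then have "evals_within Q e k f"
    unfolding evals_within_def using k by (meson order.trans)
  then show ?thesis by (rule that)
qed

text \<open>The open suffix \<open>R\<close> is where later proofs put function bodies of their own,
  at positions counted from \<open>length Q\<close>. With only two functions at hand, one is passed
  twice.\<close>

lemma ptime_joint:
  assumes "ptime f" "ptime g" "ptime h"
  obtains Q e1 e2 e3 k where "\<And>R. evals_within (Q @ R) e1 k f" "\<And>R. evals_within (Q @ R) e2 k g"
    "\<And>R. evals_within (Q @ R) e3 k h"
proof -
  obtain Q1 e1 k1 where 1: "evals_within Q1 e1 k1 f" by (rule ptime_evals_within[OF assms(1)])
  obtain Q2 e2 k2 where 2: "evals_within Q2 e2 k2 g" by (rule ptime_evals_within[OF assms(2)])
  obtain Q3 e3 k3 where 3: "evals_within Q3 e3 k3 h" by (rule ptime_evals_within[OF assms(3)])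
  let ?Q12 = "Q1 @ map (shift_calls (length Q1)) Q2" and ?k = "max k1 (max k2 k3)"
  let ?Q = "?Q12 @ map (shift_calls (length ?Q12)) Q3"
  have a: "evals_within ?Q e1 ?k f"
    by (intro evals_within_append_right evals_within_mono[OF 1]) simp
  have b: "evals_within ?Q (shift_calls (length Q1) e2) ?k g"
    by (intro evals_within_append_right evals_within_append_left evals_within_mono[OF 2]) simp
  have c: "evals_within ?Q (shift_calls (length ?Q12) e3) ?k h"
    by (intro evals_within_append_left evals_within_mono[OF 3]) simp
  show ?thesis
    by (rule that[OF evals_within_append_right[OF a] evals_within_append_right[OF b]
          evals_within_append_right[OF c]])
qed

section \<open>Closure properties\<close>

named_theorems ptime_intros

lemma ptime_id [ptime_intros]: "ptime (\<lambda>x. x)"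
proof (rule ptimeI)
  fix x :: 'a
  show "\<exists>t \<le> 1. eval [] [to_tree x] (Arg 0) (to_tree x) t"
    using eval_Arg[of 0 "[to_tree x]" "[]"] by auto
qed (intro poly_bounds)+

primrec tree_expr :: "tree \<Rightarrow> expr" where
  "tree_expr Tip = NilE"
| "tree_expr (Cell a b) = ConsE (tree_expr a) (tree_expr b)"

lemma eval_tree_expr: "\<exists>t. \<forall>env. eval Q env (tree_expr a) a t"
proof (induction a)
  case Tip then show ?case by (auto intro: eval_rules)
next
  case (Cell a b)
  then obtain t u where "\<forall>env. eval Q env (tree_expr a) a t" "\<forall>env. eval Q env (tree_expr b) b u"
    by blast
  then show ?case by (auto intro!: exI[of _ "Suc (t + u)"] eval_rules)
qed

lemma ptime_const [ptime_intros]: "ptime (\<lambda>x. c)"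
proof -
  obtain t where "\<And>env. eval [] env (tree_expr (to_tree c)) (to_tree c) t"
    using eval_tree_expr by blast
  then show ?thesis
    by (intro ptimeI[where T = "\<lambda>_. t"]) (auto intro!: poly_bounds)
qed

text \<open>The expression for \<open>g\<close> expects its input as the only argument; it becomes a
  function body that is called on the value of \<open>f\<close>.\<close>

lemma ptime_comp:
  assumes "ptime g" "ptime f" shows "ptime (\<lambda>x. g (f x))"
proof -
  obtain Q e1 e2 e3 k where r: "\<And>R. evals_within (Q @ R) e1 k f" "\<And>R. evals_within (Q @ R) e2 k g"
    by (rule ptime_joint[OF assms(2,1,1)], rule that)
  let ?Q = "Q @ [e2]"
  have b: "poly_bounded (\<lambda>x. tsize (f x))" using assms by (intro poly_bounds)
  show ?thesis
  proof (rule ptimeI)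
    show "poly_bounded (\<lambda>x. 1 + (tsize x + 2) ^ k + (tsize (f x) + 2) ^ k)" by (intro poly_bounds b)
    show "poly_bounded (\<lambda>x. tsize (g (f x)))"
      using poly_bounded_comp[OF ptime_tsize[OF assms(1)] b] .
    fix x
    obtain t1 t2 where t: "t1 \<le> (tsize x + 2) ^ k" "eval ?Q [to_tree x] e1 (to_tree (f x)) t1"
      "t2 \<le> (tsize (f x) + 2) ^ k" "eval ?Q [to_tree (f x)] e2 (to_tree (g (f x))) t2"
      using evals_withinD[OF r(1)] evals_withinD[OF r(2)] order_refl by meson
    then have "eval ?Q [to_tree x] (CallE (length Q) [e1]) (to_tree (g (f x))) (1 + (t1 + 0) + t2)"
      by (intro eval_Call[OF evals_Cons[OF _ evals_Nil]]) auto
    then show "\<exists>t \<le> 1 + (tsize x + 2) ^ k + (tsize (f x) + 2) ^ k.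
        eval ?Q [to_tree x] (CallE (length Q) [e1]) (to_tree (g (f x))) t"
      using t(1,3) by (intro exI[of _ "1 + (t1 + 0) + t2"]) auto
  qed
qed

lemma ptime_Pair [ptime_intros]:
  assumes "ptime f" "ptime g" shows "ptime (\<lambda>x. (f x, g x))"
proof -
  obtain Q e1 e2 e3 k where r: "\<And>R. evals_within (Q @ R) e1 k f" "\<And>R. evals_within (Q @ R) e2 k g"
    by (rule ptime_joint[OF assms assms(2)], rule that)
  show ?thesis
  proof (rule ptimeI)
    show "poly_bounded (\<lambda>x. 1 + (tsize x + 2) ^ k + (tsize x + 2) ^ k)" by (intro poly_bounds)
    show "poly_bounded (\<lambda>x. tsize (f x, g x))" using assms by (auto intro!: poly_bounds)
    fix x
    obtain t1 t2 where "t1 \<le> (tsize x + 2) ^ k" "eval (Q @ []) [to_tree x] e1 (to_tree (f x)) t1"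
      "t2 \<le> (tsize x + 2) ^ k" "eval (Q @ []) [to_tree x] e2 (to_tree (g x)) t2"
      using evals_withinD[OF r(1)] evals_withinD[OF r(2)] order_refl by meson
    then show "\<exists>t \<le> 1 + (tsize x + 2) ^ k + (tsize x + 2) ^ k.
        eval (Q @ []) [to_tree x] (ConsE e1 e2) (to_tree (f x, g x)) t"
      by (intro exI[of _ "Suc (t1 + t2)"]) (auto intro!: eval_rules)
  qed
qed

text \<open>
  \<^term>\<open>ptime\<close> only sees the encodings, so a function whose encoding is the identity, or that of
  another function, costs nothing extra.
\<close>

lemma ptime_cong_tree:
  fixes f :: "'a::tree_encodable \<Rightarrow> 'b::tree_encodable" and g :: "'a \<Rightarrow> 'c::tree_encodable"
  assumes "ptime f" "\<And>x. to_tree (g x) = to_tree (f x)"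
  shows "ptime g"
  using assms by (auto simp: ptime_def tsize_def)

lemma ptime_fst' : "ptime fst"
proof (rule ptimeI)
  fix x :: "'a \<times> 'b"
  show "\<exists>t \<le> 2. eval [] [to_tree x] (HdE (Arg 0)) (to_tree (fst x)) t"
    using eval_Hd[OF eval_Arg[of 0 "[to_tree x]" "[]"]] by (cases x) (auto intro!: exI[of _ "Suc (Suc 0)"])
qed (auto intro!: poly_bounds poly_bounded_mono[OF poly_bounded_tsize_id] simp: tsize_fst_le)

lemma ptime_snd' : "ptime snd"
proof (rule ptimeI)
  fix x :: "'a \<times> 'b"
  show "\<exists>t \<le> 2. eval [] [to_tree x] (TlE (Arg 0)) (to_tree (snd x)) t"
    using eval_Tl[OF eval_Arg[of 0 "[to_tree x]" "[]"]] by (cases x) (auto intro!: exI[of _ "Suc (Suc 0)"])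
qed (auto intro!: poly_bounds poly_bounded_mono[OF poly_bounded_tsize_id] simp: tsize_snd_le)

lemmas ptime_fst [ptime_intros] = ptime_comp[OF ptime_fst']
lemmas ptime_snd [ptime_intros] = ptime_comp[OF ptime_snd']

lemma ptime_Cons [ptime_intros]: "ptime f \<Longrightarrow> ptime g \<Longrightarrow> ptime (\<lambda>x. f x # g x)"
  by (rule ptime_cong_tree[OF ptime_Pair]) auto

lemma ptime_Suc [ptime_intros]: "ptime f \<Longrightarrow> ptime (\<lambda>x. Suc (f x))"
  by (rule ptime_cong_tree[OF ptime_Pair[OF ptime_const[of "()"]]]) auto

lemma ptime_If [ptime_intros]:
  assumes "ptime c" "ptime f" "ptime g" shows "ptime (\<lambda>x. if c x then f x else g x)"
proof -
  obtain Q e0 e1 e2 k where r: "\<And>R. evals_within (Q @ R) e0 k c" "\<And>R. evals_within (Q @ R) e1 k f"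
    "\<And>R. evals_within (Q @ R) e2 k g" by (rule ptime_joint[OF assms], rule that)
  let ?Q = "Q @ []"
  show ?thesis
  proof (rule ptimeI)
    show "poly_bounded (\<lambda>x. 1 + 2 * (tsize x + 2) ^ k)" by (intro poly_bounds)
    have "poly_bounded (\<lambda>x. tsize (f x) + tsize (g x))" using assms by (intro poly_bounds)
    then show "poly_bounded (\<lambda>x. tsize (if c x then f x else g x))"
      by (rule poly_bounded_mono) auto
    fix x
    obtain t0 t1 t2 where t: "t0 \<le> (tsize x + 2) ^ k" "eval ?Q [to_tree x] e0 (to_tree (c x)) t0"
      "t1 \<le> (tsize x + 2) ^ k" "eval ?Q [to_tree x] e1 (to_tree (f x)) t1"
      "t2 \<le> (tsize x + 2) ^ k" "eval ?Q [to_tree x] e2 (to_tree (g x)) t2"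
      using evals_withinD[OF r(1)] evals_withinD[OF r(2)] evals_withinD[OF r(3)] order_refl by meson
    show "\<exists>t \<le> 1 + 2 * (tsize x + 2) ^ k.
        eval ?Q [to_tree x] (IfE e0 e1 e2) (to_tree (if c x then f x else g x)) t"
    proof (cases "c x")
      case True
      have "eval ?Q [to_tree x] (IfE e0 e1 e2) (to_tree (f x)) (1 + t0 + t1)"
        by (rule eval_If_true[OF t(2) _ t(4)]) (use True in simp)
      then show ?thesis using t True by (intro exI[of _ "1 + t0 + t1"]) simp
    next
      case False
      have "eval ?Q [to_tree x] (IfE e0 e1 e2) (to_tree (g x)) (1 + t0 + t2)"
        by (rule eval_If_false[OF _ t(6)]) (use t(2) False in simp)
      then show ?thesis using t False by (intro exI[of _ "1 + t0 + t2"]) simp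
    qed
  qed
qed

text \<open>All loops except the equality test on trees are derived from this one. The size has to
  be bounded on every suffix, that is for every intermediate result: a step of polynomial time alone
  could square the size in each round.\<close>

lemma ptime_rec_list:
  assumes l: "ptime l" and a: "ptime a"
    and b: "ptime (\<lambda>p. b (fst p) (fst (snd p)) (fst (snd (snd p))) (snd (snd (snd p))))"
    and N: "poly_bounded N"
    and bound: "\<And>x s. suffix s (l x) \<Longrightarrow> tsize (rec_list (a x) (b x) s) \<le> N x"
  shows "ptime (\<lambda>x. rec_list (a x) (b x) (l x))"
proof -
  let ?b = "\<lambda>p. b (fst p) (fst (snd p)) (fst (snd (snd p))) (snd (snd (snd p)))"
  obtain Q e0 e1 e2 k where r: "\<And>R. evals_within (Q @ R) e0 k l" "\<And>R. evals_within (Q @ R) e1 k a"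
    "\<And>R. evals_within (Q @ R) e2 k ?b" by (rule ptime_joint[OF l a b], rule that)
  let ?n = "length Q"
  \<comment> \<open>Function \<open>?n\<close> is the recursion with the parameter and the current
    list as arguments, \<open>?n + 1\<close> is the step applied to the tuple built by
    \<open>?arg\<close>, and \<open>?n + 2\<close> is the base case.\<close>
  let ?arg = "ConsE (Arg 0) (ConsE (HdE (Arg 1)) (ConsE (TlE (Arg 1)) (CallE ?n [Arg 0, TlE (Arg 1)])))"
  let ?f = "IfE (Arg 1) (CallE (?n + 1) [?arg]) (CallE (?n + 2) [Arg 0])"
  let ?Q = "Q @ [?f, e2, e1]"
  have nth: "?Q ! ?n = ?f" "?Q ! (?n + 1) = e2" "?Q ! (?n + 2) = e1"
    by (simp_all add: nth_append)
  have bl: "poly_bounded (\<lambda>x. tsize (l x))" using l by (intro poly_bounds)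
  \<comment> \<open>\<open>?M\<close> bounds one application of the step: the tuple adds three cells
    to the parameter, to a part of the list and to an intermediate result.\<close>
  let ?M = "\<lambda>x. (3 + tsize x + tsize (l x) + N x + 2) ^ k" and ?S = "\<lambda>x. (tsize x + 2) ^ k"
  have A0: "eval ?Q [u, v] (Arg 0) u 1" for u v
    using eval_Arg[of 0 "[u, v]" ?Q] by simp
  have A1: "eval ?Q [u, v] (Arg 1) v 1" for u v
    using eval_Arg[of 1 "[u, v]" ?Q] by simp
  have main: "\<exists>t \<le> 4 + ?S x + length s * (20 + ?M x).
      eval ?Q [to_tree x, to_tree s] ?f (to_tree (rec_list (a x) (b x) s)) t"
    if "suffix s (l x)" for x s
    using that
  proof (induction s)
    case Nil
    obtain t1 where t1: "t1 \<le> ?S x" "eval ?Q [to_tree x] e1 (to_tree (a x)) t1"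
      using evals_withinD[OF r(2) order_refl] by blast
    have "eval ?Q [to_tree x, Tip] (CallE (?n + 2) [Arg 0]) (to_tree (a x)) (1 + (1 + 0) + t1)"
      by (rule eval_Call[OF evals_Cons[OF A0 evals_Nil]]) (use t1 nth in auto)
    then have "eval ?Q [to_tree x, Tip] ?f (to_tree (a x)) (1 + 1 + (1 + (1 + 0) + t1))"
      by (intro eval_If_false A1)
    then show ?case using t1(1) by (intro exI[of _ "1 + 1 + (1 + (1 + 0) + t1)"]) auto
  next
    case (Cons h s)
    then have suf: "suffix s (l x)" by (auto intro: suffix_ConsD)
    let ?r = "rec_list (a x) (b x) s"
    obtain t where t: "t \<le> 4 + ?S x + length s * (20 + ?M x)"
      "eval ?Q [to_tree x, to_tree s] ?f (to_tree ?r) t" using Cons.IH[OF suf] by blast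
    have sz: "tsize (x, h, s, ?r) \<le> 3 + tsize x + tsize (l x) + N x"
      using bound[OF suf] tsize_suffix_le[OF Cons.prems] by auto
    obtain t2 where t2: "t2 \<le> ?M x"
      "eval ?Q [to_tree (x, h, s, ?r)] e2 (to_tree (b x h s ?r)) t2"
      using evals_withinD[OF r(3) sz] unfolding fst_conv snd_conv by blast
    let ?env = "[to_tree x, to_tree (h # s)]"
    have H: "eval ?Q ?env (HdE (Arg 1)) (to_tree h) (1 + 1)"
      using eval_Hd[OF A1[of "to_tree x" "to_tree (h # s)"]] by simp
    have T: "eval ?Q ?env (TlE (Arg 1)) (to_tree s) (1 + 1)"
      using eval_Tl[OF A1[of "to_tree x" "to_tree (h # s)"]] by simp
    define u where "u = 1 + 1 + (1 + (1 + 1) + (1 + (1 + 1) + (1 + (1 + ((1 + 1) + 0)) + t)))"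
    have "eval ?Q ?env (CallE ?n [Arg 0, TlE (Arg 1)]) (to_tree ?r) (1 + (1 + ((1 + 1) + 0)) + t)"
      by (rule eval_Call[OF evals_Cons[OF A0 evals_Cons[OF T evals_Nil]]]) (use t nth in auto)
    then have E: "eval ?Q ?env ?arg (to_tree (x, h, s, ?r)) u"
      unfolding to_tree_simps u_def by (intro eval_Cons A0 H T)
    have G: "eval ?Q ?env (CallE (?n + 1) [?arg]) (to_tree (b x h s ?r)) (1 + (u + 0) + t2)"
      by (rule eval_Call[OF evals_Cons[OF E evals_Nil]]) (use t2 nth in auto)
    have F: "eval ?Q ?env ?f (to_tree (b x h s ?r)) (1 + 1 + (1 + (u + 0) + t2))"
      by (rule eval_If_true[OF A1 _ G]) simp
    have "1 + 1 + (1 + (u + 0) + t2) \<le> 20 + t + t2" by (simp add: u_def)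
    also have "\<dots> \<le> 20 + (4 + ?S x + length s * (20 + ?M x)) + ?M x"
      using t(1) t2(1) by (intro add_mono) auto
    also have "\<dots> = 4 + ?S x + length (h # s) * (20 + ?M x)" by simp
    finally show ?case using F by (intro exI[of _ "1 + 1 + (1 + (u + 0) + t2)"]) (simp only: list.rec(2))
  qed
  let ?T = "\<lambda>x. 10 + ?S x + (4 + ?S x + tsize (l x) * (20 + ?M x))"
  show ?thesis
  proof (rule ptimeI)
    show "poly_bounded ?T" by (intro poly_bounds bl N)
    show "poly_bounded (\<lambda>x. tsize (rec_list (a x) (b x) (l x)))"
      by (rule poly_bounded_mono[OF N bound]) auto
    fix x
    obtain t where t: "t \<le> 4 + ?S x + length (l x) * (20 + ?M x)"
      "eval ?Q [to_tree x, to_tree (l x)] ?f (to_tree (rec_list (a x) (b x) (l x))) t"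
      using main[of "l x" x] by blast
    note t(1)
    also have "4 + ?S x + length (l x) * (20 + ?M x) \<le> 4 + ?S x + tsize (l x) * (20 + ?M x)"
      by (intro add_mono mult_mono length_le_tsize) auto
    finally have t1: "t \<le> 4 + ?S x + tsize (l x) * (20 + ?M x)" .
    obtain t0 where t0: "t0 \<le> ?S x" "eval ?Q [to_tree x] e0 (to_tree (l x)) t0"
      using evals_withinD[OF r(1) order_refl] by blast
    have "eval ?Q [to_tree x] (Arg 0) (to_tree x) 1"
      using eval_Arg[of 0 "[to_tree x]" ?Q] by simp
    then have "eval ?Q [to_tree x] (CallE ?n [Arg 0, e0]) (to_tree (rec_list (a x) (b x) (l x)))
        (1 + (1 + (t0 + 0)) + t)"
      by (rule eval_Call[OF evals_Cons[OF _ evals_Cons[OF t0(2) evals_Nil]]]) (use t nth in auto)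
    then show "\<exists>t \<le> ?T x. eval ?Q [to_tree x] (CallE ?n [Arg 0, e0])
        (to_tree (rec_list (a x) (b x) (l x))) t"
      using t0(1) t1 by (intro exI[of _ "1 + (1 + (t0 + 0)) + t"]) linarith
  qed
qed

text \<open>Case analysis is a recursion whose step ignores the recursive result; the size bound
  then needs only one application of \<open>b\<close>.\<close>

lemma ptime_case_list [ptime_intros]:
  assumes l: "ptime l" and a: "ptime a" and b: "ptime (\<lambda>p. b (fst p) (fst (snd p)) (snd (snd p)))"
  shows "ptime (\<lambda>x. case l x of [] \<Rightarrow> a x | y # ys \<Rightarrow> b x y ys)"
proof -
  obtain j where j: "\<And>p. tsize (b (fst p) (fst (snd p)) (snd (snd p))) \<le> (tsize p + 2) ^ j"
    using ptime_tsize[OF b] unfolding poly_bounded_def by blast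
  have "ptime (\<lambda>x. rec_list (a x) (\<lambda>h t r. b x h t) (l x))"
  proof (rule ptime_rec_list[OF l a])
    have "ptime (\<lambda>p. (fst p, fst (snd p), fst (snd (snd p))))" by (intro ptime_intros)
    from ptime_comp[OF b this]
    show "ptime (\<lambda>p. b (fst p) (fst (snd p)) (fst (snd (snd p))))" by simp
    show "poly_bounded (\<lambda>x. tsize (a x) + (1 + tsize x + tsize (l x) + 2) ^ j)"
      by (intro poly_bounds l a)
    fix x s assume s: "suffix s (l x)"
    show "tsize (rec_list (a x) (\<lambda>h t r. b x h t) s) \<le> tsize (a x) + (1 + tsize x + tsize (l x) + 2) ^ j"
    proof (cases s)
      case (Cons h t)
      have "tsize (b x h t) \<le> (tsize (x, h, t) + 2) ^ j" using j[of "(x, h, t)"] by simp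
      also have "\<dots> \<le> (1 + tsize x + tsize (l x) + 2) ^ j"
        using tsize_suffix_le[OF s] Cons by (intro power_mono) auto
      finally show ?thesis using Cons by simp
    qed simp
  qed
  moreover have "rec_list (a x) (\<lambda>h t r. b x h t) (l x) = (case l x of [] \<Rightarrow> a x | y # ys \<Rightarrow> b x y ys)" for x
    by (cases "l x") auto
  ultimately show ?thesis by simp
qed

section \<open>Polynomial-time list and number functions\<close>

text \<open>The language can only test for \<open>Tip\<close>, so equality is a parallel descent
  into both trees. Each cell of one tree is visited at most once, whence linear time. As encodings
  are injective, this decides equality in every encodable type.\<close>

definition eq_body :: "nat \<Rightarrow> expr" where
  "eq_body n =
     IfE (Arg 0)
       (IfE (Arg 1)
         (IfE (CallE n [HdE (Arg 0), HdE (Arg 1)]) (CallE n [TlE (Arg 0), TlE (Arg 1)]) NilE)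
         NilE)
       (IfE (Arg 1) NilE (ConsE NilE NilE))"

lemma eval_eq_body:
  assumes "n < length Q" "Q ! n = eq_body n"
  shows "\<exists>t \<le> 20 + 40 * size a. eval Q [a, b] (eq_body n) (to_tree (a = b)) t"
proof (induction a arbitrary: b)
  have A0: "eval Q [u, v] (Arg 0) u 1" for u v
    using eval_Arg[of 0 "[u, v]" Q] by simp
  have A1: "eval Q [u, v] (Arg 1) v 1" for u v
    using eval_Arg[of 1 "[u, v]" Q] by simp
  {
    case Tip
    have "eval Q [Tip, b] (IfE (Arg 1) NilE (ConsE NilE NilE)) (to_tree (Tip = b)) (1 + 1 + (if b = Tip then 3 else 1))"
    proof (cases b)
      case Tip
      have "eval Q [Tip, b] (IfE (Arg 1) NilE (ConsE NilE NilE)) (Cell Tip Tip) (1 + 1 + (1 + 1 + 1))"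
        by (rule eval_If_false[OF _ eval_Cons[OF eval_Nil eval_Nil]]) (use A1[of Tip b] Tip in simp)
      then show ?thesis by (simp add: Tip eval_nat_numeral)
    next
      case Cell
      then have "eval Q [Tip, b] (IfE (Arg 1) NilE (ConsE NilE NilE)) Tip (1 + 1 + 1)"
        by (intro eval_If_true[OF A1 _ eval_Nil]) simp
      then show ?thesis using Cell by simp
    qed
    then have "eval Q [Tip, b] (eq_body n) (to_tree (Tip = b)) (1 + 1 + (1 + 1 + (if b = Tip then 3 else 1)))"
      unfolding eq_body_def by (rule eval_If_false[OF A0])
    then show ?case by (intro exI[of _ "1 + 1 + (1 + 1 + (if b = Tip then 3 else 1))"]) auto
  next
    case (Cell a1 a2)
    show ?case
    proof (cases b)
      case Tip
      have "eval Q [Cell a1 a2, Tip] (eq_body n) Tip (1 + 1 + (1 + 1 + 1))"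
        unfolding eq_body_def by (intro eval_If_true[OF A0] eval_If_false A1 eval_Nil) simp
      then show ?thesis using Tip by (intro exI[of _ "1 + 1 + (1 + 1 + 1)"]) simp
    next
      case b: (Cell b1 b2)
      let ?env = "[Cell a1 a2, b]"
      obtain t1 where t1: "t1 \<le> 20 + 40 * size a1" "eval Q [a1, b1] (eq_body n) (to_tree (a1 = b1)) t1"
        using Cell.IH(1) by blast
      obtain t2 where t2: "t2 \<le> 20 + 40 * size a2" "eval Q [a2, b2] (eq_body n) (to_tree (a2 = b2)) t2"
        using Cell.IH(2) by blast
      have H: "evals Q ?env [HdE (Arg 0), HdE (Arg 1)] [a1, b1] ((1 + 1) + ((1 + 1) + 0))"
        using eval_Hd[OF A0[of "Cell a1 a2" b]] eval_Hd[OF A1[of "Cell a1 a2" b]] b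
        by (intro evals_Cons evals_Nil) simp_all
      have T: "evals Q ?env [TlE (Arg 0), TlE (Arg 1)] [a2, b2] ((1 + 1) + ((1 + 1) + 0))"
        using eval_Tl[OF A0[of "Cell a1 a2" b]] eval_Tl[OF A1[of "Cell a1 a2" b]] b
        by (intro evals_Cons evals_Nil) simp_all
      have C1: "eval Q ?env (CallE n [HdE (Arg 0), HdE (Arg 1)]) (to_tree (a1 = b1))
          (1 + ((1 + 1) + ((1 + 1) + 0)) + t1)"
        by (rule eval_Call[OF H]) (use assms t1 in auto)
      have C2: "eval Q ?env (CallE n [TlE (Arg 0), TlE (Arg 1)]) (to_tree (a2 = b2))
          (1 + ((1 + 1) + ((1 + 1) + 0)) + t2)"
        by (rule eval_Call[OF T]) (use assms t2 in auto)
      let ?i = "IfE (CallE n [HdE (Arg 0), HdE (Arg 1)]) (CallE n [TlE (Arg 0), TlE (Arg 1)]) NilE"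
      obtain t where t: "t \<le> 12 + t1 + t2" "eval Q ?env ?i (to_tree (Cell a1 a2 = b)) t"
      proof (cases "a1 = b1")
        case True
        have "eval Q ?env ?i (to_tree (a2 = b2))
            (1 + (1 + ((1 + 1) + ((1 + 1) + 0)) + t1) + (1 + ((1 + 1) + ((1 + 1) + 0)) + t2))"
          by (rule eval_If_true[OF C1 _ C2]) (simp add: True)
        with True b show ?thesis by (intro that) auto
      next
        case False
        have "eval Q ?env ?i Tip (1 + (1 + ((1 + 1) + ((1 + 1) + 0)) + t1) + 1)"
          by (rule eval_If_false[OF _ eval_Nil]) (use C1 False in simp)
        with False b show ?thesis by (intro that) auto
      qed
      have "eval Q ?env (eq_body n) (to_tree (Cell a1 a2 = b)) (1 + 1 + (1 + 1 + t))"
        unfolding eq_body_def by (rule eval_If_true[OF A0], simp, rule eval_If_true[OF A1 _ t(2)]) (simp add: b)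
      then show ?thesis using t(1) t1(1) t2(1) by (intro exI[of _ "1 + 1 + (1 + 1 + t)"]) auto
    qed
  }
qed

lemma ptime_eq [ptime_intros]:
  assumes "ptime f" "ptime g" shows "ptime (\<lambda>x. f x = g x)"
proof -
  obtain Q e1 e2 e3 k where r: "\<And>R. evals_within (Q @ R) e1 k f" "\<And>R. evals_within (Q @ R) e2 k g"
    by (rule ptime_joint[OF assms assms(2)], rule that)
  let ?n = "length Q"
  let ?Q = "Q @ [eq_body ?n]"
  show ?thesis
  proof (rule ptimeI)
    show "poly_bounded (\<lambda>x. 1 + 2 * (tsize x + 2) ^ k + (20 + 40 * tsize (f x)))"
      by (intro poly_bounds assms)
    show "poly_bounded (\<lambda>x. tsize (f x = g x))"
      by (rule poly_bounded_mono[OF poly_bounded_const[of 1]]) (use tsize_bool in auto)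
    fix x
    obtain t1 t2 where t: "t1 \<le> (tsize x + 2) ^ k" "eval ?Q [to_tree x] e1 (to_tree (f x)) t1"
      "t2 \<le> (tsize x + 2) ^ k" "eval ?Q [to_tree x] e2 (to_tree (g x)) t2"
      using evals_withinD[OF r(1)] evals_withinD[OF r(2)] order_refl by meson
    obtain t3 where t3: "t3 \<le> 20 + 40 * tsize (f x)"
      "eval ?Q [to_tree (f x), to_tree (g x)] (eq_body ?n) (to_tree (f x = g x)) t3"
      using eval_eq_body[of ?n ?Q "to_tree (f x)" "to_tree (g x)"] by (auto simp: tsize_def)
    have "eval ?Q [to_tree x] (CallE ?n [e1, e2]) (to_tree (f x = g x)) (1 + (t1 + (t2 + 0)) + t3)"
      by (rule eval_Call[OF evals_Cons[OF t(2) evals_Cons[OF t(4) evals_Nil]]]) (use t3 in auto)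
    then show "\<exists>t \<le> 1 + 2 * (tsize x + 2) ^ k + (20 + 40 * tsize (f x)).
        eval ?Q [to_tree x] (CallE ?n [e1, e2]) (to_tree (f x = g x)) t"
      using t t3 by (intro exI[of _ "1 + (t1 + (t2 + 0)) + t3"]) auto
  qed
qed

lemma ptime_not [ptime_intros]: "ptime c \<Longrightarrow> ptime (\<lambda>x. \<not> c x)"
  using ptime_eq[OF _ ptime_const[of False]] by simp

lemma ptime_conj [ptime_intros]:
  assumes "ptime c" "ptime d" shows "ptime (\<lambda>x. c x \<and> d x)"
proof -
  have "ptime (\<lambda>x. if c x then d x else False)" by (intro ptime_intros assms)
  moreover have "(\<lambda>x. c x \<and> d x) = (\<lambda>x. if c x then d x else False)" by auto
  ultimately show ?thesis by simp
qed

lemma ptime_disj [ptime_intros]: "ptime c \<Longrightarrow> ptime d \<Longrightarrow> ptime (\<lambda>x. c x \<or> d x)"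
  using ptime_not[OF ptime_conj[OF ptime_not ptime_not]] by simp

lemma ptime_Let [ptime_intros]:
  assumes "ptime f" "ptime (\<lambda>p. b (fst p) (snd p))" shows "ptime (\<lambda>x. let y = f x in b x y)"
  using ptime_comp[OF assms(2) ptime_Pair[OF ptime_id assms(1)]] by simp

lemma ptime_case_prod [ptime_intros]:
  assumes "ptime f" "ptime (\<lambda>p. b (fst p) (fst (snd p)) (snd (snd p)))"
  shows "ptime (\<lambda>x. case f x of (u, v) \<Rightarrow> b x u v)"
  using ptime_comp[OF assms(2) ptime_Pair[OF ptime_id assms(1)]] by (simp add: case_prod_beta)

lemma poly_bounded_step:
  assumes "ptime l" "ptime (\<lambda>p. f (fst p) (snd p))"
  obtains N where "poly_bounded N" "\<And>x h. h \<in> set (l x) \<Longrightarrow> tsize (f x h) \<le> N x"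
proof -
  from ptime_tsize[OF assms(2)] obtain k where
    k: "\<And>p. tsize (f (fst p) (snd p)) \<le> (tsize p + 2) ^ k" unfolding poly_bounded_def by blast
  show ?thesis
  proof (rule that)
    show "poly_bounded (\<lambda>x. (1 + tsize x + tsize (l x) + 2) ^ k)" by (intro poly_bounds assms)
    fix x h assume "h \<in> set (l x)"
    then have "tsize h \<le> tsize (l x)" using tsize_mem_le less_imp_le by blast
    then have "(tsize (x, h) + 2) ^ k \<le> (1 + tsize x + tsize (l x) + 2) ^ k"
      by (intro power_mono) auto
    then show "tsize (f x h) \<le> (1 + tsize x + tsize (l x) + 2) ^ k"
      using k[of "(x, h)"] by simp
  qed
qed

section \<open>Folds and list functions\<close>

lemma foldr_conv_rec_list: "foldr f xs z = rec_list z (\<lambda>h t. f h) xs"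
  by (induction xs) auto

text \<open>Growth by at most an amount independent of the accumulator excludes the doubling that
  would make the final size exponential.\<close>

lemma ptime_foldr_additive:
  assumes l: "ptime l" and a: "ptime a" and b: "ptime (\<lambda>p. b (fst p) (fst (snd p)) (snd (snd p)))"
    and N: "poly_bounded N" and step: "\<And>x h r. h \<in> set (l x) \<Longrightarrow> tsize (b x h r) \<le> tsize r + N x"
  shows "ptime (\<lambda>x. foldr (b x) (l x) (a x))"
  unfolding foldr_conv_rec_list
proof (rule ptime_rec_list[OF l a])
  have "ptime (\<lambda>p. (fst p, fst (snd p), snd (snd (snd p))))" by (intro ptime_intros)
  from ptime_comp[OF b this]
  show "ptime (\<lambda>p. b (fst p) (fst (snd p)) (snd (snd (snd p))))" by simp
  show "poly_bounded (\<lambda>x. tsize (a x) + tsize (l x) * N x)" by (intro poly_bounds l a N)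
  fix x s assume s: "suffix s (l x)"
  have "set s \<subseteq> set (l x)" using set_mono_suffix[OF s] .
  then have "tsize (rec_list (a x) (\<lambda>h t. b x h) s) \<le> tsize (a x) + length s * N x"
  proof (induction s)
    case (Cons h s)
    then show ?case using step[of h x "rec_list (a x) (\<lambda>h t. b x h) s"] by auto
  qed simp
  also have "\<dots> \<le> tsize (a x) + tsize (l x) * N x"
    using length_le_tsize[of s] tsize_suffix_le[OF s] by (intro add_left_mono mult_right_mono) auto
  finally show "tsize (rec_list (a x) (\<lambda>h t. b x h) s) \<le> tsize (a x) + tsize (l x) * N x" .
qed

lemma ptime_append [ptime_intros]:
  assumes "ptime f" "ptime g" shows "ptime (\<lambda>x. f x @ g x)"
proof -
  have "xs @ ys = foldr (\<lambda>h r. h # r) xs ys" for xs ys :: "'b list" by (induction xs) auto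
  moreover have "ptime (\<lambda>x. foldr (\<lambda>h r. h # r) (f x) (g x))"
  proof (rule ptime_foldr_additive[where N = "\<lambda>x. tsize (f x)"])
    show "tsize (h # r) \<le> tsize r + tsize (f x)" if "h \<in> set (f x)" for x h r
      using tsize_mem_le[OF that] by simp
  qed (intro assms ptime_intros poly_bounds)+
  ultimately show ?thesis by simp
qed

lemma map_conv_foldr: "map f xs = foldr (\<lambda>h r. f h # r) xs []"
  by (induction xs) auto

lemma ptime_map [ptime_intros]:
  assumes "ptime l" "ptime (\<lambda>p. f (fst p) (snd p))" shows "ptime (\<lambda>x. map (f x) (l x))"
proof -
  obtain N where N: "poly_bounded N" "\<And>x h. h \<in> set (l x) \<Longrightarrow> tsize (f x h) \<le> N x"
    by (rule poly_bounded_step[OF assms]) blast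
  have "ptime (\<lambda>x. foldr (\<lambda>h r. f x h # r) (l x) [])"
  proof (rule ptime_foldr_additive[where N = "\<lambda>x. Suc (N x)"])
    have "ptime (\<lambda>p. (fst p, fst (snd p)))" by (intro ptime_intros)
    from ptime_comp[OF assms(2) this]
    show "ptime (\<lambda>p. f (fst p) (fst (snd p)) # snd (snd p))" by (intro ptime_intros) simp
    show "tsize (f x h # r) \<le> tsize r + Suc (N x)" if "h \<in> set (l x)" for x h r
      using N(2)[OF that] by simp
  qed (intro assms ptime_intros poly_bounds N)+
  then show ?thesis by (simp add: map_conv_foldr)
qed

lemma ptime_filter [ptime_intros]:
  assumes "ptime l" "ptime (\<lambda>p. f (fst p) (snd p))" shows "ptime (\<lambda>x. filter (f x) (l x))"
proof -
  have "filter g xs = foldr (\<lambda>h r. if g h then h # r else r) xs []" for g :: "'b \<Rightarrow> bool" and xs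
    by (induction xs) auto
  moreover have "ptime (\<lambda>x. foldr (\<lambda>h r. if f x h then h # r else r) (l x) [])"
  proof (rule ptime_foldr_additive[where N = "\<lambda>x. tsize (l x)"])
    have "ptime (\<lambda>p. (fst p, fst (snd p)))" by (intro ptime_intros)
    from ptime_comp[OF assms(2) this]
    show "ptime (\<lambda>p. if f (fst p) (fst (snd p)) then fst (snd p) # snd (snd p) else snd (snd p))"
      by (intro ptime_intros) simp
    show "tsize (if f x h then h # r else r) \<le> tsize r + tsize (l x)" if "h \<in> set (l x)" for x h r
      using tsize_mem_le[OF that] by simp
  qed (intro assms ptime_intros poly_bounds)+
  ultimately show ?thesis by simp
qed

lemma ptime_takeWhile [ptime_intros]:
  assumes "ptime l" "ptime (\<lambda>p. f (fst p) (snd p))" shows "ptime (\<lambda>x. takeWhile (f x) (l x))"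
proof -
  have "takeWhile g xs = foldr (\<lambda>h r. if g h then h # r else []) xs []" for g :: "'b \<Rightarrow> bool" and xs
    by (induction xs) auto
  moreover have "ptime (\<lambda>x. foldr (\<lambda>h r. if f x h then h # r else []) (l x) [])"
  proof (rule ptime_foldr_additive[where N = "\<lambda>x. tsize (l x)"])
    have "ptime (\<lambda>p. (fst p, fst (snd p)))" by (intro ptime_intros)
    from ptime_comp[OF assms(2) this]
    show "ptime (\<lambda>p. if f (fst p) (fst (snd p)) then fst (snd p) # snd (snd p) else [])"
      by (intro ptime_intros) simp
    show "tsize (if f x h then h # r else []) \<le> tsize r + tsize (l x)" if "h \<in> set (l x)" for x h r
      using tsize_mem_le[OF that] by simp
  qed (intro assms ptime_intros poly_bounds)+
  ultimately show ?thesis by simp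
qed

lemma ptime_list_ex [ptime_intros]:
  assumes "ptime l" "ptime (\<lambda>p. f (fst p) (snd p))" shows "ptime (\<lambda>x. list_ex (f x) (l x))"
proof -
  have "list_ex g xs \<longleftrightarrow> filter g xs \<noteq> []" for g :: "'b \<Rightarrow> bool" and xs
    by (induction xs) auto
  moreover have "ptime (\<lambda>x. filter (f x) (l x) \<noteq> [])" by (intro ptime_intros assms)
  ultimately show ?thesis by simp
qed

lemma ptime_member [ptime_intros]:
  assumes "ptime f" "ptime l" shows "ptime (\<lambda>x. f x \<in> set (l x))"
proof -
  have "a \<in> set xs \<longleftrightarrow> list_ex (\<lambda>b. a = b) xs" for a :: 'b and xs by (induction xs) auto
  moreover have "ptime (\<lambda>x. list_ex (\<lambda>b. f x = b) (l x))"
    by (intro ptime_intros assms ptime_comp[OF assms(1)])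
  ultimately show ?thesis by simp
qed

lemma ptime_rev [ptime_intros]:
  assumes "ptime l" shows "ptime (\<lambda>x. rev (l x))"
proof -
  have "rev xs = foldr (\<lambda>h r. r @ [h]) xs []" for xs :: "'b list" by (induction xs) auto
  moreover have "ptime (\<lambda>x. foldr (\<lambda>h r. r @ [h]) (l x) [])"
  proof (rule ptime_foldr_additive[where N = "\<lambda>x. tsize (l x)"])
    show "tsize (r @ [h]) \<le> tsize r + tsize (l x)" if "h \<in> set (l x)" for x h r
      using tsize_mem_le[OF that] by simp
  qed (intro assms ptime_intros poly_bounds)+
  ultimately show ?thesis by simp
qed

text \<open>For loops whose size bound is not additive by itself: the invariant \<open>J\<close>,
  indexed by the number of elements consumed, may also restrict the entries of the state. A left
  fold is a recursion on the reversed list, and suffixes of that list are prefixes of the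
  original.\<close>

lemma ptime_foldl_indexed:
  assumes l: "ptime l" and a: "ptime a" and b: "ptime (\<lambda>p. b (fst p) (snd (snd p)) (fst (snd p)))"
    and N: "poly_bounded N"
    and J: "\<And>x. J x 0 (a x)"
      "\<And>x i r. i < length (l x) \<Longrightarrow> J x i r \<Longrightarrow> J x (Suc i) (b x r (l x ! i))"
      "\<And>x i r. i \<le> length (l x) \<Longrightarrow> J x i r \<Longrightarrow> tsize r \<le> N x"
  shows "ptime (\<lambda>x. foldl (b x) (a x) (l x))"
proof -
  have rec: "foldl f z xs = rec_list z (\<lambda>h t r. f r h) (rev xs)" for f z xs
    by (simp add: foldl_conv_foldr foldr_conv_rec_list)
  have "ptime (\<lambda>x. rec_list (a x) (\<lambda>h t r. b x r h) (rev (l x)))"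
  proof (rule ptime_rec_list[where N = N])
    have "ptime (\<lambda>p. (fst p, fst (snd p), snd (snd (snd p))))" by (intro ptime_intros)
    from ptime_comp[OF b this]
    show "ptime (\<lambda>p. b (fst p) (snd (snd (snd p))) (fst (snd p)))" by simp
    fix x s assume "suffix s (rev (l x))"
    then have "prefix (rev s) (l x)" by (simp add: suffix_to_prefix)
    then obtain i where i: "i \<le> length (l x)" "rev s = take i (l x)"
      by (metis prefix_length_le prefixE append_eq_conv_conj)
    have "J x i (foldl (b x) (a x) (take i (l x)))"
      using i(1) by (induction i) (simp_all add: J(1) J(2) take_Suc_conv_app_nth)
    then have "tsize (foldl (b x) (a x) (rev s)) \<le> N x" using J(3) i by simp
    then show "tsize (rec_list (a x) (\<lambda>h t r. b x r h) s) \<le> N x" by (simp add: rec)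
  qed (intro ptime_intros l a N)+
  then show ?thesis by (simp add: rec)
qed

text \<open>A number and a list of as many units are the same tree, so that functions on lists
  transfer to numbers at no cost.\<close>

lemma to_tree_units: "to_tree (replicate n ()) = to_tree n"
  by (induction n) auto

lemma ptime_length [ptime_intros]:
  assumes "ptime l" shows "ptime (\<lambda>x. length (l x))"
proof -
  have "to_tree (length xs) = to_tree (map (\<lambda>_. ()) xs)" for xs :: "'b list"
    by (induction xs) auto
  then show ?thesis by (intro ptime_cong_tree[OF ptime_map[OF assms ptime_const[of "()"]]]) simp
qed

lemma ptime_units: "ptime n \<Longrightarrow> ptime (\<lambda>x. replicate (n x) ())"
  by (erule ptime_cong_tree) (simp add: to_tree_units)

lemma ptime_case_nat [ptime_intros]:
  fixes n :: "'a::tree_encodable \<Rightarrow> nat" and a :: "'a \<Rightarrow> 'b::tree_encodable"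
  assumes "ptime n" "ptime a" "ptime (\<lambda>p. b (fst p) (snd p))"
  shows "ptime (\<lambda>x. case n x of 0 \<Rightarrow> a x | Suc m \<Rightarrow> b x m)"
proof -
  have "ptime (\<lambda>p. (fst p, length (snd (snd p))))"
    for p :: "'a \<times> unit \<times> unit list" by (intro ptime_intros)
  from ptime_comp[OF assms(3) this]
  have "ptime (\<lambda>p::'a \<times> unit \<times> unit list. b (fst p) (length (snd (snd p))))" by simp
  then have "ptime (\<lambda>x. case replicate (n x) () of [] \<Rightarrow> a x | u # us \<Rightarrow> b x (length us))"
    by (intro ptime_intros ptime_units assms)
  moreover have "(case k of 0 \<Rightarrow> c | Suc m \<Rightarrow> d m) =
      (case replicate k () of [] \<Rightarrow> c | u # us \<Rightarrow> d (length us))" for k and c :: 'b and d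
    by (cases k) auto
  ultimately show ?thesis by simp
qed

lemma ptime_funpow_indexed:
  fixes n :: "'a::tree_encodable \<Rightarrow> nat" and a :: "'a \<Rightarrow> 'b::tree_encodable" and b :: "'a \<Rightarrow> 'b \<Rightarrow> 'b"
  assumes "ptime n" "ptime a" "ptime (\<lambda>p. b (fst p) (snd p))" "poly_bounded N"
    and J: "\<And>x. J x 0 (a x)" "\<And>x i r. i < n x \<Longrightarrow> J x i r \<Longrightarrow> J x (Suc i) (b x r)"
      "\<And>x i r. i \<le> n x \<Longrightarrow> J x i r \<Longrightarrow> tsize r \<le> N x"
  shows "ptime (\<lambda>x. (b x ^^ n x) (a x))"
proof -
  have conv: "(f ^^ k) z = foldl (\<lambda>r u. f r) z (replicate k ())" for f :: "'b \<Rightarrow> 'b" and k z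
    by (induction k arbitrary: z) (simp_all add: funpow_Suc_right del: funpow.simps(2))
  have "ptime (\<lambda>x. foldl (\<lambda>r u. b x r) (a x) (replicate (n x) ()))"
  proof (rule ptime_foldl_indexed[where N = N and J = J])
    have "ptime (\<lambda>p :: 'a \<times> unit \<times> 'b. (fst p, snd (snd p)))" by (intro ptime_intros)
    from ptime_comp[OF assms(3) this]
    show "ptime (\<lambda>p :: 'a \<times> unit \<times> 'b. b (fst p) (snd (snd p)))" by simp
  qed (use assms ptime_units in auto)
  then show ?thesis by (simp only: conv)
qed

lemma ptime_funpow_additive:
  fixes n :: "'a::tree_encodable \<Rightarrow> nat" and a :: "'a \<Rightarrow> 'b::tree_encodable" and b :: "'a \<Rightarrow> 'b \<Rightarrow> 'b"
  assumes n: "ptime n" and a: "ptime a" and b: "ptime (\<lambda>p. b (fst p) (snd p))" and N: "poly_bounded N"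
    and step: "\<And>x r. tsize (b x r) \<le> tsize r + N x"
  shows "ptime (\<lambda>x. (b x ^^ n x) (a x))"
proof (rule ptime_funpow_indexed[OF n a b, where J = "\<lambda>x i r. tsize r \<le> tsize (a x) + i * N x" and
      N = "\<lambda>x. tsize (a x) + tsize (n x) * N x"])
  show "poly_bounded (\<lambda>x. tsize (a x) + tsize (n x) * N x)" by (intro poly_bounds n a N)
  fix x i and r :: 'b
  assume J: "tsize r \<le> tsize (a x) + i * N x"
  then show "tsize (b x r) \<le> tsize (a x) + Suc i * N x" using step[of x r] by simp
  assume "i \<le> n x"
  then have "i \<le> tsize (n x)" by simp
  then have "i * N x \<le> tsize (n x) * N x" by (rule mult_right_mono) simp
  then show "tsize r \<le> tsize (a x) + tsize (n x) * N x" using J by linarith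
qed simp

section \<open>Arithmetic and list access\<close>

lemma ptime_add [ptime_intros]:
  fixes f g :: "'a::tree_encodable \<Rightarrow> nat"
  assumes "ptime f" "ptime g" shows "ptime (\<lambda>x. f x + g x)"
proof -
  have "ptime (\<lambda>x. length (replicate (f x) () @ replicate (g x) ()))"
    by (intro ptime_intros ptime_units assms)
  then show ?thesis by simp
qed

lemma ptime_diff [ptime_intros]:
  fixes f g :: "'a::tree_encodable \<Rightarrow> nat"
  assumes "ptime f" "ptime g" shows "ptime (\<lambda>x. f x - g x)"
proof -
  have "m - n = ((\<lambda>r. case r of 0 \<Rightarrow> 0 | Suc k \<Rightarrow> k) ^^ n) m" for m n :: nat
    by (induction n) (auto split: nat.split)
  moreover have "ptime (\<lambda>x. ((\<lambda>r. case r of 0 \<Rightarrow> 0 | Suc k \<Rightarrow> k) ^^ g x) (f x))"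
    by (rule ptime_funpow_additive[where N = "\<lambda>_. 0"])
       (intro ptime_intros poly_bounds assms | simp split: nat.split)+
  ultimately show ?thesis by simp
qed

lemma ptime_mult [ptime_intros]:
  fixes f g :: "'a::tree_encodable \<Rightarrow> nat"
  assumes "ptime f" "ptime g" shows "ptime (\<lambda>x. f x * g x)"
proof -
  have "m * n = ((\<lambda>r. n + r) ^^ m) 0" for m n :: nat by (induction m) auto
  moreover have "ptime (\<lambda>x. ((\<lambda>r. g x + r) ^^ f x) 0)"
    by (rule ptime_funpow_additive[where N = "\<lambda>x. tsize (g x)"])
       (intro ptime_intros poly_bounds assms ptime_comp[OF assms(2)] | simp)+
  ultimately show ?thesis by simp
qed

lemma ptime_le [ptime_intros]:
  fixes f g :: "'a::tree_encodable \<Rightarrow> nat"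
  assumes "ptime f" "ptime g" shows "ptime (\<lambda>x. f x \<le> g x)"
proof -
  have "ptime (\<lambda>x. f x - g x = 0)" by (intro ptime_intros assms)
  then show ?thesis by simp
qed

lemma ptime_less [ptime_intros]:
  fixes f g :: "'a::tree_encodable \<Rightarrow> nat"
  assumes "ptime f" "ptime g" shows "ptime (\<lambda>x. f x < g x)"
  using ptime_le[OF ptime_Suc[OF assms(1)] assms(2)] by (simp add: Suc_le_eq)

lemma ptime_min [ptime_intros]:
  fixes f g :: "'a::tree_encodable \<Rightarrow> nat"
  assumes "ptime f" "ptime g" shows "ptime (\<lambda>x. min (f x) (g x))"
  unfolding min_def by (intro ptime_intros assms)

lemma ptime_tl [ptime_intros]: assumes "ptime f" shows "ptime (\<lambda>x. tl (f x))"
proof -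
  have "ptime (\<lambda>x. case f x of [] \<Rightarrow> [] | y # ys \<Rightarrow> ys)" by (intro ptime_intros assms)
  moreover have "tl ys = (case ys of [] \<Rightarrow> [] | z # zs \<Rightarrow> zs)" for ys :: "'b list" by (cases ys) auto
  ultimately show ?thesis by simp
qed

lemma ptime_drop [ptime_intros]:
  assumes "ptime n" "ptime l" shows "ptime (\<lambda>x. drop (n x) (l x))"
proof -
  have "drop k ys = (tl ^^ k) ys" for k and ys :: "'b list"
    by (induction k) (simp_all add: drop_Suc tl_drop[symmetric])
  moreover have "ptime (\<lambda>x. (tl ^^ n x) (l x))"
  proof (rule ptime_funpow_additive[where N = "\<lambda>_. 0"])
    show "tsize (tl r) \<le> tsize r + 0" for r :: "'b list" by (cases r) auto
  qed (intro ptime_intros poly_bounds assms)+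
  ultimately show ?thesis by simp
qed

lemma ptime_take [ptime_intros]:
  assumes "ptime n" "ptime l" shows "ptime (\<lambda>x. take (n x) (l x))"
proof -
  have "ptime (\<lambda>x. rev (drop (length (l x) - n x) (rev (l x))))" by (intro ptime_intros assms)
  moreover have "rev (drop (length ys - k) (rev ys)) = take k ys" for k and ys :: "'b list"
    by (simp add: rev_drop) (metis diff_diff_cancel diff_is_0_eq diff_zero nle_le take_all_iff)
  ultimately show ?thesis by simp
qed

lemma ptime_upt [ptime_intros]: assumes "ptime n" shows "ptime (\<lambda>x. [0..<n x])"
proof -
  have "[0..<k] = ((\<lambda>r. r @ [length r]) ^^ k) []" for k
    by (induction k) (simp, metis comp_apply diff_zero funpow.simps(2) length_upt upt_Suc_append zero_le)
  moreover have "ptime (\<lambda>x. ((\<lambda>r. r @ [length r]) ^^ n x) [])"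
  proof (rule ptime_funpow_indexed[where N = "\<lambda>x. tsize (n x) * Suc (tsize (n x))" and
        J = "\<lambda>x i r. length r = i \<and> (\<forall>j\<in>set r. j \<le> n x)"])
    show "tsize r \<le> tsize (n x) * Suc (tsize (n x))"
      if "i \<le> n x" "length r = i \<and> (\<forall>j\<in>set r. j \<le> n x)" for x i and r :: "nat list"
    proof -
      have "tsize r \<le> length r * Suc (n x)" using that by (intro tsize_list_le) simp
      also have "\<dots> \<le> n x * Suc (n x)" using that by (intro mult_right_mono) auto
      finally show ?thesis by simp
    qed
  qed (intro ptime_intros poly_bounds assms | simp)+
  ultimately show ?thesis by simp
qed

text \<open>The algorithms also have to be total on bit strings that encode nothing, where positions
  may be out of range; the default value makes such an access computable.\<close>

definition get :: "'a \<Rightarrow> 'a list \<Rightarrow> nat \<Rightarrow> 'a" where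
  "get d xs n = (case drop n xs of [] \<Rightarrow> d | y # ys \<Rightarrow> y)"

lemma get_nth [simp]: "n < length xs \<Longrightarrow> get d xs n = xs ! n"
  by (simp add: get_def Cons_nth_drop_Suc[symmetric])

lemma get_default: "n \<ge> length xs \<Longrightarrow> get d xs n = d"
  by (simp add: get_def)

lemma ptime_get [ptime_intros]:
  "ptime d \<Longrightarrow> ptime l \<Longrightarrow> ptime n \<Longrightarrow> ptime (\<lambda>x. get (d x) (l x) (n x))"
  unfolding get_def by (intro ptime_intros)

lemma ptime_remdups [ptime_intros]:
  assumes "ptime l" shows "ptime (\<lambda>x. remdups (l x))"
proof -
  have "set (foldr (\<lambda>h r. if h \<in> set r then r else h # r) xs []) = set xs" for xs :: "'b list"
    by (induction xs) auto
  then have "remdups xs = foldr (\<lambda>h r. if h \<in> set r then r else h # r) xs []" for xs :: "'b list"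
    by (induction xs) auto
  moreover have "ptime (\<lambda>x. foldr (\<lambda>h r. if h \<in> set r then r else h # r) (l x) [])"
  proof (rule ptime_foldr_additive[where N = "\<lambda>x. tsize (l x)"])
    show "tsize (if h \<in> set r then r else h # r) \<le> tsize r + tsize (l x)" if "h \<in> set (l x)" for x h r
      using tsize_mem_le[OF that] by simp
  qed (intro assms ptime_intros poly_bounds)+
  ultimately show ?thesis by simp
qed

text \<open>\<open>runs_in\<close> enters a program at function 0, so the main expression is put in
  front as a body and all calls move up by one.\<close>

lemma poly_time_computableI:
  fixes F :: "bool list \<Rightarrow> bool list"
  assumes F: "ptime F" and enc: "\<And>d. d \<in> D \<Longrightarrow> F (enc d) = f d"
  shows "poly_time_computable enc D f"
proof -
  obtain Q e k where "evals_within Q e k F" by (rule ptime_evals_within[OF F])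
  from evals_within_append_left[OF this, of "[shift_calls 1 e]"]
  have k: "evals_within ([shift_calls 1 e] @ map (shift_calls 1) Q) (shift_calls 1 e) k F" by simp
  let ?Q = "[shift_calls 1 e] @ map (shift_calls 1) Q"
  \<comment> \<open>A bit string of length n has at most 2 n cells, and (2 n + 2)^k <= (4 n)^k for n
    >= 1, whence the factor. The added constant covers n = 0 and the 2 steps of the initial
    call.\<close>
  have "\<exists>t. runs_in ?Q (enc d) (f d) t \<and> t \<le> (2 ^ (2 * k) + 2) * length (enc d) ^ k + (2 ^ (2 * k) + 2)"
    if "d \<in> D" for d
  proof -
    let ?n = "length (enc d)"
    obtain t where t: "t \<le> (2 * ?n + 2) ^ k"
      "eval ?Q [to_tree (enc d)] (shift_calls 1 e) (to_tree (F (enc d))) t"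
      using evals_withinD[OF k tsize_bits[of "enc d"]] by blast
    have "eval ?Q [to_tree (enc d)] (CallE 0 [Arg 0]) (to_tree (F (enc d))) (1 + (1 + 0) + t)"
      by (rule eval_Call[OF evals_Cons[OF eval_Arg evals_Nil]]) (use t(2) in auto)
    then have "runs_in ?Q (enc d) (f d) (2 + t)"
      using enc[OF that] by (simp add: runs_in_def to_tree_bits add_2_eq_Suc)
    moreover have "(2 * ?n + 2) ^ k \<le> 2 ^ (2 * k) * ?n ^ k + 2 ^ (2 * k)"
    proof (cases "?n = 0")
      case True
      have "(2::nat) ^ k \<le> 2 ^ (2 * k)" by (rule power_increasing) auto
      then show ?thesis using True by (simp add: trans_le_add2)
    next
      case False
      then have "1 \<le> ?n" by (simp add: Suc_le_eq)
      then have "(2 * ?n + 2) ^ k \<le> (4 * ?n) ^ k" by (intro power_mono) linarith+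
      also have "\<dots> = 2 ^ (2 * k) * ?n ^ k" by (simp add: power_mult_distrib power_mult)
      finally show ?thesis by simp
    qed
    ultimately show ?thesis using t(1) by (intro exI[of _ "2 + t"]) (auto simp: algebra_simps)
  qed
  then show ?thesis unfolding poly_time_computable_def by blast
qed

section \<open>Bipartite matching by an auction\<close>

text \<open>The queue of left vertices still to bid, and for every right vertex its price and its
  owner, kept as a list with at most one entry.\<close>

type_synonym ('l, 'r) bidding = "'l list \<times> ('r \<times> nat \<times> 'l list) list"

text \<open>One bid of an ascending auction with unit increments. The filter keeps the cheapest
  neighbours priced below \<open>N\<close>, a displaced owner returns to the queue, and a bidder
  without candidates leaves for good.\<close>

definition auction_step ::
  "('l \<Rightarrow> 'r \<Rightarrow> bool) \<Rightarrow> nat \<Rightarrow> ('l, 'r) bidding \<Rightarrow> ('l, 'r) bidding" where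
  "auction_step adj N s = (case fst s of [] \<Rightarrow> s | u # W \<Rightarrow>
     (case filter (\<lambda>e. adj u (fst e) \<and> fst (snd e) < N \<and>
            \<not> list_ex (\<lambda>e'. adj u (fst e') \<and> fst (snd e') < fst (snd e)) (snd s)) (snd s) of
        [] \<Rightarrow> (W, snd s)
      | e # _ \<Rightarrow> (snd (snd e) @ W,
          map (\<lambda>e'. if fst e' = fst e then (fst e, Suc (fst (snd e)), [u]) else e') (snd s))))"

text \<open>The number of rounds is the initial value of \<open>auction_measure\<close>, which
  decreases in every round with a nonempty queue. The limit for prices exceeds the number of right
  vertices by one, as the level argument for the cover requires.\<close>

definition auction :: "('l \<Rightarrow> 'r \<Rightarrow> bool) \<Rightarrow> 'l list \<Rightarrow> 'r list \<Rightarrow> ('r \<times> nat \<times> 'l list) list" where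
  "auction adj L R = snd ((auction_step adj (Suc (length R)) ^^ (length L + Suc (length R) * length R))
     (L, map (\<lambda>v. (v, 0, [])) R))"

definition matching_size :: "('l \<Rightarrow> 'r \<Rightarrow> bool) \<Rightarrow> 'l list \<Rightarrow> 'r list \<Rightarrow> nat" where
  "matching_size adj L R = length (filter (\<lambda>e. snd (snd e) \<noteq> []) (auction adj L R))"

context
  fixes adj :: "'l \<Rightarrow> 'r \<Rightarrow> bool" and N :: nat and L :: "'l list" and R :: "'r list"
  assumes distinct_L: "distinct L" and distinct_R: "distinct R"
begin

text \<open>A single rule serves as a named conjunction. Its heart is complementary slackness up to
  one unit: an owner paid at most one more than the current price of any neighbour. Once taken, a
  right vertex is never released, so a positive price implies an owner. The last clause concerns
  left vertices that gave up.\<close>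

inductive auction_inv :: "'l list \<Rightarrow> ('r \<times> nat \<times> 'l list) list \<Rightarrow> bool" where
  auction_invI: "auction_inv W S"
    if "map fst S = R" "distinct W" "set W \<subseteq> set L"
      "\<And>v p us. (v, p, us) \<in> set S \<Longrightarrow> length us \<le> 1 \<and> p \<le> N \<and> (p > 0 \<longrightarrow> us \<noteq> []) \<and>
        set us \<subseteq> set L \<and> set us \<inter> set W = {}"
      "\<And>v p us u w q vs. (v, p, us) \<in> set S \<Longrightarrow> u \<in> set us \<Longrightarrow> (w, q, vs) \<in> set S \<Longrightarrow>
        adj u v \<and> (adj u w \<longrightarrow> p \<le> Suc q)"
      "\<And>v p us w q vs. (v, p, us) \<in> set S \<Longrightarrow> (w, q, vs) \<in> set S \<Longrightarrow> v \<noteq> w \<Longrightarrow> set us \<inter> set vs = {}"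
      "\<And>u w q vs. u \<in> set L \<Longrightarrow> u \<notin> set W \<Longrightarrow> (\<And>v p us. (v, p, us) \<in> set S \<Longrightarrow> u \<notin> set us) \<Longrightarrow>
        (w, q, vs) \<in> set S \<Longrightarrow> adj u w \<Longrightarrow> q \<ge> N"

lemma auction_invD:
  assumes "auction_inv W S"
  shows "map fst S = R" "distinct W" "set W \<subseteq> set L"
    "\<And>v p us. (v, p, us) \<in> set S \<Longrightarrow> length us \<le> 1 \<and> p \<le> N \<and> (p > 0 \<longrightarrow> us \<noteq> []) \<and>
        set us \<subseteq> set L \<and> set us \<inter> set W = {}"
    "\<And>v p us u w q vs. (v, p, us) \<in> set S \<Longrightarrow> u \<in> set us \<Longrightarrow> (w, q, vs) \<in> set S \<Longrightarrow>
        adj u v \<and> (adj u w \<longrightarrow> p \<le> Suc q)"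
    "\<And>v p us w q vs. (v, p, us) \<in> set S \<Longrightarrow> (w, q, vs) \<in> set S \<Longrightarrow> v \<noteq> w \<Longrightarrow> set us \<inter> set vs = {}"
    "\<And>u w q vs. u \<in> set L \<Longrightarrow> u \<notin> set W \<Longrightarrow> (\<And>v p us. (v, p, us) \<in> set S \<Longrightarrow> u \<notin> set us) \<Longrightarrow>
        (w, q, vs) \<in> set S \<Longrightarrow> adj u w \<Longrightarrow> q \<ge> N"
  by - (rule auction_inv.cases[OF assms], hypsubst, (assumption | blast | meson))+

lemma auction_inv_init: "auction_inv L (map (\<lambda>v. (v, 0, [])) R)"
  by (rule auction_invI) (auto simp: distinct_L comp_def)

definition auction_measure :: "('l, 'r) bidding \<Rightarrow> nat" where
  "auction_measure s = length (fst s) + (\<Sum>e\<leftarrow>snd s. N - fst (snd e))"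

lemma entry_unique:
  "map fst S = R \<Longrightarrow> (v, a) \<in> set S \<Longrightarrow> (v, b) \<in> set S \<Longrightarrow> a = b"
  using distinct_R eq_key_imp_eq_value[of S v a b] by auto

text \<open>A bid raises a price that was below \<open>N\<close> and puts at most one displaced
  owner in place of the bidder; giving up shortens the queue and leaves the prices alone.\<close>

lemma auction_step_props:
  assumes inv: "auction_inv (fst s) (snd s)" and ne: "fst s \<noteq> []"
  shows "auction_inv (fst (auction_step adj N s)) (snd (auction_step adj N s)) \<and> auction_measure (auction_step adj N s) < auction_measure s"
proof -
  obtain u W S where s: "s = (u # W, S)" using ne by (cases s; cases "fst s") auto
  define C where "C = filter (\<lambda>e. adj u (fst e) \<and> fst (snd e) < N \<and>
            \<not> list_ex (\<lambda>e'. adj u (fst e') \<and> fst (snd e') < fst (snd e)) S) S"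
  have step: "auction_step adj N s = (case C of [] \<Rightarrow> (W, S) | e # _ \<Rightarrow> (snd (snd e) @ W,
          map (\<lambda>e'. if fst e' = fst e then (fst e, Suc (fst (snd e)), [u]) else e') S))"
    unfolding auction_step_def s C_def fst_conv snd_conv list.case ..
  have keys: "map fst S = R" using auction_invD(1)[OF inv] by (simp add: s)
  note uniq = entry_unique[OF keys]
  show ?thesis
  proof (cases C)
    case Nil
    have st: "auction_step adj N s = (W, S)"
      using Nil by (simp add: step)
    \<comment> \<open>A cheapest neighbour priced below \<open>N\<close> would be a candidate;
      without candidates all neighbours have reached \<open>N\<close>.\<close>
    have high: "q \<ge> N" if "(w, q, us) \<in> set S" "adj u w" for w q us
    proof (rule ccontr)
      assume "\<not> q \<ge> N"
      let ?A = "{e \<in> set S. adj u (fst e) \<and> fst (snd e) < N}"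
      have "?A \<noteq> {}" "finite ?A" using that \<open>\<not> q \<ge> N\<close> by force+
      then obtain e where e: "e \<in> ?A" "\<forall>e'\<in>?A. fst (snd e) \<le> fst (snd e')"
        using arg_min_if_finite[of ?A "\<lambda>e. fst (snd e)"] by (metis (no_types, lifting) not_le)
      then have "e \<in> set C" unfolding C_def by (auto simp: list_ex_iff) (metis leD less_trans)
      then show False using Nil by simp
    qed
    note I = auction_invD[OF inv, unfolded s fst_conv snd_conv]
    have "auction_inv W S"
    proof (rule auction_invI)
      show "q \<ge> N" if "u' \<in> set L" "u' \<notin> set W" "\<And>v p us. (v, p, us) \<in> set S \<Longrightarrow> u' \<notin> set us"
          "(w, q, vs) \<in> set S" "adj u' w" for u' w q vs
        using high[OF that(4)] that I(7)[of u' w q vs] by (cases "u' = u") auto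
    qed (use I(1-3) I(4) I(5) I(6) in \<open>simp | blast\<close>)+
    then show ?thesis unfolding st by (simp add: s auction_measure_def)
  next
    case (Cons e C')
    obtain v p us where e: "e = (v, p, us)" by (cases e)
    have "e \<in> set C" using Cons by simp
    then have eS: "(v, p, us) \<in> set S" and adj: "adj u v" and pN: "p < N"
      and minp: "\<And>w q vs. (w, q, vs) \<in> set S \<Longrightarrow> adj u w \<Longrightarrow> p \<le> q"
      unfolding C_def e by (force simp: list_ex_iff)+
    define S' where "S' = map (\<lambda>e'. if fst e' = v then (v, Suc p, [u]) else e') S"
    have st: "auction_step adj N s = (us @ W, S')"
      unfolding step Cons S'_def e by simp
    have S': "x \<in> set S' \<longleftrightarrow> x = (v, Suc p, [u]) \<or> (x \<in> set S \<and> fst x \<noteq> v)" for x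
      unfolding S'_def using eS by force
    have vs1: "vs = us" "q = p" if "(v, q, vs) \<in> set S" for q vs using uniq[OF eS that] by auto
    note I = auction_invD(2-)[OF inv, unfolded s fst_conv snd_conv]
    have "distinct us" using I(3)[OF eS] by (cases us) (auto simp: Suc_le_eq le_Suc_eq)
    have "auction_inv (us @ W) S'"
    proof (rule auction_invI)
      have "map fst S' = map fst S" unfolding S'_def by (simp add: comp_def)
      then show "map fst S' = R" using keys by simp
      show "distinct (us @ W)" using I(1) I(3)[OF eS] \<open>distinct us\<close> by auto
      show "set (us @ W) \<subseteq> set L" using I(2) I(3)[OF eS] by auto
    next
      fix w q vs assume x: "(w, q, vs) \<in> set S'"
      show "length vs \<le> 1 \<and> q \<le> N \<and> (q > 0 \<longrightarrow> vs \<noteq> []) \<and> set vs \<subseteq> set L \<and> set vs \<inter> set (us @ W) = {}"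
      proof (cases "w = v")
        case True
        with x S' have x': "q = Suc p" "vs = [u]" by auto
        have "u \<notin> set us" "u \<notin> set W" using I(1) I(3)[OF eS] by auto
        then show ?thesis using x' pN I(2) by auto
      next
        case False
        with x S' have xS: "(w, q, vs) \<in> set S" by auto
        then show ?thesis using I(3)[OF xS] I(5)[OF xS eS False] by auto
      qed
      fix u' w' q' vs' assume y: "u' \<in> set vs" "(w', q', vs') \<in> set S'"
      show "adj u' w \<and> (adj u' w' \<longrightarrow> q \<le> Suc q')"
      proof (cases "w = v")
        case True
        with x S' have x': "q = Suc p" "vs = [u]" by auto
        \<comment> \<open>The bidder chose a cheapest neighbour and prices never fall, so its new
          price exceeds that of no other neighbour by more than one.\<close>
        have "Suc p \<le> Suc q'" if "adj u w'"
          using y(2) that minp unfolding S' by auto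
        then show ?thesis using True x' y(1) adj by auto
      next
        case False
        with x S' have xS: "(w, q, vs) \<in> set S" by auto
        have "q \<le> Suc q'" if "adj u' w'"
        proof (cases "w' = v")
          case True
          then have "q' = Suc p" using y(2) S' by auto
          then show ?thesis using I(4)[OF xS y(1) eS] that True by auto
        next
          case False
          then show ?thesis using y(2) S' I(4)[OF xS y(1)] that by auto
        qed
        then show ?thesis using I(4)[OF xS y(1) eS] by blast
      qed
    next
      fix w q vs w' q' vs' assume x: "(w, q, vs) \<in> set S'" "(w', q', vs') \<in> set S'" "w \<noteq> w'"
      have u: "u \<notin> set vs" if "(w, q, vs) \<in> set S" for w q vs using I(3)[OF that] by auto
      show "set vs \<inter> set vs' = {}"
        using x u I(5)[of w q vs w' q' vs'] unfolding S' by auto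
    next
      fix u' w q vs
      assume h: "u' \<in> set L" "u' \<notin> set (us @ W)" "\<And>v p us. (v, p, us) \<in> set S' \<Longrightarrow> u' \<notin> set us"
        "(w, q, vs) \<in> set S'" "adj u' w"
      have "u' \<noteq> u" using h(3)[of v "Suc p" "[u]"] unfolding S' by auto
      moreover have "u' \<notin> set vs" if "(w, q, vs) \<in> set S" for w q vs
        using h(2) h(3)[of w q vs] vs1 that unfolding S' by (cases "w = v") auto
      ultimately have low: "\<And>w q vs. (w, q, vs) \<in> set S \<Longrightarrow> adj u' w \<Longrightarrow> q \<ge> N"
        using I(6)[of u'] h(1,2) by auto
      show "q \<ge> N" using h(4,5) low[of w q vs] low[OF eS] pN unfolding S' by auto
    qed
    moreover have "auction_measure (us @ W, S') < auction_measure s"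
    proof -
      have "(\<Sum>e\<leftarrow>S'. N - fst (snd e)) < (\<Sum>e\<leftarrow>S. N - fst (snd e))"
      proof -
        obtain S1 S2 where split: "S = S1 @ (v, p, us) # S2" using eS split_list by metis
        have d: "v \<notin> fst ` set S1" "v \<notin> fst ` set S2"
          using distinct_R unfolding keys[symmetric] split by simp_all
        then have "map (\<lambda>e'. if fst e' = v then (v, Suc p, [u]) else e') S1 = S1"
          "map (\<lambda>e'. if fst e' = v then (v, Suc p, [u]) else e') S2 = S2"
          by (intro map_idI, metis image_eqI)+
        then show ?thesis unfolding S'_def split using pN by simp
      qed
      then show ?thesis using I(3)[OF eS] by (simp add: auction_measure_def s)
    qed
    ultimately show ?thesis by (simp add: st)
  qed
qed

lemma auction_step_done: "fst s = [] \<Longrightarrow> auction_step adj N s = s"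
  by (simp add: auction_step_def)

lemma auction_run:
  assumes "auction_inv (fst s) (snd s)"
  shows "auction_inv (fst ((auction_step adj N ^^ k) s)) (snd ((auction_step adj N ^^ k) s)) \<and>
    (auction_measure s \<le> k \<longrightarrow> fst ((auction_step adj N ^^ k) s) = [])"
proof -
  have "auction_inv (fst ((auction_step adj N ^^ k) s)) (snd ((auction_step adj N ^^ k) s)) \<and>
     (fst ((auction_step adj N ^^ k) s) = [] \<or> auction_measure ((auction_step adj N ^^ k) s) + k \<le> auction_measure s)"
  proof (induction k)
    case (Suc k)
    let ?s = "(auction_step adj N ^^ k) s"
    show ?case
    proof (cases "fst ?s = []")
      case True
      then show ?thesis using Suc by (simp add: auction_step_done)
    next
      case False
      have "(auction_step adj N ^^ Suc k) s = auction_step adj N ?s" by simp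
      then show ?thesis using Suc False auction_step_props[of ?s] by simp
    qed
  qed (use assms in simp)
  moreover have "fst s' = []" if "auction_measure s' + k \<le> m" "m \<le> k" for s' m
  proof -
    have "length (fst s') = 0" using that unfolding auction_measure_def by linarith
    then show ?thesis by simp
  qed
  ultimately show ?thesis by blast
qed

text \<open>
  There are more price levels than right vertices, so some level \<open>\<ell>\<close> is the price of none of
  them. No edge leads from an owner of a right vertex above \<open>\<ell>\<close>, or from a left vertex that gave
  up, to a right vertex below \<open>\<ell>\<close>.
\<close>

lemma auction_cover:
  assumes inv: "auction_inv [] S" and N: "N = Suc (length R)"
  defines "M \<equiv> {(u, v). \<exists>p us. (v, p, us) \<in> set S \<and> u \<in> set us}"
  shows "\<exists>CL CR. M \<subseteq> set L \<times> set R \<and> (\<forall>(u, v)\<in>M. adj u v) \<and> inj_on fst M \<and> inj_on snd M \<and>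
    card M = length (filter (\<lambda>e. snd (snd e) \<noteq> []) S) \<and>
    CL \<subseteq> set L \<and> CR \<subseteq> set R \<and> (\<forall>u\<in>set L. \<forall>v\<in>set R. adj u v \<longrightarrow> u \<in> CL \<or> v \<in> CR) \<and>
    card CL + card CR \<le> card M"
proof -
  note keys = auction_invD(1)[OF inv] and I = auction_invD(4-7)[OF inv]
  note uniq = entry_unique[OF keys]
  have R: "set R = fst ` set S" using keys by (metis set_map)
  have finM: "finite M" and sub_M: "M \<subseteq> set L \<times> set R"
  proof -
    show "M \<subseteq> set L \<times> set R" unfolding M_def R using I(1) by force
    then show "finite M" by (rule finite_subset) simp
  qed
  have single: "us = [u]" if "(v, p, us) \<in> set S" "u \<in> set us" for u v p us
    using I(1)[OF that(1)] that(2) by (cases us) auto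
  have inj1: "inj_on fst M"
  proof (rule inj_onI)
    fix x y assume xy: "x \<in> M" "y \<in> M" "fst x = fst y"
    then obtain u v p us v' p' us' where "x = (u, v)" "y = (u, v')" "(v, p, us) \<in> set S" "u \<in> set us"
      "(v', p', us') \<in> set S" "u \<in> set us'" unfolding M_def by auto
    then show "x = y" using I(3)[of v p us v' p' us'] by blast
  qed
  have inj2: "inj_on snd M"
  proof (rule inj_onI)
    fix x y assume xy: "x \<in> M" "y \<in> M" "snd x = snd y"
    then obtain u v p us u' p' us' where "x = (u, v)" "y = (u', v)" "(v, p, us) \<in> set S" "u \<in> set us"
      "(v, p', us') \<in> set S" "u' \<in> set us'" unfolding M_def by auto
    then show "x = y" using uniq[of v "(p, us)" "(p', us')"] single[of v p us u] single[of v p us u'] by auto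
  qed
  have cardM: "card M = length (filter (\<lambda>e. snd (snd e) \<noteq> []) S)"
  proof -
    let ?F = "filter (\<lambda>e. snd (snd e) \<noteq> []) S"
    have "distinct (map fst ?F)" by (rule distinct_map_filter) (simp add: keys distinct_R)
    from distinct_card[OF this] have "length ?F = card (fst ` set ?F)" by (simp only: set_map length_map)
    also have "fst ` set ?F = snd ` M"
    proof (intro equalityI subsetI)
      fix v assume "v \<in> fst ` set ?F"
      then obtain p us where "(v, p, us) \<in> set S" "us \<noteq> []" by auto
      then have "(hd us, v) \<in> M" unfolding M_def using hd_in_set by blast
      then show "v \<in> snd ` M" by force
    next
      fix v assume "v \<in> snd ` M"
      then show "v \<in> fst ` set ?F" unfolding M_def by force
    qed
    also have "card \<dots> = card M" by (rule card_image[OF inj2])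
    finally show ?thesis by simp
  qed
  have "\<not> {1..N} \<subseteq> (\<lambda>e. fst (snd e)) ` set S"
  proof
    assume "{1..N} \<subseteq> (\<lambda>e. fst (snd e)) ` set S"
    then have "card {1..N} \<le> card ((\<lambda>e. fst (snd e)) ` set S)" by (intro card_mono) auto
    also have "\<dots> \<le> length S" using card_image_le[of "set S"] card_length[of S] le_trans by blast
    also have "\<dots> = length R" using keys by auto
    finally show False using N by simp
  qed
  then obtain l where l: "l \<in> {1..N}" "\<And>v p us. (v, p, us) \<in> set S \<Longrightarrow> p \<noteq> l" by force
  \<comment> \<open>Every matching edge contributes one end to the cover: the right end if it is
    priced above the level, the left end otherwise. Thus the cover is no larger than
    \<open>M\<close>.\<close>
  let ?hi = "{(u, v) \<in> M. \<exists>p us. (v, p, us) \<in> set S \<and> l < p}"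
  let ?CR = "snd ` ?hi" and ?CL = "fst ` (M - ?hi)"
  have "u \<in> ?CL \<or> v \<in> ?CR" if h: "u \<in> set L" "v \<in> set R" "adj u v" for u v
  proof (cases "u \<in> ?CL")
    case False
    obtain q vs where vS: "(v, q, vs) \<in> set S" using h(2) R by auto
    \<comment> \<open>If \<open>u\<close> gave up, \<open>q\<close> has reached \<open>N\<close>; if
      \<open>u\<close> owns a vertex, that vertex lies above the level and its price is at most
      \<open>q + 1\<close>. In both cases \<open>q\<close> is at least \<open>l\<close>, and no
      price equals \<open>l\<close>.\<close>
    have "l < q"
    proof (cases "\<forall>v p us. (v, p, us) \<in> set S \<longrightarrow> u \<notin> set us")
      case True
      then have "q \<ge> N" using I(4)[OF h(1) _ _ vS h(3)] by simp
      then show ?thesis using l(1) l(2)[OF vS] by simp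
    next
      case False': False
      then obtain w p us where w: "(w, p, us) \<in> set S" "u \<in> set us" by auto
      then have "(u, w) \<in> M" unfolding M_def by auto
      with False obtain p' us' where "(w, p', us') \<in> set S" "l < p'" by force
      then have "l < p" using uniq[OF w(1)] by auto
      moreover have "p \<le> Suc q" using I(2)[OF w vS] h(3) by auto
      ultimately show ?thesis using l(2)[OF vS] by simp
    qed
    then have "vs \<noteq> []" using I(1)[OF vS] by auto
    then have "(hd vs, v) \<in> ?hi" using vS \<open>l < q\<close> unfolding M_def using hd_in_set by blast
    then show ?thesis by force
  qed simp
  moreover have "card ?CL + card ?CR \<le> card M"
  proof -
    have "card ?CL + card ?CR \<le> card (M - ?hi) + card ?hi"
      using finM by (intro add_mono card_image_le) (auto intro: finite_subset[of _ M])
    also have "\<dots> = card M"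
    proof -
      have sub: "?hi \<subseteq> M" by auto
      have "finite ?hi" by (rule finite_subset[OF sub finM])
      then show ?thesis using card_Diff_subset[OF _ sub] card_mono[OF finM sub] by linarith
    qed
    finally show ?thesis .
  qed
  moreover have "?CL \<subseteq> set L" "?CR \<subseteq> set R" using sub_M by auto
  moreover have "\<forall>(u, v)\<in>M. adj u v" unfolding M_def using I(2) by blast
  ultimately show ?thesis using sub_M inj1 inj2 cardM by (intro exI[of _ ?CL] exI[of _ ?CR]) blast
qed

end

text \<open>Koenig's theorem with the size of the matching given by the algorithm. The existence
  results on dispersion and the correctness of the computation both rest on it.\<close>

lemma matching_size_koenig:
  assumes "distinct L" "distinct R"
  obtains M CL CR where "M \<subseteq> set L \<times> set R" "\<And>u v. (u, v) \<in> M \<Longrightarrow> adj u v" "inj_on fst M" "inj_on snd M"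
    "card M = matching_size adj L R" "CL \<subseteq> set L" "CR \<subseteq> set R"
    "\<And>u v. u \<in> set L \<Longrightarrow> v \<in> set R \<Longrightarrow> adj u v \<Longrightarrow> u \<in> CL \<or> v \<in> CR"
    "card CL + card CR \<le> card M"
proof -
  let ?N = "Suc (length R)"
  let ?s = "(L, map (\<lambda>v. (v, 0, [])) R)"
  let ?k = "length L + Suc (length R) * length R"
  have meas: "auction_measure ?N ?s = ?k"
    by (simp add: auction_measure_def[OF assms] comp_def sum_list_triv)
  have "auction_inv adj ?N L R (fst ?s) (snd ?s)"
    using auction_inv_init[OF assms, of adj ?N] unfolding fst_conv snd_conv .
  note props = auction_run[OF assms this, of ?k]
  have run: "auction_inv adj ?N L R (fst ((auction_step adj ?N ^^ ?k) ?s)) (auction adj L R)"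
    using props[THEN conjunct1] unfolding auction_def .
  have all_bid: "fst ((auction_step adj ?N ^^ ?k) ?s) = []"
    by (rule props[THEN conjunct2, THEN mp]) (simp only: meas order_refl)
  have "auction_inv adj ?N L R [] (auction adj L R)" using run unfolding all_bid .
  note cover = auction_cover[OF assms this refl, folded matching_size_def]
  show ?thesis
    by (rule exE[OF cover], erule exE, elim conjE, rule that) (assumption | fast)+
qed

section \<open>Dispersion and term cuts\<close>

lemma subterms_refl [simp]: "t \<in> subterms t"
  by (cases t) auto

lemma subterms_trans: "u \<in> subterms t \<Longrightarrow> w \<in> subterms u \<Longrightarrow> w \<in> subterms t"
  by (induction t) auto

lemma finite_subterms: "finite (subterms t)"
  by (induction t) auto

lemma wf_trm_subterms: "wf_trm X F ar t \<Longrightarrow> u \<in> subterms t \<Longrightarrow> wf_trm X F ar u"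
  by (induction t) (auto simp: list_all_iff)

lemma term_vertices_args: "Fun f us \<in> term_vertices P \<Longrightarrow> set us \<subseteq> term_vertices P"
proof
  fix u assume F: "Fun f us \<in> term_vertices P" and u: "u \<in> set us"
  have "u \<in> subterms (Fun f us)" using u subterms_refl[of u] by (simp del: subterms_refl) blast
  then have "u \<in> subterms t" if "Fun f us \<in> subterms t" for t using subterms_trans that by blast
  with F show "u \<in> term_vertices P" unfolding term_vertices_def by auto
qed

lemma outputs_vertices: "set (outputs P) \<subseteq> term_vertices P"
  by (auto simp: term_vertices_def intro: subterms_refl)

lemma tests_vertices:
  "(u, v) \<in> set (tests P) \<Longrightarrow> u \<in> term_vertices P \<and> v \<in> term_vertices P"
  unfolding term_vertices_def using subterms_refl[of u] subterms_refl[of v] by blast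

lemma variables_vertices: "Var ` variables P \<subseteq> term_vertices P"
  by (auto simp: term_vertices_def)

text \<open>The edge relation without the restriction to \<open>term_vertices\<close>, so that it
  makes sense on larger sets of terms.\<close>

definition arg_edge :: "('f, 'x) trm \<Rightarrow> ('f, 'x) trm \<Rightarrow> bool" where
  "arg_edge u w \<longleftrightarrow> (\<exists>f us. w = Fun f us \<and> u \<in> set us)"

text \<open>Terms grow along edges; this gives every path of matching edges a last vertex.\<close>

lemma arg_edge_size: "arg_edge u w \<Longrightarrow> size u < size w"
  unfolding arg_edge_def by (auto dest!: size_list_estimation'[where f = size, OF _ order_refl])

text \<open>
  \<open>linked M x v\<close>: the proper edges in the matching \<open>M\<close> contain a path from the variable \<open>x\<close>
  to \<open>v\<close>. Loops \<open>(v, v)\<close> of \<open>M\<close> only occur at vertices that lie on none of these paths.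
\<close>

inductive linked :: "(('f, 'x) trm \<times> ('f, 'x) trm) set \<Rightarrow> 'x \<Rightarrow> ('f, 'x) trm \<Rightarrow> bool"
  for M and x
where
  linked_Var: "linked M x (Var x)"
| linked_step: "linked M x u \<Longrightarrow> (u, v) \<in> M \<Longrightarrow> u \<noteq> v \<Longrightarrow> linked M x v"

context
  fixes P :: "('f, 'x) problem"
  assumes wf: "wf_problem P"
begin

lemma finite_term_vertices: "finite (term_vertices P)"
  using wf finite_subterms by (auto simp: wf_problem_def term_vertices_def)

lemma wf_trm_vertices: "v \<in> term_vertices P \<Longrightarrow> wf_trm (variables P) (symbols P) (arity P) v"
  using wf wf_trm_subterms unfolding wf_problem_def term_vertices_def by fastforce

lemma graph_size_pos: "graph_size P > 0"
proof -
  obtain x where "x \<in> variables P" using wf by (auto simp: wf_problem_def)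
  then have "Var x \<in> term_vertices P" using variables_vertices[of P] by blast
  then show ?thesis unfolding graph_size_def using finite_term_vertices by (auto simp: card_gt_0_iff)
qed

section \<open>Minimum cuts and the upper bound\<close>

lemma term_cut_all: "term_cut P (term_vertices P)"
  unfolding term_cut_def io_path_def by (simp add: Int_absorb1)

lemma min_cut_size_le: "term_cut P K \<Longrightarrow> min_cut_size P \<le> card K"
  and min_cut_size_ex: "\<exists>K. term_cut P K \<and> card K = min_cut_size P"
proof -
  have "{K. term_cut P K} \<subseteq> Pow (term_vertices P)" by (auto simp: term_cut_def)
  then have fin: "finite (card ` {K. term_cut P K})"
    using finite_term_vertices by (auto intro: finite_subset)
  show "term_cut P K \<Longrightarrow> min_cut_size P \<le> card K"
    unfolding min_cut_size_def using fin by (intro Min_le) auto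
  have "min_cut_size P \<in> card ` {K. term_cut P K}"
    unfolding min_cut_size_def using fin term_cut_all by (intro Min_in) auto
  then show "\<exists>K. term_cut P K \<and> card K = min_cut_size P" by auto
qed

lemma trm_value_in:
  assumes "interpretation_on P A I" "\<And>x. x \<in> variables P \<Longrightarrow> a x \<in> A"
  shows "wf_trm (variables P) (symbols P) (arity P) v \<Longrightarrow> trm_value I a v \<in> A"
proof (induction v)
  case (Fun f us)
  then have "f \<in> symbols P" "length (map (trm_value I a) us) = arity P f"
    "set (map (trm_value I a) us) \<subseteq> A" by (auto simp: list_all_iff)
  then show ?case using assms(1) unfolding interpretation_on_def trm_value.simps by blast
qed (use assms in simp)

text \<open>Induction on the term: if a vertex lies outside \<open>K\<close> and all paths into it
  meet \<open>K\<close>, the same holds for the paths into its arguments, since these extend to the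
  vertex. The path condition replaces \<open>io_path\<close>, which would force the end to be an
  output and so break the induction.\<close>

lemma trm_value_determined:
  assumes "\<And>v. v \<in> K \<Longrightarrow> trm_value I a v = trm_value I a' v"
  shows "v \<in> term_vertices P \<Longrightarrow>
    (\<And>p. p \<noteq> [] \<Longrightarrow> set p \<subseteq> term_vertices P \<Longrightarrow> successively (\<lambda>u w. (u, w) \<in> term_edges P) p \<Longrightarrow>
      hd p \<in> Var ` variables P \<Longrightarrow> last p = v \<Longrightarrow> K \<inter> set p \<noteq> {}) \<Longrightarrow>
    trm_value I a v = trm_value I a' v"
proof (induction v)
  case (Var x)
  have "x \<in> variables P" using wf_trm_vertices[OF Var.prems(1)] by simp
  then have "K \<inter> set [Var x] \<noteq> {}" by (intro Var.prems(2)) (use Var.prems(1) in auto)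
  then show ?case using assms by (simp del: trm_value.simps)
next
  case (Fun f us)
  show ?case
  proof (cases "Fun f us \<in> K")
    case False
    have "trm_value I a u = trm_value I a' u" if u: "u \<in> set us" for u
    proof (rule Fun.IH[OF u])
      show uV: "u \<in> term_vertices P" using term_vertices_args[OF Fun.prems(1)] u by auto
      fix p assume p: "p \<noteq> []" "set p \<subseteq> term_vertices P"
        "successively (\<lambda>u w. (u, w) \<in> term_edges P) p" "hd p \<in> Var ` variables P" "last p = u"
      have "K \<inter> set (p @ [Fun f us]) \<noteq> {}"
      proof (rule Fun.prems(2))
        have "(u, Fun f us) \<in> term_edges P" using uV u Fun.prems(1) unfolding term_edges_def by auto
        then show "successively (\<lambda>u w. (u, w) \<in> term_edges P) (p @ [Fun f us])"
          using p by (simp add: successively_append_iff)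
      qed (use p Fun.prems(1) in auto)
      then show "K \<inter> set p \<noteq> {}" using False by auto
    qed
    then show ?thesis by (simp cong: map_cong)
  qed (rule assms)
qed

lemma card_output_values_le:
  assumes K: "term_cut P K" and I: "interpretation_on P {0..<n} I"
  shows "card (output_values P {0..<n} I) \<le> n ^ card K"
proof -
  let ?\<phi> = "\<lambda>a. restrict (trm_value I a) K"
  let ?F = "\<lambda>a. map (trm_value I a) (outputs P)"
  let ?D = "admissible P {0..<n} I"
  have KV: "K \<subseteq> term_vertices P" using K by (simp add: term_cut_def)
  have finK: "finite K" using finite_subset[OF KV finite_term_vertices] .
  have det: "?F a = ?F a'" if "?\<phi> a = ?\<phi> a'" for a a'
  proof (rule map_cong[OF refl])
    fix t assume t: "t \<in> set (outputs P)"
    show "trm_value I a t = trm_value I a' t"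
    proof (rule trm_value_determined[where K = K])
      show "trm_value I a v = trm_value I a' v" if "v \<in> K" for v
        using fun_cong[OF \<open>?\<phi> a = ?\<phi> a'\<close>, of v] that by simp
      show "t \<in> term_vertices P" using t outputs_vertices[of P] by auto
      fix p assume "p \<noteq> []" "set p \<subseteq> term_vertices P"
        "successively (\<lambda>u w. (u, w) \<in> term_edges P) p" "hd p \<in> Var ` variables P" "last p = t"
      then have "io_path P p" using t by (simp add: io_path_def)
      then show "K \<inter> set p \<noteq> {}" using K by (simp add: term_cut_def)
    qed
  qed
  \<comment> \<open>By \<open>det\<close> all admissible assignments with the same values on
    \<open>K\<close> give the same outputs, so the choice made here is immaterial.\<close>
  define g where "g y = ?F (SOME a. a \<in> ?D \<and> ?\<phi> a = y)" for y
  have "?F a = g (?\<phi> a)" if "a \<in> ?D" for a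
    unfolding g_def using someI[of "\<lambda>b. b \<in> ?D \<and> ?\<phi> b = ?\<phi> a" a] that by (intro det) auto
  then have "output_values P {0..<n} I \<subseteq> g ` (?\<phi> ` ?D)" unfolding output_values_def by auto
  moreover have "?\<phi> ` ?D \<subseteq> K \<rightarrow>\<^sub>E {0..<n}"
  proof clarify
    fix a assume "a \<in> ?D"
    then have "\<And>x. x \<in> variables P \<Longrightarrow> a x \<in> {0..<n}" by (auto simp: admissible_def)
    then have "trm_value I a v \<in> {0..<n}" if "v \<in> K" for v
      using trm_value_in[OF I] wf_trm_vertices KV that by blast
    then show "?\<phi> a \<in> K \<rightarrow>\<^sub>E {0..<n}" by auto
  qed
  ultimately have "output_values P {0..<n} I \<subseteq> g ` (K \<rightarrow>\<^sub>E {0..<n})" by blast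
  then have "card (output_values P {0..<n} I) \<le> card (g ` (K \<rightarrow>\<^sub>E {0..<n}))"
    using finK by (intro card_mono finite_imageI finite_PiE) auto
  also have "\<dots> \<le> card (K \<rightarrow>\<^sub>E {0..<n})" using finK by (intro card_image_le finite_PiE) auto
  also have "\<dots> = n ^ card K" using finK by (simp add: card_PiE)
  finally show ?thesis .
qed

text \<open>Infinitely many functions \<open>I\<close> qualify as interpretations, but the trivial
  cut of all vertices bounds their counts, so the maximum exists.\<close>

lemma finite_dispersion_set:
  "finite {card (output_values P {0..<n::nat} I) | I. interpretation_on P {0..<n} I}"
  by (rule finite_subset[of _ "{.. n ^ card (term_vertices P)}"])
     (use card_output_values_le[OF term_cut_all] in auto)

lemma ex_interpretation: "n \<ge> 1 \<Longrightarrow> interpretation_on P {0..<n::nat} (\<lambda>_ _. 0)"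
  by (auto simp: interpretation_on_def)

lemma dispersion_ge:
  "interpretation_on P {0..<n} I \<Longrightarrow> card (output_values P {0..<n} I) \<le> dispersion P n"
  unfolding dispersion_def using finite_dispersion_set by (intro Max_ge) auto

lemma dispersion_attained:
  assumes "n \<ge> 1"
  obtains I where "interpretation_on P {0..<n} I" "dispersion P n = card (output_values P {0..<n} I)"
proof -
  have "dispersion P n \<in> {card (output_values P {0..<n} I) | I. interpretation_on P {0..<n} I}"
    unfolding dispersion_def using ex_interpretation[OF assms] by (intro Max_in finite_dispersion_set) auto
  then show ?thesis using that by auto
qed

lemma dispersion_upper: "n \<ge> 1 \<Longrightarrow> dispersion P n \<le> n ^ min_cut_size P"
  using min_cut_size_ex card_output_values_le dispersion_attained by metis

lemma dispersion_identical:
  assumes "has_identical_test P" "n \<ge> 1" shows "dispersion P n = 0"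
proof -
  obtain u where u: "(u, u) \<in> set (tests P)"
    using assms(1) unfolding has_identical_test_def by auto
  obtain I where I: "dispersion P n = card (output_values P {0..<n} I)"
    by (rule dispersion_attained[OF assms(2)])
  have "admissible P {0..<n} I = {}" unfolding admissible_def using u by auto
  then show ?thesis by (simp add: I output_values_def)
qed

section \<open>Disjoint paths from a matching, and the lower bound\<close>

context
  fixes V :: "('f, 'x) trm set" and M :: "(('f, 'x) trm \<times> ('f, 'x) trm) set"
  assumes finite_V: "finite V" and vertices_V: "term_vertices P \<subseteq> V"
    and M_subset: "M \<subseteq> (V - set (outputs P)) \<times> (V - Var ` variables P)"
    and M_edges: "\<And>u v. (u, v) \<in> M \<Longrightarrow> u = v \<or> arg_edge u v"
    and M_inj: "inj_on fst M" "inj_on snd M"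
begin

lemma linked_in_V: "linked M x v \<Longrightarrow> x \<in> variables P \<Longrightarrow> v \<in> V"
proof (induction rule: linked.induct)
  case linked_Var
  then have "Var x \<in> term_vertices P" using variables_vertices[of P] by blast
  then show ?case using vertices_V by blast
next
  case (linked_step u v)
  then show ?case using M_subset by auto
qed

text \<open>Walking backwards from \<open>v\<close> is deterministic: \<open>M\<close> has at most
  one edge into a vertex, and none into a variable, whose right copy is omitted. Paths from distinct
  variables are therefore disjoint.\<close>

lemma linked_unique:
  "linked M x v \<Longrightarrow> linked M y v \<Longrightarrow> x \<in> variables P \<Longrightarrow> y \<in> variables P \<Longrightarrow> x = y"
proof (induction rule: linked.induct)
  case linked_Var
  from linked_Var(1) show ?case
    by cases (use M_subset linked_Var in auto)
next
  case (linked_step u v)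
  from linked_step(5) show ?case
  proof cases
    case linked_Var
    then show ?thesis using linked_step(2,7) M_subset by auto
  next
    case (linked_step u')
    have "u' = u" using inj_onD[OF M_inj(2), of "(u', v)" "(u, v)"] linked_step linked_step.hyps \<open>(u, v) \<in> M\<close> by simp
    then show ?thesis using linked_step linked_step.IH local.linked_step.prems linked_step.hyps by blast
  qed
qed

text \<open>A vertex of maximal size linked to \<open>x\<close> is an output or unmatched on the left.\<close>

lemma linked_outputs:
  obtains Z where "Z \<subseteq> variables P" "\<And>x. x \<in> Z \<Longrightarrow> \<exists>b\<in>set (outputs P). linked M x b"
    "card M + card (variables P) + card (set (outputs P)) \<le> card Z + card V"
proof -
  let ?X = "variables P" and ?B = "set (outputs P)"
  have finX: "finite ?X" using wf by (simp add: wf_problem_def)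
  have "\<exists>e. linked M x e \<and> e \<in> V \<and> e \<notin> fst ` M" if x: "x \<in> ?X" for x
  proof -
    let ?T = "{v. linked M x v}"
    have "?T \<subseteq> V" using linked_in_V x by auto
    then have "finite ?T" using finite_V finite_subset by auto
    moreover have "Var x \<in> ?T" by (auto intro: linked_Var)
    ultimately obtain e where e: "e \<in> ?T" "\<And>v. v \<in> ?T \<Longrightarrow> size v \<le> size e"
      using Max_in[of "size ` ?T"] Max_ge[of "size ` ?T"] by (metis (no_types, lifting) empty_iff finite_imageI image_iff)
    have "(e, v) \<notin> M" for v
    proof
      assume ev: "(e, v) \<in> M"
      show False
      proof (cases "e = v")
        case False
        then have "linked M x v" using e(1) ev by (auto intro: linked_step)
        moreover have "size e < size v" using M_edges[OF ev] False arg_edge_size by auto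
        ultimately show False using e(2)[of v] by auto
      next
        \<comment> \<open>A loop at \<open>e\<close> would be the only edge of \<open>M\<close> into
          \<open>e\<close>. But the path enters \<open>e\<close> by a proper edge, or starts there,
          and then \<open>e\<close> is a variable and has no right copy.\<close>
        case True
        from e(1) have "linked M x e" by simp
        then show False
        proof cases
          case linked_Var
          then show False using ev True M_subset x by auto
        next
          case (linked_step u)
          then show False using inj_onD[OF M_inj(2), of "(u, e)" "(e, e)"] ev True by auto
        qed
      qed
    qed
    then show ?thesis using e(1) \<open>?T \<subseteq> V\<close> by force
  qed
  then obtain e where e: "\<And>x. x \<in> ?X \<Longrightarrow> linked M x (e x) \<and> e x \<in> V \<and> e x \<notin> fst ` M" by metis
  have inj: "inj_on e ?X" using e linked_unique by (metis inj_onI)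
  let ?Z = "{x \<in> ?X. e x \<in> ?B}"
  have BV: "?B \<subseteq> V" using outputs_vertices[of P] vertices_V by blast
  have fM: "fst ` M \<subseteq> V - ?B" using M_subset by auto
  \<comment> \<open>A path that misses the outputs ends in an unmatched left vertex, and distinct
    paths have distinct ends. So the variables outside \<open>?Z\<close> are no more than the
    unmatched left vertices.\<close>
  have "e ` (?X - ?Z) \<subseteq> (V - ?B) - fst ` M" using e by auto
  then have "card (e ` (?X - ?Z)) \<le> card ((V - ?B) - fst ` M)" using finite_V by (intro card_mono) auto
  also have "\<dots> = card V - card ?B - card M"
    using fM BV finite_V finite_subset[OF fM] by (simp add: card_Diff_subset card_image[OF M_inj(1)])
  also have "card (e ` (?X - ?Z)) = card (?X - ?Z)" by (rule card_image[OF inj_on_subset[OF inj]]) auto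
  also have "\<dots> = card ?X - card ?Z" using finX by (simp add: card_Diff_subset)
  finally have 1: "card ?X - card ?Z \<le> card V - card ?B - card M" .
  \<comment> \<open>Facts 2 and 3 exclude truncation in the subtractions on natural numbers in fact
    1.\<close>
  have 2: "card ?B \<le> card V" using BV finite_V by (rule card_mono[rotated])
  have "card M = card (fst ` M)" by (simp add: card_image[OF M_inj(1)])
  also have "\<dots> \<le> card (V - ?B)" using fM finite_V by (intro card_mono) auto
  also have "\<dots> = card V - card ?B" using BV by (intro card_Diff_subset) auto
  finally have 3: "card M \<le> card V - card ?B" .
  show ?thesis
    by (rule that[of ?Z]) (use e 1 2 3 in auto)
qed

text \<open>Matching edges may leave the term graph when \<open>V\<close> is larger. A path that
  ends in a term vertex stays inside, since term vertices are closed under arguments.\<close>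

lemma linked_path:
  "linked M x v \<Longrightarrow> x \<in> variables P \<Longrightarrow> v \<in> term_vertices P \<Longrightarrow>
    \<exists>p. p \<noteq> [] \<and> set p \<subseteq> {u \<in> term_vertices P. linked M x u} \<and>
      successively (\<lambda>u w. (u, w) \<in> term_edges P) p \<and> hd p = Var x \<and> last p = v"
proof (induction rule: linked.induct)
  case linked_Var
  then show ?case by (intro exI[of _ "[Var x]"]) (auto intro: linked.linked_Var)
next
  case (linked_step u v)
  then obtain f us where v: "v = Fun f us" "u \<in> set us"
    using M_edges[OF linked_step.hyps(2)] linked_step.hyps(3) unfolding arg_edge_def by auto
  then have u: "u \<in> term_vertices P" using term_vertices_args[of f us P] linked_step.prems by auto
  then obtain p where p: "p \<noteq> []" "set p \<subseteq> {u \<in> term_vertices P. linked M x u}"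
    "successively (\<lambda>u w. (u, w) \<in> term_edges P) p" "hd p = Var x" "last p = u"
    using linked_step.IH[OF linked_step.prems(1) u] by blast
  have "(u, v) \<in> term_edges P" using v u linked_step.prems unfolding term_edges_def by auto
  then show ?case using p linked_step.prems(2) linked.linked_step[OF linked_step.hyps]
    by (intro exI[of _ "p @ [v]"]) (auto simp: successively_append_iff)
qed

text \<open>The easy half of Menger's theorem: a cut contains a vertex of each path, and these
  vertices differ because the paths are disjoint.\<close>

lemma linked_le_cut:
  assumes Z: "Z \<subseteq> variables P" "\<And>x. x \<in> Z \<Longrightarrow> \<exists>b\<in>set (outputs P). linked M x b"
    and K: "term_cut P K"
  shows "card Z \<le> card K"
proof -
  have "\<exists>k. k \<in> K \<and> linked M x k" if "x \<in> Z" for x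
  proof -
    obtain b where b: "b \<in> set (outputs P)" "linked M x b" using Z(2)[OF \<open>x \<in> Z\<close>] by auto
    have x: "x \<in> variables P" using Z(1) that by auto
    then obtain p where p: "p \<noteq> []" "set p \<subseteq> {u \<in> term_vertices P. linked M x u}"
      "successively (\<lambda>u w. (u, w) \<in> term_edges P) p" "hd p = Var x" "last p = b"
      using linked_path[OF b(2) x] b(1) outputs_vertices[of P] by blast
    then have "io_path P p" unfolding io_path_def using b(1) x by auto
    then have "K \<inter> set p \<noteq> {}" using K by (simp add: term_cut_def)
    then show ?thesis using p(2) by auto
  qed
  then obtain k where k: "\<And>x. x \<in> Z \<Longrightarrow> k x \<in> K \<and> linked M x (k x)" by metis
  have "inj_on k Z" using k Z(1) linked_unique by (metis inj_onI subsetD)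
  moreover have "finite K" using K finite_term_vertices by (auto simp: term_cut_def intro: finite_subset)
  ultimately show ?thesis using k by (intro card_inj_on_le[of k]) auto
qed

text \<open>
  A value in the block of \<open>n div s\<close> numbers reserved for the vertex \<open>v\<close> codes a pair of the term
  \<open>v\<close> itself and of a payload; along a linked path the payload is passed on unchanged.
\<close>

lemma dispersion_lower:
  assumes Z: "Z \<subseteq> variables P" "\<And>x. x \<in> Z \<Longrightarrow> \<exists>b\<in>set (outputs P). linked M x b"
    and nid: "\<not> has_identical_test P" and n: "n \<ge> graph_size P"
  shows "(n div graph_size P) ^ card Z \<le> dispersion P n"
proof -
  let ?S = "term_vertices P" and ?s = "graph_size P" and ?X = "variables P"
  define q where "q = n div ?s"
  have q: "q > 0" using n graph_size_pos by (simp add: q_def div_greater_zero_iff)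
  obtain \<iota> where "bij_betw \<iota> ?S {0..<?s}"
    using ex_bij_betw_finite_nat[OF finite_term_vertices] unfolding graph_size_def by auto
  then have \<iota>: "inj_on \<iota> ?S" "\<And>v. v \<in> ?S \<Longrightarrow> \<iota> v < ?s" by (auto simp: bij_betw_def)
  define dec where "dec m = inv_into ?S \<iota> (m div q)" for m
  have block: "\<iota> v * q + d < n" if "v \<in> ?S" "d < q" for v d
  proof -
    have "\<iota> v * q + d < Suc (\<iota> v) * q" using that by simp
    also have "\<dots> \<le> ?s * q" using \<iota>(2)[OF that(1)] by (intro mult_right_mono) auto
    also have "\<dots> \<le> n" by (simp add: q_def)
    finally show ?thesis .
  qed
  \<comment> \<open>A vertex inherits the payload of the argument matched to it. That term may occur
    at several argument positions; the least index is a mere choice, as \<open>snd\<close> is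
    injective on \<open>M\<close> and so all such positions hold the same term.\<close>
  define payload where "payload w us as =
    (if \<exists>i<length us. (us ! i, w) \<in> M \<and> us ! i \<noteq> w
     then as ! (LEAST i. i < length us \<and> (us ! i, w) \<in> M \<and> us ! i \<noteq> w) mod q else 0)" for w us as
  \<comment> \<open>The blocks in which the argument values lie reveal the argument terms, hence the
    term being evaluated. The value 0 keeps the operation total where the decoded term is no
    vertex.\<close>
  define I where "I f as = (let us = map dec as; w = Fun f us in
    if w \<in> ?S then \<iota> w * q + payload w us as else 0)" for f as
  have payload: "payload w us as < q" for w us as unfolding payload_def using q by auto
  have int: "interpretation_on P {0..<n} I"
    unfolding interpretation_on_def I_def Let_def using block payload q n graph_size_pos by auto
  have val_eq: "trm_value I a v div q = \<iota> v \<and> (\<forall>x\<in>?X. linked M x v \<longrightarrow> trm_value I a v mod q = c x)"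
    if a: "\<And>x. x \<in> ?X \<Longrightarrow> a x = \<iota> (Var x) * q + c x" "\<And>x. c x < q" and "v \<in> ?S" for a c v
    using \<open>v \<in> ?S\<close>
  proof (induction v)
    case (Var x)
    then have x: "x \<in> ?X" using wf_trm_vertices[OF Var] by simp
    have "y = x" if "linked M y (Var x)" "y \<in> ?X" for y
      using linked_unique[OF that(1) linked_Var] that(2) x by auto
    then show ?case using a(1)[OF x] a(2)[of x] by auto
  next
    case (Fun f us)
    let ?w = "Fun f us" and ?as = "map (trm_value I a) us"
    have us: "set us \<subseteq> ?S" using term_vertices_args[OF Fun.prems] .
    have "map dec ?as = us"
      unfolding map_map using Fun.IH us \<iota>(1) by (intro map_idI) (auto simp: dec_def)
    then have val: "trm_value I a ?w = \<iota> ?w * q + payload ?w us ?as"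
      using Fun.prems by (simp add: I_def Let_def)
    have "trm_value I a ?w mod q = c x" if x: "x \<in> ?X" "linked M x ?w" for x
    proof -
      from x(2) obtain u where u: "linked M x u" "(u, ?w) \<in> M" "u \<noteq> ?w" by cases auto
      then obtain i where i: "i < length us" "us ! i = u"
        using M_edges[OF u(2)] by (auto simp: arg_edge_def in_set_conv_nth)
      let ?Q = "\<lambda>i. i < length us \<and> (us ! i, ?w) \<in> M \<and> us ! i \<noteq> ?w"
      have Q: "?Q (LEAST i. ?Q i)" by (rule LeastI[of ?Q i]) (use i u in simp)
      then have "us ! (LEAST i. ?Q i) = u"
        using inj_onD[OF M_inj(2), of "(us ! (LEAST i. ?Q i), ?w)" "(u, ?w)"] u(2) by simp
      moreover have "payload ?w us ?as = ?as ! (LEAST i. ?Q i) mod q"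
        unfolding payload_def using i u by auto
      moreover have "?as ! (LEAST i. ?Q i) = trm_value I a (us ! (LEAST i. ?Q i))" using Q by simp
      ultimately have "payload ?w us ?as = trm_value I a u mod q" by simp
      also have "\<dots> = c x" using Fun.IH[of u] us i u(1) x(1) nth_mem by blast
      finally show ?thesis unfolding val using payload[of ?w us ?as] by simp
    qed
    moreover have "trm_value I a ?w div q = \<iota> ?w" unfolding val using payload[of ?w us ?as] by simp
    ultimately show ?case by blast
  qed
  define asg where "asg c = (\<lambda>x\<in>?X. \<iota> (Var x) * q + (if x \<in> Z then c x else 0))" for c
  let ?C = "Z \<rightarrow>\<^sub>E {0..<q}"
  let ?F = "\<lambda>a. map (trm_value I a) (outputs P)"
  have asg_value: "trm_value I (asg c) v div q = \<iota> v \<and>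
      (\<forall>x\<in>?X. linked M x v \<longrightarrow> trm_value I (asg c) v mod q = (if x \<in> Z then c x else 0))"
    if "c \<in> ?C" "v \<in> ?S" for c v
    by (rule val_eq[where c = "\<lambda>x. if x \<in> Z then c x else 0", OF _ _ that(2)])
       (use that(1) q in \<open>auto simp: asg_def dest: PiE_mem\<close>)
  have adm: "asg c \<in> admissible P {0..<n} I" if c: "c \<in> ?C" for c
  proof -
    have "trm_value I (asg c) u \<noteq> trm_value I (asg c) v" if t: "(u, v) \<in> set (tests P)" for u v
    proof -
      have "u \<noteq> v" using nid t by (auto simp: has_identical_test_def)
      moreover have "u \<in> ?S" "v \<in> ?S" using tests_vertices[OF t] by auto
      ultimately have "\<iota> u \<noteq> \<iota> v" using \<iota>(1) by (auto dest: inj_onD)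
      then show ?thesis using asg_value[OF c] \<open>u \<in> ?S\<close> \<open>v \<in> ?S\<close> by metis
    qed
    moreover have "asg c \<in> ?X \<rightarrow>\<^sub>E {0..<n}"
    proof -
      have "\<iota> (Var x) * q + (if x \<in> Z then c x else 0) < n" if "x \<in> ?X" for x
        using that variables_vertices[of P] c q by (intro block) (auto dest: PiE_mem)
      then show ?thesis by (auto simp: asg_def)
    qed
    ultimately show ?thesis by (auto simp: admissible_def)
  qed
  have inj: "inj_on (\<lambda>c. ?F (asg c)) ?C"
  proof (rule inj_onI)
    fix c c' assume cc: "c \<in> ?C" "c' \<in> ?C" "?F (asg c) = ?F (asg c')"
    show "c = c'"
    proof (rule PiE_ext[OF cc(1,2)])
      fix x assume x: "x \<in> Z"
      then obtain b where b: "b \<in> set (outputs P)" "linked M x b" using Z(2) by blast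
      have "b \<in> ?S" using b(1) outputs_vertices[of P] by auto
      moreover have "x \<in> ?X" using Z(1) x by auto
      moreover have "trm_value I (asg c) b = trm_value I (asg c') b" using cc(3) b(1) by simp
      ultimately show "c x = c' x" using asg_value[OF cc(1)] asg_value[OF cc(2)] b(2) x by metis
    qed
  qed
  have finZ: "finite Z" using Z(1) wf by (auto simp: wf_problem_def intro: finite_subset)
  have "q ^ card Z = card ?C" using finZ by (simp add: card_PiE)
  also have "\<dots> = card ((\<lambda>c. ?F (asg c)) ` ?C)" using card_image[OF inj] by simp
  also have "\<dots> \<le> card (output_values P {0..<n} I)"
  proof (rule card_mono)
    have "finite (?X \<rightarrow>\<^sub>E {0..<n})" using wf by (intro finite_PiE) (auto simp: wf_problem_def)
    then have "finite (admissible P {0..<n} I)"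
      by (rule finite_subset[rotated]) (auto simp: admissible_def)
    then show "finite (output_values P {0..<n} I)" by (simp add: output_values_def)
    show "(\<lambda>c. ?F (asg c)) ` ?C \<subseteq> output_values P {0..<n} I"
      unfolding output_values_def using adm by blast
  qed
  also have "\<dots> \<le> dispersion P n" by (rule dispersion_ge[OF int])
  finally show ?thesis by (simp add: q_def)
qed

end

section \<open>From covers to cuts; the formula for the minimum cut size\<close>

text \<open>
  A bipartite cover, enlarged by the right copies of the variables and the left copies of the
  outputs, contains at least one copy of every vertex; the vertices with both copies form a cut.
\<close>

lemma cover_cut:
  assumes V: "finite V" "term_vertices P \<subseteq> V"
    and C: "CL \<subseteq> V - set (outputs P)" "CR \<subseteq> V - Var ` variables P"
      "\<And>u v. u \<in> V - set (outputs P) \<Longrightarrow> v \<in> V - Var ` variables P \<Longrightarrow> u = v \<or> arg_edge u v \<Longrightarrow>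
        u \<in> CL \<or> v \<in> CR"
  shows "min_cut_size P + card V \<le> card CL + card CR + card (variables P) + card (set (outputs P))"
proof -
  let ?A = "Var ` variables P" and ?B = "set (outputs P)" and ?S = "term_vertices P"
  have AV: "?A \<subseteq> V" and BV: "?B \<subseteq> V" using V(2) variables_vertices[of P] outputs_vertices[of P] by blast+
  let ?Y = "CR \<union> ?A" and ?W = "CL \<union> ?B"
  have cut: "term_cut P (?Y \<inter> ?W \<inter> ?S)"
    unfolding term_cut_def
  proof (intro conjI allI impI notI)
    fix p assume p: "io_path P p" and empty: "?Y \<inter> ?W \<inter> ?S \<inter> set p = {}"
    from p have p': "p \<noteq> []" "set p \<subseteq> ?S" "successively (\<lambda>u w. (u, w) \<in> term_edges P) p"
      "hd p \<in> ?A" "last p \<in> ?B" by (auto simp: io_path_def)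
    \<comment> \<open>Membership in \<open>?Y\<close> travels along the path: a vertex in
      \<open>?Y\<close> that avoids the cut is outside \<open>?W\<close>, so the edge leaving it
      must be covered at its head, unless the head is a variable. The last vertex, an output, then
      lies in both sets.\<close>
    have "last p \<in> ?Y" using p'(1-4) empty
    proof (induction p rule: rev_induct)
      case (snoc v p)
      show ?case
      proof (cases "p = []")
        case False
        have e: "(last p, v) \<in> term_edges P" and s: "successively (\<lambda>u w. (u, w) \<in> term_edges P) p"
          using snoc.prems(3) False by (auto simp: successively_append_iff)
        have "last p \<in> ?Y" using snoc.IH[OF False _ s] snoc.prems False by auto
        moreover have "last p \<in> set p" using False by simp
        ultimately have "last p \<notin> ?W" using snoc.prems by auto
        moreover have "v \<in> ?A \<or> last p \<in> CL \<or> v \<in> CR \<or> last p \<in> ?B"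
          using C(3)[of "last p" v] e V(2) unfolding term_edges_def arg_edge_def by blast
        ultimately show ?thesis by auto
      qed (use snoc.prems in auto)
    qed simp
    moreover have "last p \<in> set p" using p'(1) by simp
    ultimately show False using p' empty by blast
  qed auto
  have "?Y \<subseteq> V" "?W \<subseteq> V" using C(1,2) AV BV by blast+
  then have fin: "finite ?Y" "finite ?W" using finite_subset[OF _ V(1)] by blast+
  \<comment> \<open>The loops enter here: covering the pair (v, v) puts a copy of every vertex into
    \<open>?Y\<close> or \<open>?W\<close>.\<close>
  have "V \<subseteq> ?Y \<union> ?W" using C(3) by blast
  then have "card V \<le> card (?Y \<union> ?W)" using fin by (intro card_mono) auto
  moreover have "min_cut_size P \<le> card (?Y \<inter> ?W)"
    by (rule order.trans[OF min_cut_size_le[OF cut] card_mono]) (use fin in auto)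
  moreover have "card (?Y \<union> ?W) + card (?Y \<inter> ?W) = card ?Y + card ?W" using card_Un_Int[OF fin] by simp
  moreover have "card ?Y \<le> card CR + card (variables P)"
    using card_Un_le[of CR ?A] card_image_le[of "variables P" "Var :: 'x \<Rightarrow> ('f, 'x) trm"] wf
    unfolding wf_problem_def by linarith
  moreover have "card ?W \<le> card CL + card ?B" by (rule card_Un_le)
  ultimately show ?thesis by linarith
qed

text \<open>The chain \<open>card Z\<close> <= minimum cut <= bound from the cover <= bound from the
  matching <= \<open>card Z\<close> closes up, so that all its members agree. \<open>V\<close> is
  left open: it is the term graph itself for the dispersion and the whole table of terms for the
  algorithm.\<close>

lemma min_cut_size_matching:
  assumes V: "finite V" "term_vertices P \<subseteq> V"
    and M: "M \<subseteq> (V - set (outputs P)) \<times> (V - Var ` variables P)"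
      "\<And>u v. (u, v) \<in> M \<Longrightarrow> u = v \<or> arg_edge u v" "inj_on fst M" "inj_on snd M"
    and C: "CL \<subseteq> V - set (outputs P)" "CR \<subseteq> V - Var ` variables P"
      "\<And>u v. u \<in> V - set (outputs P) \<Longrightarrow> v \<in> V - Var ` variables P \<Longrightarrow> u = v \<or> arg_edge u v \<Longrightarrow>
        u \<in> CL \<or> v \<in> CR"
    and le: "card CL + card CR \<le> card M"
  shows "min_cut_size P + card V = card M + card (variables P) + card (set (outputs P))"
    and "\<not> has_identical_test P \<Longrightarrow> n \<ge> graph_size P \<Longrightarrow>
      (n div graph_size P) ^ min_cut_size P \<le> dispersion P n"
proof -
  obtain Z where Z: "Z \<subseteq> variables P" "\<And>x. x \<in> Z \<Longrightarrow> \<exists>b\<in>set (outputs P). linked M x b"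
    "card M + card (variables P) + card (set (outputs P)) \<le> card Z + card V"
    using linked_outputs[OF V M] by metis
  have 1: "card Z \<le> min_cut_size P"
    using min_cut_size_ex linked_le_cut[OF V M Z(1,2)] by metis
  have 2: "min_cut_size P + card V \<le> card CL + card CR + card (variables P) + card (set (outputs P))"
    by (rule cover_cut[OF V C])
  show "min_cut_size P + card V = card M + card (variables P) + card (set (outputs P))"
    using 1 2 Z(3) le by linarith
  have "min_cut_size P = card Z" using 1 2 Z(3) le by linarith
  then show "\<not> has_identical_test P \<Longrightarrow> n \<ge> graph_size P \<Longrightarrow>
      (n div graph_size P) ^ min_cut_size P \<le> dispersion P n"
    using dispersion_lower[OF V M Z(1,2)] by simp
qed

text \<open>The auction serves only as an existence proof here, for a matching together with a cover
  no larger than it.\<close>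

lemma dispersion_bounds:
  assumes nid: "\<not> has_identical_test P" and n: "n \<ge> graph_size P"
  shows "(n div graph_size P) ^ min_cut_size P \<le> dispersion P n"
    and "dispersion P n \<le> n ^ min_cut_size P"
proof -
  let ?V = "term_vertices P"
  obtain L where L: "distinct L" "set L = ?V - set (outputs P)"
    using finite_distinct_list finite_term_vertices by (metis finite_Diff)
  obtain R where R: "distinct R" "set R = ?V - Var ` variables P"
    using finite_distinct_list finite_term_vertices by (metis finite_Diff)
  obtain M CL CR where K: "M \<subseteq> set L \<times> set R" "\<And>u v. (u, v) \<in> M \<Longrightarrow> u = v \<or> arg_edge u v"
    "inj_on fst M" "inj_on snd M" "CL \<subseteq> set L" "CR \<subseteq> set R"
    "\<And>u v. u \<in> set L \<Longrightarrow> v \<in> set R \<Longrightarrow> u = v \<or> arg_edge u v \<Longrightarrow> u \<in> CL \<or> v \<in> CR"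
    "card CL + card CR \<le> card M"
    by (rule matching_size_koenig[OF L(1) R(1), of "\<lambda>u v. u = v \<or> arg_edge u v"]) blast
  show "(n div graph_size P) ^ min_cut_size P \<le> dispersion P n"
    by (rule min_cut_size_matching(2)[OF finite_term_vertices order_refl K[unfolded L(2) R(2)] nid n])
  show "dispersion P n \<le> n ^ min_cut_size P"
    using dispersion_upper n graph_size_pos by simp
qed

section \<open>Asymptotics\<close>

lemma dispersion_asymptotics:
  assumes nid: "\<not> has_identical_test P"
  shows "(\<lambda>n. real (dispersion P n)) \<in> \<Theta>(\<lambda>n. real n ^ min_cut_size P)"
    and "(\<lambda>n. ln (real (dispersion P n)) / ln (real n)) \<longlonglongrightarrow> real (min_cut_size P)"
proof -
  let ?s = "graph_size P" and ?r = "min_cut_size P"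
  \<comment> \<open>For n >= s one has n < s (n div s) + s <= 2 s (n div s), so that n div s is at
    least n / (2 s).\<close>
  define c where "c = (1 / (2 * real ?s)) ^ ?r"
  have c: "c > 0" using graph_size_pos by (simp add: c_def)
  have lower: "c * real n ^ ?r \<le> real (dispersion P n)" if n: "n \<ge> ?s" for n
  proof -
    have d: "n div ?s \<ge> 1" using n graph_size_pos by (simp add: Suc_le_eq div_greater_zero_iff)
    have "n < ?s * (n div ?s) + ?s"
      using mod_less_divisor[OF graph_size_pos, of n] by (metis mult_div_mod_eq nat_add_left_cancel_less)
    also have "\<dots> \<le> 2 * ?s * (n div ?s)" using mult_le_mono2[OF d, of ?s] by simp
    finally have "real n \<le> real (2 * ?s * (n div ?s))" by (intro of_nat_mono) simp
    then have "1 / (2 * real ?s) * real n \<le> real (n div ?s)"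
      using graph_size_pos by (simp add: field_simps)
    then have "(1 / (2 * real ?s) * real n) ^ ?r \<le> real (n div ?s) ^ ?r" by (intro power_mono) auto
    also have "\<dots> = real ((n div ?s) ^ ?r)" by simp
    also have "\<dots> \<le> real (dispersion P n)" using dispersion_bounds(1)[OF nid n] by (intro of_nat_mono)
    finally show ?thesis unfolding c_def power_mult_distrib .
  qed
  have upper: "real (dispersion P n) \<le> real n ^ ?r" if "n \<ge> ?s" for n
    using dispersion_bounds(2)[OF nid that] of_nat_mono by fastforce
  show "(\<lambda>n. real (dispersion P n)) \<in> \<Theta>(\<lambda>n. real n ^ ?r)"
  proof (rule bigthetaI')
    show "\<forall>\<^sub>F n in sequentially. c * norm (real n ^ ?r) \<le> norm (real (dispersion P n)) \<and>
        norm (real (dispersion P n)) \<le> 1 * norm (real n ^ ?r)"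
      using eventually_ge_at_top[of ?s] by eventually_elim (use lower upper in simp)
  qed (use c in auto)
  have ln: "\<forall>\<^sub>F n in sequentially. ln c / ln (real n) + real ?r \<le> ln (real (dispersion P n)) / ln (real n) \<and>
      ln (real (dispersion P n)) / ln (real n) \<le> real ?r"
    \<comment> \<open>From 2 on the logarithm of n is positive, so that dividing by it preserves the
      inequalities.\<close>
    using eventually_ge_at_top[of "max ?s 2"]
  proof eventually_elim
    case (elim n)
    then have n: "n \<ge> ?s" "real n > 1" by auto
    have pos: "c * real n ^ ?r > 0" using c n by simp
    have "ln (c * real n ^ ?r) \<le> ln (real (dispersion P n))"
      using lower[OF n(1)] pos by (subst ln_le_cancel_iff) linarith+
    moreover have "ln (c * real n ^ ?r) = ln c + real ?r * ln (real n)"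
      using c n by (simp add: ln_mult ln_realpow)
    moreover have "ln (real (dispersion P n)) \<le> ln (real n ^ ?r)"
      using upper[OF n(1)] lower[OF n(1)] pos n by (subst ln_le_cancel_iff) linarith+
    moreover have "ln (real n ^ ?r) = real ?r * ln (real n)" using n by (simp add: ln_realpow)
    moreover have pos_ln: "ln (real n) > 0" using n by simp
    ultimately have "(ln c + real ?r * ln (real n)) / ln (real n) \<le> ln (real (dispersion P n)) / ln (real n)"
      "ln (real (dispersion P n)) / ln (real n) \<le> real ?r * ln (real n) / ln (real n)"
      by (intro divide_right_mono; simp)+
    then show ?case using pos_ln by (simp add: add_divide_distrib)
  qed
  have "(\<lambda>n. ln c / ln (real n)) \<longlonglongrightarrow> 0"
    by (rule tendsto_divide_0[OF tendsto_const])
       (intro filterlim_at_top_imp_at_infinity filterlim_compose[OF ln_at_top filterlim_real_sequentially])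
  then have low: "(\<lambda>n. ln c / ln (real n) + real ?r) \<longlonglongrightarrow> real ?r"
    using tendsto_add[of _ 0 _ "\<lambda>_. real ?r" "real ?r"] by simp
  show "(\<lambda>n. ln (real (dispersion P n)) / ln (real n)) \<longlonglongrightarrow> real ?r"
    by (rule tendsto_sandwich[OF _ _ low tendsto_const]) (use ln in \<open>auto elim: eventually_mono\<close>)
qed

end

section \<open>Parsing\<close>

text \<open>The digit part of \<open>enc_nat\<close>. As it is injective, names can be compared by
  their digit lists without forming the numbers.\<close>

fun digits :: "nat \<Rightarrow> bool list" where
  "digits n = (if n = 0 then [] else odd n # digits (n div 2))"

declare digits.simps [simp del]

definition undigits :: "bool list \<Rightarrow> nat" where
  "undigits ds = foldr (\<lambda>b v. 2 * v + of_bool b) ds 0"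

lemma undigits_digits [simp]: "undigits (digits n) = n"
proof (induction n rule: digits.induct)
  case (1 n)
  show ?case
  proof (cases "n = 0")
    case False
    then have "undigits (digits n) = 2 * (n div 2) + of_bool (odd n)"
      using 1 by (subst digits.simps) (simp add: undigits_def)
    then show ?thesis by simp
  qed (simp add: digits.simps undigits_def)
qed

lemma digits_inject [simp]: "digits m = digits n \<longleftrightarrow> m = n"
  by (metis undigits_digits)

definition mark_digits :: "bool list \<Rightarrow> bool list" where
  "mark_digits ds = foldr (\<lambda>b r. True # b # r) ds [False]"

lemma enc_nat_digits: "enc_nat n = mark_digits (digits n)"
proof (induction n rule: enc_nat.induct)
  case (1 n)
  then show ?case
    by (cases "n = 0") (simp_all add: enc_nat.simps[of n] enc_nat.simps[of 0] digits.simps[of n] digits.simps[of 0]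
        mark_digits_def)
qed

lemma enc_nat_nonempty [simp]: "enc_nat n \<noteq> []"
  by (subst enc_nat.simps) simp

lemma ptime_mark_digits [ptime_intros]: assumes "ptime f" shows "ptime (\<lambda>x. mark_digits (f x))"
  unfolding mark_digits_def
proof (rule ptime_foldr_additive[where N = "\<lambda>_. 5"])
  show "tsize (True # h # r) \<le> tsize r + 5" for h r using tsize_bool[of h] by simp
qed (intro ptime_intros poly_bounds assms)+

primrec inc_digits :: "bool list \<Rightarrow> bool list" where
  "inc_digits [] = [True]"
| "inc_digits (b # ds) = (if b then False # inc_digits ds else True # ds)"

lemma inc_digits_digits [simp]: "inc_digits (digits n) = digits (Suc n)"
proof (induction n rule: digits.induct)
  case (1 n)
  show ?case
  proof (cases "n = 0")
    case True
    then show ?thesis by (simp add: digits.simps)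
  next
    case False
    then have d: "digits n = odd n # digits (n div 2)" by (subst digits.simps) simp
    have s: "digits (Suc n) = even n # digits (Suc n div 2)" by (subst digits.simps) simp
    show ?thesis
    proof (cases "even n")
      case True
      then show ?thesis unfolding d s by simp
    next
      case False
      then have "Suc n div 2 = Suc (n div 2)" by presburger
      with 1[OF \<open>n \<noteq> 0\<close>] False show ?thesis unfolding d s by simp
    qed
  qed
qed

lemma ptime_inc_digits: "ptime inc_digits"
proof -
  have "inc_digits = (\<lambda>ds. rec_list [True] (\<lambda>h t r. if h then False # r else True # t) ds)"
  proof
    fix ds show "inc_digits ds = rec_list [True] (\<lambda>h t r. if h then False # r else True # t) ds"
      by (induction ds) auto
  qed
  moreover have "ptime (\<lambda>x. rec_list [True] (\<lambda>h t r. if h then False # r else True # t) x)"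
  proof (rule ptime_rec_list[where N = "\<lambda>x. tsize x + 2"])
    fix x s :: "bool list" assume "suffix s x"
    moreover have "tsize (rec_list [True] (\<lambda>h t r. if h then False # r else True # t) s) \<le> tsize s + 2"
      by (induction s) auto
    ultimately show "tsize (rec_list [True] (\<lambda>h t r. if h then False # r else True # t) s) \<le> tsize x + 2"
      using tsize_suffix_le[of s x] by simp
  qed (intro ptime_intros poly_bounds)+
  ultimately show ?thesis by simp
qed

lemma inc_digits_size: "tsize (inc_digits ds) \<le> tsize ds + 2"
  by (induction ds) auto

text \<open>Conversion from unary by counting up: n increments of a binary counter, each adding at
  most two cells.\<close>

lemma ptime_digits [ptime_intros]:
  assumes "ptime f" shows "ptime (\<lambda>x. digits (f x))"
proof -
  have "digits n = (inc_digits ^^ n) []" for n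
    by (induction n) (simp_all add: digits.simps[of 0] inc_digits_digits[symmetric] del: inc_digits_digits)
  moreover have "ptime (\<lambda>x. (inc_digits ^^ f x) [])"
    by (rule ptime_funpow_additive[where N = "\<lambda>_. 2"])
       (intro ptime_intros poly_bounds assms ptime_comp[OF ptime_inc_digits] inc_digits_size)+
  ultimately show ?thesis by simp
qed

lemma ptime_enc_nat [ptime_intros]: "ptime f \<Longrightarrow> ptime (\<lambda>x. enc_nat (f x))"
  unfolding enc_nat_digits by (intro ptime_intros)

text \<open>
  On arbitrary bit strings a digit list may denote a number exponential in the input; reading
  numbers off in unary is therefore cut off at \<open>cap\<close>, which no length or position in a valid
  description exceeds.
\<close>

definition unary :: "nat \<Rightarrow> bool list \<Rightarrow> nat" where
  "unary cap ds = foldl (\<lambda>v b. min cap (2 * v + (if b then 1 else 0))) 0 (rev ds)"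

text \<open>Doubling and adding never lead back below the cap, so capping in every round agrees with
  capping once at the end.\<close>

lemma unary_undigits: "unary cap ds = min cap (undigits ds)"
  unfolding unary_def undigits_def by (induction ds) (auto simp: min_def)

lemma unary_digits: "unary cap (digits n) = min cap n"
  by (simp add: unary_undigits)

lemma unary_le: "unary cap ds \<le> cap"
  by (simp add: unary_undigits)

lemma ptime_unary [ptime_intros]:
  assumes "ptime c" "ptime f" shows "ptime (\<lambda>x. unary (c x) (f x))"
  unfolding unary_def
proof (rule ptime_foldl_indexed[where N = "\<lambda>x. tsize (c x)" and J = "\<lambda>x i r. r \<le> c x"])
  show "ptime (\<lambda>p. min (c (fst p)) (2 * snd (snd p) + (if fst (snd p) then 1 else 0)))"
    by (intro ptime_intros ptime_comp[OF assms(1)])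
qed (intro ptime_intros poly_bounds assms | simp)+

text \<open>The state consists of the digits read so far in reverse, the rest of the input and a
  flag that makes further rounds idle; the number of rounds can thus be the length of the
  input.\<close>

definition num_step :: "bool list \<times> bool list \<times> bool \<Rightarrow> bool list \<times> bool list \<times> bool" where
  "num_step s = (if snd (snd s) then s else
     case fst (snd s) of [] \<Rightarrow> (fst s, [], True)
     | b # r \<Rightarrow> if b then (case r of [] \<Rightarrow> (fst s, [], True) | d # r' \<Rightarrow> (d # fst s, r', False))
         else (fst s, r, True))"

definition parse_num :: "bool list \<Rightarrow> bool list \<times> bool list" where
  "parse_num bs = (let s = (num_step ^^ length bs) ([], bs, False) in (rev (fst s), fst (snd s)))"

lemma num_step_run:
  "length ds < k \<Longrightarrow>
    (num_step ^^ k) (acc, mark_digits ds @ rest, False) = (rev ds @ acc, rest, True)"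
proof (induction ds arbitrary: acc k)
  case Nil
  have stop: "(num_step ^^ j) (acc, rest, True) = (acc, rest, True)" for j
    by (induction j) (auto simp: num_step_def)
  obtain j where "k = Suc j" using Nil by (cases k) auto
  then show ?case
    by (simp add: funpow_Suc_right stop mark_digits_def del: funpow.simps(2))
       (simp add: num_step_def stop)
next
  case (Cons d ds)
  then obtain j where j: "k = Suc j" "length ds < j" by (cases k) auto
  have "num_step (acc, mark_digits (d # ds) @ rest, False) = (d # acc, mark_digits ds @ rest, False)"
    by (simp add: num_step_def mark_digits_def)
  then show ?case using Cons.IH[OF j(2)] by (simp add: j funpow_Suc_right del: funpow.simps(2))
qed

lemma length_mark_digits: "length (mark_digits ds) = Suc (2 * length ds)"
  unfolding mark_digits_def by (induction ds) auto

lemma parse_num [simp]: "parse_num (enc_nat n @ rest) = (digits n, rest)"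
  unfolding parse_num_def enc_nat_digits
  by (subst num_step_run) (simp_all add: length_mark_digits)

lemma num_step_size: "tsize (fst (num_step s)) + tsize (fst (snd (num_step s))) \<le> tsize (fst s) + tsize (fst (snd s))"
  by (auto simp: num_step_def split: list.split)

lemma num_steps_size:
  "tsize (fst ((num_step ^^ k) s)) + tsize (fst (snd ((num_step ^^ k) s))) \<le> tsize (fst s) + tsize (fst (snd s))"
  by (induction k) (auto intro: order.trans[OF num_step_size])

lemma parse_num_size: "tsize (fst (parse_num bs)) + tsize (snd (parse_num bs)) \<le> tsize bs"
  using num_steps_size[of "length bs" "([], bs, False)"] by (simp add: parse_num_def Let_def)

lemma ptime_num_step: "ptime num_step"
  unfolding num_step_def by (intro ptime_intros)

lemma ptime_parse_num': "ptime parse_num"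
  unfolding parse_num_def
proof (intro ptime_intros)
  show "ptime (\<lambda>bs. (num_step ^^ length bs) ([], bs, False))"
  proof (rule ptime_funpow_indexed[where N = "\<lambda>x. 3 + tsize x" and
        J = "\<lambda>x i s. tsize (fst s) + tsize (fst (snd s)) \<le> tsize x"])
    show "tsize r \<le> 3 + tsize x" if "tsize (fst r) + tsize (fst (snd r)) \<le> tsize x"
      for x :: "bool list" and r :: "bool list \<times> bool list \<times> bool"
      using that tsize_bool[of "snd (snd r)"] by (cases r) auto
  qed (intro ptime_intros poly_bounds ptime_comp[OF ptime_num_step] |
       simp | rule order.trans[OF num_step_size])+
qed

lemmas ptime_parse_num [ptime_intros] = ptime_comp[OF ptime_parse_num']

section \<open>Parsers and their combination\<close>

definition shrinking :: "(bool list \<Rightarrow> 'a \<times> bool list) \<Rightarrow> bool" where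
  "shrinking p \<longleftrightarrow> (\<forall>bs. tsize (snd (p bs)) \<le> tsize bs)"

lemma shrinkingD: "shrinking p \<Longrightarrow> tsize (snd (p bs)) \<le> tsize bs"
  by (simp add: shrinking_def)

lemma shrinking_parse_num: "shrinking parse_num"
  unfolding shrinking_def using parse_num_size add_leD2 by blast

definition parse_list :: "(bool list \<Rightarrow> 'a \<times> bool list) \<Rightarrow> bool list \<Rightarrow> 'a list \<times> bool list" where
  "parse_list p bs = (case parse_num bs of (n, r) \<Rightarrow>
     ((\<lambda>s. case p (snd s) of (y, r') \<Rightarrow> (fst s @ [y], r')) ^^ unary (length bs) n) ([], r))"

lemma parse_list_run:
  assumes "\<And>x rest. x \<in> set xs \<Longrightarrow> p (e x @ rest) = (g x, rest)"
  shows "((\<lambda>s. case p (snd s) of (y, r') \<Rightarrow> (fst s @ [y], r')) ^^ length xs)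
    (acc, concat (map e xs) @ rest) = (acc @ map g xs, rest)"
  using assms
  by (induction xs arbitrary: acc) (simp_all add: funpow_Suc_right del: funpow.simps(2))

text \<open>\<open>parse_list\<close> caps the number of entries by the length of the input.
  Nonempty codes make a list no longer than its code, so on valid input the cap cuts nothing
  off.\<close>

lemma parse_list:
  assumes p: "\<And>x rest. x \<in> set xs \<Longrightarrow> p (e x @ rest) = (g x, rest)"
    and ne: "\<And>x. x \<in> set xs \<Longrightarrow> e x \<noteq> []"
  shows "parse_list p (enc_list e xs @ rest) = (map g xs, rest)"
proof -
  have "length xs \<le> length (concat (map e xs))"
    using ne by (induction xs) (auto simp: Suc_le_eq intro: add_strict_increasing)
  then have "unary (length (enc_list e xs @ rest)) (digits (length xs)) = length xs"
    by (simp add: unary_digits enc_list_def)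
  then show ?thesis
    unfolding parse_list_def enc_list_def append_assoc parse_num prod.case
    using parse_list_run[of xs p e g "[]" rest] p by simp
qed

lemma shrinking_parse_list:
  assumes "shrinking p" shows "shrinking (parse_list p)"
  unfolding shrinking_def
proof
  fix bs
  let ?f = "\<lambda>s. case p (snd s) of (y, r') \<Rightarrow> (fst s @ [y], r')"
  have "snd ((?f ^^ k) s) = ((\<lambda>r. snd (p r)) ^^ k) (snd s)" for k s
    by (induction k) (simp_all add: case_prod_beta)
  moreover have "tsize (((\<lambda>r. snd (p r)) ^^ k) r) \<le> tsize r" for k r
    by (induction k) (auto intro: order.trans[OF shrinkingD[OF assms]])
  ultimately show "tsize (snd (parse_list p bs)) \<le> tsize bs"
    unfolding parse_list_def
    using shrinkingD[OF shrinking_parse_num, of bs] by (simp add: case_prod_beta) (metis order.trans)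
qed

text \<open>As \<open>p\<close> never enlarges the rest, every entry is parsed from a string no
  larger than the input, so that one polynomial bounds all entries.\<close>

lemma ptime_parse_list':
  assumes p: "ptime p" and sh: "shrinking p" shows "ptime (parse_list p)"
proof -
  obtain k where k: "\<And>r. tsize (p r) \<le> (tsize r + 2) ^ k"
    using ptime_tsize[OF p] unfolding poly_bounded_def by blast
  have B: "tsize (fst (p r)) \<le> (m + 2) ^ k" if "tsize r \<le> m" for r m
  proof -
    have "tsize (fst (p r)) \<le> (tsize r + 2) ^ k" by (rule order.trans[OF tsize_fst_le k])
    also have "\<dots> \<le> (m + 2) ^ k" using that by (intro power_mono) auto
    finally show ?thesis .
  qed
  show ?thesis
    unfolding parse_list_def case_prod_beta
  proof (rule ptime_funpow_indexed[where
        N = "\<lambda>x. 1 + tsize x * Suc ((tsize x + 2) ^ k) + tsize x" and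
        J = "\<lambda>x i s. tsize (snd s) \<le> tsize x \<and> tsize (fst s) \<le> i * Suc ((tsize x + 2) ^ k)"])
    fix x :: "bool list"
    show "tsize (snd ([] :: 'a list, snd (parse_num x))) \<le> tsize x \<and>
        tsize (fst ([] :: 'a list, snd (parse_num x))) \<le> 0 * Suc ((tsize x + 2) ^ k)"
      using shrinkingD[OF shrinking_parse_num, of x] by simp
    fix i and r :: "'a list \<times> bool list"
    assume J: "tsize (snd r) \<le> tsize x \<and> tsize (fst r) \<le> i * Suc ((tsize x + 2) ^ k)"
    then show "tsize (snd (fst r @ [fst (p (snd r))], snd (p (snd r)))) \<le> tsize x \<and>
       tsize (fst (fst r @ [fst (p (snd r))], snd (p (snd r)))) \<le> Suc i * Suc ((tsize x + 2) ^ k)"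
      using B[of "snd r" "tsize x"] shrinkingD[OF sh, of "snd r"] by simp
    assume "i \<le> unary (length x) (fst (parse_num x))"
    then have "i \<le> tsize x" using unary_le[of "length x" "fst (parse_num x)"] length_le_tsize[of x] by linarith
    then have "i * Suc ((tsize x + 2) ^ k) \<le> tsize x * Suc ((tsize x + 2) ^ k)" by (rule mult_right_mono) simp
    then show "tsize r \<le> 1 + tsize x * Suc ((tsize x + 2) ^ k) + tsize x"
      using J by (cases r) auto
  qed (intro ptime_intros poly_bounds ptime_comp[OF p])+
qed

lemmas ptime_parse_list = ptime_comp[OF ptime_parse_list']

definition parse_pair ::
  "(bool list \<Rightarrow> 'a \<times> bool list) \<Rightarrow> (bool list \<Rightarrow> 'b \<times> bool list) \<Rightarrow> bool list \<Rightarrow> ('a \<times> 'b) \<times> bool list" where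
  "parse_pair p q bs = (case p bs of (a, r) \<Rightarrow> case q r of (b, r') \<Rightarrow> ((a, b), r'))"

lemma parse_pair:
  assumes "\<And>rest. p (e (fst x) @ rest) = (g (fst x), rest)" "\<And>rest. q (e' (snd x) @ rest) = (g' (snd x), rest)"
  shows "parse_pair p q (enc_pair e e' x @ rest) = (map_prod g g' x, rest)"
  unfolding parse_pair_def enc_pair_def append_assoc assms prod.case by (cases x) simp

lemma shrinking_parse_pair: "shrinking p \<Longrightarrow> shrinking q \<Longrightarrow> shrinking (parse_pair p q)"
  unfolding shrinking_def parse_pair_def case_prod_beta snd_conv using order.trans by blast

lemma ptime_parse_pair':
  assumes "ptime p" "ptime q" shows "ptime (parse_pair p q)"
  unfolding parse_pair_def by (intro ptime_intros ptime_comp[OF assms(1)] ptime_comp[OF assms(2)])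

definition parse_flag :: "bool list \<Rightarrow> bool \<times> bool list" where
  "parse_flag bs = (case bs of [] \<Rightarrow> (False, []) | b # r \<Rightarrow> (b, r))"

lemma parse_flag [simp]: "parse_flag (b # r) = (b, r)"
  by (simp add: parse_flag_def)

lemma shrinking_parse_flag: "shrinking parse_flag"
  unfolding shrinking_def by (auto simp: parse_flag_def split: list.split)

lemma ptime_parse_flag [ptime_intros]: "ptime f \<Longrightarrow> ptime (\<lambda>x. parse_flag (f x))"
  unfolding parse_flag_def by (intro ptime_intros)

type_synonym raw_node = "bool \<times> bool list \<times> bool list list"

fun raw_node :: "node \<Rightarrow> raw_node" where
  "raw_node (VarNode x) = (False, digits x, [])"
| "raw_node (FunNode f js) = (True, digits f, map digits js)"

definition parse_node :: "bool list \<Rightarrow> raw_node \<times> bool list" where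
  "parse_node bs = (case parse_flag bs of (b, r) \<Rightarrow> case parse_num r of (f, r1) \<Rightarrow>
     if b then (case parse_list parse_num r1 of (js, r2) \<Rightarrow> ((True, f, js), r2))
     else ((False, f, []), r1))"

lemma parse_list_nums [simp]:
  "parse_list parse_num (enc_list enc_nat ns @ rest) = (map digits ns, rest)"
  by (rule parse_list) simp_all

lemma parse_node [simp]: "parse_node (enc_node nd @ rest) = (raw_node nd, rest)"
  by (cases nd) (simp_all add: parse_node_def)

lemma shrinking_parse_node: "shrinking parse_node"
  unfolding shrinking_def
proof
  fix bs
  show "tsize (snd (parse_node bs)) \<le> tsize bs"
    using shrinkingD[OF shrinking_parse_flag, of bs]
      shrinkingD[OF shrinking_parse_num, of "snd (parse_flag bs)"]
      shrinkingD[OF shrinking_parse_list[OF shrinking_parse_num], of "snd (parse_num (snd (parse_flag bs)))"]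
    by (auto simp: parse_node_def case_prod_beta)
qed

lemma ptime_parse_node: "ptime parse_node"
  unfolding parse_node_def
  by (intro ptime_intros ptime_parse_list[OF ptime_parse_num' shrinking_parse_num])

section \<open>Terms as preorder sequences\<close>

type_synonym token = "bool \<times> bool list \<times> bool list"

text \<open>Each symbol carries its number of arguments, which makes the sequence uniquely readable.
  Unlike terms, such sequences form a list type, within reach of list recursion.\<close>

primrec tokens :: "(nat, nat) trm \<Rightarrow> token list" where
  "tokens (Var x) = [(False, digits x, [])]"
| "tokens (Fun f us) = (True, digits f, digits (length us)) # concat (map tokens us)"

definition parse_token :: "bool list \<Rightarrow> token \<times> bool list" where
  "parse_token bs = (case parse_flag bs of (b, r) \<Rightarrow> case parse_num r of (f, r1) \<Rightarrow>
     if b then (case parse_num r1 of (n, r2) \<Rightarrow> ((True, f, n), r2)) else ((False, f, []), r1))"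

lemma parse_token_size:
  "tsize (fst (parse_token bs)) \<le> tsize bs + 3" "tsize (snd (parse_token bs)) \<le> tsize bs"
proof -
  let ?r = "snd (parse_flag bs)"
  show "tsize (snd (parse_token bs)) \<le> tsize bs"
    using shrinkingD[OF shrinking_parse_flag, of bs] shrinkingD[OF shrinking_parse_num, of ?r]
      shrinkingD[OF shrinking_parse_num, of "snd (parse_num ?r)"]
    by (auto simp: parse_token_def case_prod_beta)
  show "tsize (fst (parse_token bs)) \<le> tsize bs + 3"
    using shrinkingD[OF shrinking_parse_flag, of bs] parse_num_size[of ?r]
      parse_num_size[of "snd (parse_num ?r)"]
    by (auto simp: parse_token_def case_prod_beta)
qed

lemma ptime_parse_token: "ptime parse_token"
  unfolding parse_token_def by (intro ptime_intros)

text \<open>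
  The first component of a token state counts the terms still to be read; reading stops when it
  reaches \<open>0\<close>, so no recursion over the nesting of terms is needed.
\<close>

type_synonym token_state = "nat \<times> token list \<times> bool list"

definition token_step :: "nat \<Rightarrow> token_state \<Rightarrow> token_state" where
  "token_step cap s = (if fst s = 0 then s else
     case parse_token (snd (snd s)) of (tok, r) \<Rightarrow>
       (fst s - 1 + (if fst tok then unary cap (snd (snd tok)) else 0), fst (snd s) @ [tok], r))"

definition parse_tokens :: "nat \<Rightarrow> nat \<Rightarrow> bool list \<Rightarrow> token list \<times> bool list" where
  "parse_tokens cap n bs = snd ((token_step cap ^^ cap) (n, [], bs))"

lemma length_le_enc_trms: "length us \<le> length (concat (map enc_trm us))"
proof (induction us)
  case (Cons t us)
  have "enc_trm t \<noteq> []" by (cases t) auto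
  then have "length (enc_trm t) \<ge> 1" by (simp add: Suc_le_eq)
  then show ?case using Cons by simp
qed simp

text \<open>The claim for single terms is a hypothesis, so that the lemma serves inside the
  induction on terms and later for whole lists.\<close>

lemma token_step_run_list:
  assumes "\<And>t m acc rest. t \<in> set ts \<Longrightarrow>
    (token_step cap ^^ length (tokens t)) (Suc m, acc, enc_trm t @ rest) = (m, acc @ tokens t, rest)"
  shows "(token_step cap ^^ length (concat (map tokens ts))) (length ts + m, acc, concat (map enc_trm ts) @ rest)
      = (m, acc @ concat (map tokens ts), rest)"
  using assms
proof (induction ts arbitrary: acc)
  case (Cons t ts)
  have step: "(token_step cap ^^ length (tokens t)) (Suc (length ts + m), acc, enc_trm t @ concat (map enc_trm ts) @ rest)
      = (length ts + m, acc @ tokens t, concat (map enc_trm ts) @ rest)"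
    using Cons.prems by simp
  have "(token_step cap ^^ (length (concat (map tokens ts)) + length (tokens t)))
      (Suc (length ts + m), acc, enc_trm t @ concat (map enc_trm ts) @ rest)
      = (m, (acc @ tokens t) @ concat (map tokens ts), rest)"
    unfolding funpow_add comp_def step using Cons by simp
  then show ?case by (simp add: add.commute)
qed simp

lemma length_enc_trm_le: "t \<in> set ts \<Longrightarrow> length (enc_trm t) \<le> length (concat (map enc_trm ts))"
  by (induction ts) auto

lemma token_step_run:
  "length (enc_trm t) \<le> cap \<Longrightarrow>
    (token_step cap ^^ length (tokens t)) (Suc m, acc, enc_trm t @ rest) = (m, acc @ tokens t, rest)"
proof (induction t arbitrary: m acc rest)
  case (Var x)
  then show ?case by (simp add: token_step_def parse_token_def)
next
  case (Fun f us)
  have first: "token_step cap (Suc m, acc, enc_trm (Fun f us) @ rest) =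
      (length us + m, acc @ [(True, digits f, digits (length us))], concat (map enc_trm us) @ rest)"
    using Fun.prems length_le_enc_trms[of us] by (simp add: token_step_def parse_token_def unary_digits)
  have "length (enc_trm u) \<le> cap" if "u \<in> set us" for u
    using length_enc_trm_le[OF that] Fun.prems by simp
  then have "(token_step cap ^^ Suc (length (concat (map tokens us)))) (Suc m, acc, enc_trm (Fun f us) @ rest)
      = (m, (acc @ [(True, digits f, digits (length us))]) @ concat (map tokens us), rest)"
    unfolding funpow_Suc_right comp_def first by (intro token_step_run_list Fun.IH)
  then show ?case by simp
qed

lemma length_tokens_le: "length (tokens t) \<le> length (enc_trm t)"
proof (induction t)
  case (Fun f us)
  then have "length (concat (map tokens us)) \<le> length (concat (map enc_trm us))"
    by (induction us) (auto intro: add_mono)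
  then show ?case by simp
qed simp

lemma parse_tokens:
  assumes "length (concat (map enc_trm ts)) \<le> cap"
  shows "parse_tokens cap (length ts) (concat (map enc_trm ts) @ rest) = (concat (map tokens ts), rest)"
proof -
  let ?l = "length (concat (map tokens ts))"
  have "?l \<le> length (concat (map enc_trm ts))"
    by (induction ts) (auto intro: add_mono length_tokens_le)
  then obtain j where j: "cap = j + ?l" using assms by (metis add.commute le_Suc_ex order.trans)
  have short: "length (enc_trm t) \<le> cap" if "t \<in> set ts" for t
    using length_enc_trm_le[OF that] assms by simp
  have stop: "(token_step cap ^^ j) (0, s) = (0, s)" for j s
    by (induction j) (auto simp: token_step_def)
  have "(token_step cap ^^ (j + ?l)) (length ts, [], concat (map enc_trm ts) @ rest) =
      (0, concat (map tokens ts), rest)"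
    unfolding funpow_add comp_def
    using token_step_run_list[of ts cap 0 "[]" rest, OF token_step_run[OF short]] by (simp add: stop)
  then show ?thesis unfolding parse_tokens_def using j by simp
qed

lemma ptime_parse_tokens [ptime_intros]:
  assumes "ptime c" "ptime n" "ptime l"
  shows "ptime (\<lambda>x. parse_tokens (c x) (n x) (l x))"
  unfolding parse_tokens_def
proof (rule ptime_snd, rule ptime_funpow_indexed[where
      N = "\<lambda>x. 2 + (tsize (n x) + tsize (c x) * tsize (c x)) + tsize (c x) * (tsize (l x) + 4) + tsize (l x)" and
      J = "\<lambda>x i s. fst s \<le> n x + i * c x \<and> tsize (fst (snd s)) \<le> i * (tsize (l x) + 4) \<and>
        tsize (snd (snd s)) \<le> tsize (l x)"])
  show "ptime (\<lambda>p. token_step (c (fst p)) (snd p))"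
    unfolding token_step_def by (intro ptime_intros ptime_comp[OF ptime_parse_token] ptime_comp[OF assms(1)])
  fix x i and r :: token_state
  assume J: "fst r \<le> n x + i * c x \<and> tsize (fst (snd r)) \<le> i * (tsize (l x) + 4) \<and>
        tsize (snd (snd r)) \<le> tsize (l x)"
  show "fst (token_step (c x) r) \<le> n x + Suc i * c x \<and>
      tsize (fst (snd (token_step (c x) r))) \<le> Suc i * (tsize (l x) + 4) \<and>
      tsize (snd (snd (token_step (c x) r))) \<le> tsize (l x)"
    using J parse_token_size[of "snd (snd r)"] unary_le[of "c x" "snd (snd (fst (parse_token (snd (snd r)))))"]
    by (auto simp: token_step_def case_prod_beta)
  assume i: "i \<le> c x"
  have "i * c x \<le> c x * c x" "i * (tsize (l x) + 4) \<le> c x * (tsize (l x) + 4)"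
    using i by (auto intro!: mult_mono)
  moreover obtain m toks bs where r: "r = (m, toks, bs)" by (cases r)
  ultimately show "tsize r \<le> 2 + (tsize (n x) + tsize (c x) * tsize (c x)) + tsize (c x) * (tsize (l x) + 4) + tsize (l x)"
    using J unfolding r tsize_simps tsize_nat fst_conv snd_conv by linarith
qed (intro ptime_intros poly_bounds assms | simp)+

section \<open>The table of distinct terms\<close>

type_synonym key = "bool \<times> bool list \<times> nat list"

text \<open>Hash consing with linear search: \<open>takeWhile\<close> stops at the position of
  \<open>k\<close>, or runs through the whole table and yields the position at which
  \<open>k\<close> gets appended.\<close>

definition intern :: "key \<Rightarrow> key list \<Rightarrow> nat \<times> key list" where
  "intern k T = (length (takeWhile (\<lambda>k'. k' \<noteq> k) T), if k \<in> set T then T else T @ [k])"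

fun is_key :: "(nat, nat) trm list \<Rightarrow> key \<Rightarrow> (nat, nat) trm \<Rightarrow> bool" where
  "is_key tt k (Var x) \<longleftrightarrow> k = (False, digits x, [])"
| "is_key tt k (Fun f us) \<longleftrightarrow>
     (\<exists>js. k = (True, digits f, js) \<and> (\<forall>j\<in>set js. j < length tt) \<and> map ((!) tt) js = us)"

text \<open>The list \<open>tt\<close> exists only in proofs. Its terms may be exponentially larger
  than a node list describing them; the algorithm stores just the keys, whose arguments are
  positions.\<close>

definition represents :: "key list \<Rightarrow> (nat, nat) trm list \<Rightarrow> bool" where
  "represents T tt \<longleftrightarrow> length T = length tt \<and> distinct tt \<and> (\<forall>i<length T. is_key tt (T ! i) (tt ! i))"

lemma is_key_mono: "is_key tt k t \<Longrightarrow> prefix tt tt' \<Longrightarrow> is_key tt' k t"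
proof (cases t)
  case (Fun f us)
  assume "is_key tt k t" "prefix tt tt'"
  then obtain js where js: "k = (True, digits f, js)" "\<forall>j\<in>set js. j < length tt" "map ((!) tt) js = us"
    using Fun by auto
  obtain zs where "tt' = tt @ zs" using \<open>prefix tt tt'\<close> by (auto simp: prefix_def)
  then show ?thesis using js Fun by (auto simp: nth_append)
qed simp

text \<open>Distinct table entries let argument positions be recovered from argument terms. Together
  with the converse uniqueness this turns syntactic equality of terms into equality of
  positions.\<close>

lemma is_key_unique1: "distinct tt \<Longrightarrow> is_key tt k t \<Longrightarrow> is_key tt k' t \<Longrightarrow> k = k'"
proof (cases t)
  case (Fun f us)
  assume d: "distinct tt" and "is_key tt k t" "is_key tt k' t"
  then obtain js js' where js: "k = (True, digits f, js)" "\<forall>j\<in>set js. j < length tt"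
    "k' = (True, digits f, js')" "\<forall>j\<in>set js'. j < length tt" "map ((!) tt) js = map ((!) tt) js'"
    using Fun by auto
  have "inj_on ((!) tt) {..<length tt}" using d by (intro inj_on_nth) auto
  then have "js = js'" by (intro map_inj_on[OF js(5)]) (use js in \<open>auto elim: inj_on_subset\<close>)
  then show ?thesis using js by simp
qed simp

lemma is_key_unique2: "is_key tt k t \<Longrightarrow> is_key tt k t' \<Longrightarrow> t = t'"
  by (cases t; cases t') auto

lemma length_takeWhile_neq_less: "k \<in> set T \<Longrightarrow> length (takeWhile (\<lambda>k'. k' \<noteq> k) T) < length T"
  by (induction T) auto

lemma intern:
  assumes T: "represents T tt" and k: "is_key tt k t"
  obtains i T' tt' where "intern k T = (i, T')" "represents T' tt'" "prefix tt tt'"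
    "i < length tt'" "tt' ! i = t"
proof -
  note R = T[unfolded represents_def]
  show ?thesis
  proof (cases "k \<in> set T")
    case True
    let ?i = "length (takeWhile (\<lambda>k'. k' \<noteq> k) T)"
    have i: "?i < length T" "T ! ?i = k"
      using True nth_length_takeWhile[of "\<lambda>k'. k' \<noteq> k" T] length_takeWhile_neq_less[OF True] by auto
    then have "is_key tt k (tt ! ?i)" using R by metis
    then have "tt ! ?i = t" using is_key_unique2 k by blast
    then show ?thesis using i True R T by (intro that[of ?i T tt]) (auto simp: intern_def)
  next
    case False
    have "t \<notin> set tt"
    proof
      assume "t \<in> set tt"
      then obtain i where "i < length tt" "tt ! i = t" by (auto simp: in_set_conv_nth)
      then have "T ! i = k" "i < length T" using is_key_unique1[of tt "T ! i" t k] R k by auto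
      then show False using False by auto
    qed
    have "takeWhile (\<lambda>k'. k' \<noteq> k) T = T" using False by (auto simp: takeWhile_eq_all_conv)
    then have "length (takeWhile (\<lambda>k'. k' \<noteq> k) T) = length T" by (rule arg_cong)
    moreover have "represents (T @ [k]) (tt @ [t])"
      using R \<open>t \<notin> set tt\<close> is_key_mono[of tt _ _ "tt @ [t]"] k
      by (auto simp: represents_def nth_append less_Suc_eq)
    ultimately show ?thesis using False R
      by (intro that[of "length T" "T @ [k]" "tt @ [t]"]) (auto simp: intern_def)
  qed
qed

lemma represents_args: "represents T tt \<Longrightarrow> Fun f us \<in> set tt \<Longrightarrow> set us \<subseteq> set tt"
proof -
  assume R: "represents T tt" "Fun f us \<in> set tt"
  then obtain i where "i < length tt" "tt ! i = Fun f us" by (auto simp: in_set_conv_nth)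
  then have "is_key tt (T ! i) (Fun f us)" using R by (metis represents_def)
  then show ?thesis by auto
qed

lemma represents_subterms: "represents T tt \<Longrightarrow> t \<in> set tt \<Longrightarrow> subterms t \<subseteq> set tt"
proof (induction t)
  case (Fun f us)
  then have "subterms u \<subseteq> set tt" if "u \<in> set us" for u using represents_args that by blast
  then show ?case using Fun.prems by auto
qed simp

lemma represents_children:
  assumes "represents T tt" "i < length T" "j < length T"
  shows "i \<in> set (snd (snd (T ! j))) \<longleftrightarrow> arg_edge (tt ! i) (tt ! j)"
proof -
  have len: "length T = length tt" and d: "distinct tt" and k: "is_key tt (T ! j) (tt ! j)"
    using assms by (auto simp: represents_def)
  show ?thesis
  proof (cases "tt ! j")
    case (Fun f us)
    then obtain js where js: "T ! j = (True, digits f, js)" "\<forall>j\<in>set js. j < length tt" "map ((!) tt) js = us"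
      using k by auto
    have "tt ! i \<in> set us \<longleftrightarrow> i \<in> set js"
      using js assms(2) len d by (auto simp: nth_eq_iff_index_eq)
    then show ?thesis using js Fun by (simp add: arg_edge_def)
  qed (use k in \<open>auto simp: arg_edge_def\<close>)
qed

lemma represents_Nil: "represents [] []"
  by (simp add: represents_def)

section \<open>Building the table\<close>

type_synonym table_state = "key list \<times> nat list"

text \<open>The common step of all readers. For preorder sequences the position list is a stack from
  which the \<open>m\<close> arguments are popped; for node lists and variables \<open>m\<close> is
  0 and the list records all positions in reverse.\<close>

definition push_key :: "key \<Rightarrow> nat \<Rightarrow> table_state \<Rightarrow> table_state" where
  "push_key k m s = (case intern k (fst s) of (i, T') \<Rightarrow> (T', i # drop m (snd s)))"

lemma ptime_push_key [ptime_intros]: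
  assumes "ptime k" "ptime m" "ptime s" shows "ptime (\<lambda>x. push_key (k x) (m x) (s x))"
  unfolding push_key_def intern_def
  by (intro ptime_intros ptime_comp[OF assms(1)] ptime_comp[OF assms(2)] ptime_comp[OF assms(3)])

definition table_bound :: "nat \<Rightarrow> nat \<Rightarrow> table_state \<Rightarrow> bool" where
  "table_bound B i s \<longleftrightarrow> length (fst s) \<le> i \<and> length (snd s) \<le> i \<and> (\<forall>j\<in>set (snd s). j \<le> i) \<and>
     (\<forall>k\<in>set (fst s). tsize k \<le> B)"

lemma table_bound_push_key:
  assumes "table_bound B i s" "tsize k \<le> B"
  shows "table_bound B (Suc i) (push_key k m s)"
  using assms length_takeWhile_le[of "\<lambda>k'. k' \<noteq> k" "fst s"]
  by (auto simp: table_bound_def push_key_def intern_def le_SucI dest!: in_set_dropD intro: le_SucI)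

lemma table_bound_size:
  assumes "table_bound B i s" "i \<le> n" shows "tsize s \<le> 1 + n * Suc B + n * Suc n"
proof -
  have "tsize (fst s) \<le> length (fst s) * Suc B"
    using assms by (intro tsize_list_le) (auto simp: table_bound_def)
  also have "\<dots> \<le> n * Suc B" using assms by (intro mult_right_mono) (auto simp: table_bound_def)
  finally have 1: "tsize (fst s) \<le> n * Suc B" .
  have "tsize (snd s) \<le> length (snd s) * Suc n"
    using assms by (intro tsize_list_le) (auto simp: table_bound_def)
  also have "\<dots> \<le> n * Suc n" using assms by (intro mult_right_mono) (auto simp: table_bound_def)
  finally show ?thesis using 1 by (cases s) simp
qed

text \<open>The bound on keys adds up two pairs and a flag, a name taken from the input, and at most
  n argument positions, each no larger than n plus its list cell. It does not depend on the round,
  so the table grows only additively.\<close>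

lemma ptime_table_foldl:
  fixes l :: "'a::tree_encodable \<Rightarrow> 'b::tree_encodable list"
  assumes l: "ptime l" and step: "ptime (\<lambda>p :: 'a \<times> 'b \<times> table_state. step (snd (snd p)) (fst (snd p)))"
    and key: "\<And>n r h. \<forall>j\<in>set (snd r). j \<le> n \<Longrightarrow> length (snd r) \<le> n \<Longrightarrow> tsize h \<le> n \<Longrightarrow>
      \<exists>k m. step r h = push_key k m r \<and> tsize k \<le> 3 + n + n * Suc n"
  shows "ptime (\<lambda>x. foldl step ([], []) (l x))"
proof -
  let ?B = "\<lambda>x. 3 + tsize (l x) + tsize (l x) * Suc (tsize (l x))"
  show ?thesis
  proof (rule ptime_foldl_indexed[where J = "\<lambda>x. table_bound (?B x)" and
        N = "\<lambda>x. 1 + tsize (l x) * Suc (?B x) + tsize (l x) * Suc (tsize (l x))"])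
    fix x i r
    let ?n = "tsize (l x)"
    assume J: "table_bound (?B x) i r"
    show "tsize r \<le> 1 + ?n * Suc (?B x) + ?n * Suc ?n" if "i \<le> length (l x)"
      using table_bound_size[OF J] that length_le_tsize[of "l x"] by auto
    assume i: "i < length (l x)"
    have n: "i \<le> ?n" using i length_le_tsize[of "l x"] by simp
    have h: "tsize (l x ! i) \<le> ?n" using tsize_mem_le[OF nth_mem[OF i]] by simp
    have "\<forall>j\<in>set (snd r). j \<le> ?n" "length (snd r) \<le> ?n"
      using J n unfolding table_bound_def by (meson order.trans)+
    from key[OF this h] obtain k m where "step r (l x ! i) = push_key k m r" "tsize k \<le> ?B x" by auto
    then show "table_bound (?B x) (Suc i) (step r (l x ! i))" using table_bound_push_key[OF J] by simp
  qed (intro ptime_intros poly_bounds l step | simp add: table_bound_def)+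
qed

lemma push_key:
  assumes T: "represents T tt" and k: "is_key tt k t"
  obtains i T' tt' where "push_key k m (T, st) = (T', i # drop m st)" "represents T' tt'" "prefix tt tt'"
    "i < length tt'" "tt' ! i = t"
proof -
  obtain i T' tt' where "intern k T = (i, T')" "represents T' tt'" "prefix tt tt'"
    "i < length tt'" "tt' ! i = t" by (rule intern[OF T k])
  then show ?thesis by (intro that[of T' i tt']) (simp_all add: push_key_def)
qed

lemma nth_prefix: "prefix tt tt' \<Longrightarrow> i < length tt \<Longrightarrow> tt' ! i = tt ! i"
  by (auto simp: prefix_def nth_append)

lemma map_nth_prefix:
  "prefix tt tt' \<Longrightarrow> \<forall>i\<in>set is. i < length tt \<Longrightarrow> map ((!) tt') is = map ((!) tt) is"
  by (auto intro: nth_prefix)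

lemma prefix_less: "prefix tt tt' \<Longrightarrow> i < length tt \<Longrightarrow> i < length tt'"
  using prefix_length_le by fastforce

text \<open>Reading the preorder sequence backwards, the arguments of a symbol are on top of the stack.\<close>

definition stack_step :: "table_state \<Rightarrow> token \<Rightarrow> table_state" where
  "stack_step s tok = (if fst tok
     then (let m = unary (length (snd s)) (snd (snd tok)) in
       push_key (True, fst (snd tok), take m (snd s)) m s)
     else push_key (False, fst (snd tok), []) 0 s)"

definition stack_run :: "token list \<Rightarrow> table_state \<Rightarrow> table_state" where
  "stack_run toks s = foldl stack_step s (rev toks)"

lemma stack_run_append: "stack_run (a @ b) s = stack_run a (stack_run b s)"
  by (simp add: stack_run_def)

definition stacked :: "(nat, nat) trm list \<Rightarrow> nat list \<Rightarrow> (nat, nat) trm list \<Rightarrow> bool" where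
  "stacked tt is ts \<longleftrightarrow> (\<forall>i\<in>set is. i < length tt) \<and> map ((!) tt) is = ts"

lemma stacked_mono: "stacked tt is ts \<Longrightarrow> prefix tt tt' \<Longrightarrow> stacked tt' is ts"
  unfolding stacked_def using map_nth_prefix prefix_less by metis

text \<open>As for parsing, the claim for single terms is a hypothesis, which the induction on terms
  in \<open>stack_run_tokens\<close> supplies for the arguments.\<close>

lemma stack_run_list:
  assumes "\<And>t T tt st. t \<in> set ts \<Longrightarrow> represents T tt \<Longrightarrow>
      \<exists>T' tt' i. stack_run (tokens t) (T, st) = (T', i # st) \<and> represents T' tt' \<and>
        prefix tt tt' \<and> stacked tt' [i] [t]"
  shows "represents T tt \<Longrightarrow>
      \<exists>T' tt' is. stack_run (concat (map tokens ts)) (T, st) = (T', is @ st) \<and> represents T' tt' \<and>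
        prefix tt tt' \<and> stacked tt' is ts"
  using assms
proof (induction ts)
  case Nil
  then show ?case
    by (intro exI[of _ T] exI[of _ tt] exI[of _ "[]"]) (simp add: stack_run_def stacked_def)
next
  case (Cons t ts)
  obtain T1 tt1 js where 1: "stack_run (concat (map tokens ts)) (T, st) = (T1, js @ st)"
    "represents T1 tt1" "prefix tt tt1" "stacked tt1 js ts"
    using Cons.IH[OF Cons.prems(1)] Cons.prems(2) by (metis list.set_intros(2))
  obtain T2 tt2 i where 2: "stack_run (tokens t) (T1, js @ st) = (T2, i # js @ st)"
    "represents T2 tt2" "prefix tt1 tt2" "stacked tt2 [i] [t]"
    using Cons.prems(2)[OF _ 1(2), of t "js @ st"] by auto
  have "stacked tt2 (i # js) (t # ts)" using 2(4) stacked_mono[OF 1(4) 2(3)] by (auto simp: stacked_def)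
  moreover have "prefix tt tt2" using 1(3) 2(3) by (rule prefix_order.trans)
  ultimately show ?case using 1 2
    by (intro exI[of _ T2] exI[of _ tt2] exI[of _ "i # js"]) (simp add: stack_run_append)
qed

lemma stack_run_tokens:
  "represents T tt \<Longrightarrow>
    \<exists>T' tt' i. stack_run (tokens t) (T, st) = (T', i # st) \<and> represents T' tt' \<and>
      prefix tt tt' \<and> stacked tt' [i] [t]"
proof (induction t arbitrary: T tt st)
  case (Var x)
  obtain i T' tt' where p: "push_key (False, digits x, []) 0 (T, st) = (T', i # drop 0 st)"
    "represents T' tt'" "prefix tt tt'" "i < length tt'" "tt' ! i = Var x"
    by (rule push_key[OF Var, where k = "(False, digits x, [])" and t = "Var x" and m = 0 and st = st]) auto
  then show ?case
    by (intro exI[of _ T'] exI[of _ tt'] exI[of _ i]) (simp add: stack_run_def stack_step_def stacked_def)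
next
  case (Fun f us)
  obtain T1 tt1 js where 1: "stack_run (concat (map tokens us)) (T, st) = (T1, js @ st)"
    "represents T1 tt1" "prefix tt tt1" "stacked tt1 js us"
    using stack_run_list[OF Fun.IH Fun.prems] by blast
  have len: "length js = length us" using 1(4) by (auto simp: stacked_def)
  have "is_key tt1 (True, digits f, js) (Fun f us)" using 1(4) by (simp add: stacked_def)
  then obtain i T' tt' where p: "push_key (True, digits f, js) (length us) (T1, js @ st) = (T', i # drop (length us) (js @ st))"
    "represents T' tt'" "prefix tt1 tt'" "i < length tt'" "tt' ! i = Fun f us"
    by (rule push_key[OF 1(2)]) blast
  have "stack_run (tokens (Fun f us)) (T, st) = stack_step (T1, js @ st) (True, digits f, digits (length us))"
    using 1(1) by (simp add: stack_run_def)
  also have "\<dots> = (T', i # st)" using p(1) len by (simp add: stack_step_def Let_def unary_digits)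
  finally show ?case using p prefix_order.trans[OF 1(3) p(3)]
    by (intro exI[of _ T'] exI[of _ tt'] exI[of _ i]) (simp add: stacked_def)
qed

lemma stack_run_terms:
  "represents T tt \<Longrightarrow>
    \<exists>T' tt' is. stack_run (concat (map tokens ts)) (T, st) = (T', is @ st) \<and> represents T' tt' \<and>
      prefix tt tt' \<and> stacked tt' is ts"
  by (rule stack_run_list) (erule stack_run_tokens | assumption)+

lemma ptime_stack_run [ptime_intros]:
  fixes l :: "'a::tree_encodable \<Rightarrow> token list"
  assumes "ptime l" shows "ptime (\<lambda>x. stack_run (l x) ([], []))"
  unfolding stack_run_def
proof (rule ptime_table_foldl)
  fix n and r :: table_state and tok :: token
  assume J: "\<forall>j\<in>set (snd r). j \<le> n" "length (snd r) \<le> n" and tok: "tsize tok \<le> n"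
  have key: "tsize (b, fst (snd tok), take m (snd r)) \<le> 3 + n + n * Suc n" for b :: bool and m
  proof -
    have "tsize (take m (snd r)) \<le> length (take m (snd r)) * Suc n"
      using J(1) by (intro tsize_list_le) (auto dest: in_set_takeD)
    also have "\<dots> \<le> n * Suc n" using J(2) by (intro mult_right_mono) auto
    finally show ?thesis
      using tok tsize_bool[of b] tsize_fst_le[of "snd tok"] tsize_snd_le[of tok] by simp
  qed
  let ?m = "unary (length (snd r)) (snd (snd tok))"
  have "stack_step r tok = push_key (True, fst (snd tok), take ?m (snd r)) ?m r \<or>
      stack_step r tok = push_key (False, fst (snd tok), take 0 (snd r)) 0 r"
    by (simp add: stack_step_def Let_def)
  then show "\<exists>k m. stack_step r tok = push_key k m r \<and> tsize k \<le> 3 + n + n * Suc n"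
    using key by blast
next
  show "ptime (\<lambda>p :: 'a \<times> token \<times> table_state. stack_step (snd (snd p)) (fst (snd p)))"
    unfolding stack_step_def by (intro ptime_intros)
qed (intro ptime_intros assms)

text \<open>Node numbers are not table positions, since several nodes may represent one term; the
  reversed position list translates the former into the latter.\<close>

definition dag_step :: "table_state \<Rightarrow> raw_node \<Rightarrow> table_state" where
  "dag_step s nd = push_key (fst nd, fst (snd nd),
      map (\<lambda>ds. get 0 (rev (snd s)) (unary (length (snd s)) ds)) (snd (snd nd))) 0 s"

definition dag_run :: "raw_node list \<Rightarrow> table_state" where
  "dag_run nds = foldl dag_step ([], []) nds"

lemma ptime_dag_run [ptime_intros]:
  fixes l :: "'a::tree_encodable \<Rightarrow> raw_node list"
  assumes "ptime l" shows "ptime (\<lambda>x. dag_run (l x))"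
  unfolding dag_run_def
proof (rule ptime_table_foldl[OF assms])
  fix n and r :: table_state and nd :: raw_node
  assume J: "\<forall>j\<in>set (snd r). j \<le> n" "length (snd r) \<le> n" and nd: "tsize nd \<le> n"
  let ?cs = "map (\<lambda>ds. get 0 (rev (snd r)) (unary (length (snd r)) ds)) (snd (snd nd))"
  have "get 0 (rev (snd r)) m \<le> n" for m
  proof (cases "m < length (rev (snd r))")
    case True
    then have "rev (snd r) ! m \<in> set (snd r)" using nth_mem[OF True] by simp
    then show ?thesis using True J(1) by auto
  qed (simp add: get_default)
  then have "tsize ?cs \<le> length ?cs * Suc n" by (intro tsize_list_le) auto
  also have "\<dots> \<le> n * Suc n"
    using nd length_le_tsize[of "snd (snd nd)"] tsize_snd_le[of "snd nd"] tsize_snd_le[of nd]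
    by (intro mult_right_mono) auto
  finally have "tsize (fst nd, fst (snd nd), ?cs) \<le> 3 + n + n * Suc n"
    using nd tsize_bool[of "fst nd"] tsize_fst_le[of "snd nd"] tsize_snd_le[of nd] by simp
  then show "\<exists>k m. dag_step r nd = push_key k m r \<and> tsize k \<le> 3 + n + n * Suc n"
    unfolding dag_step_def by blast
next
  show "ptime (\<lambda>p :: 'a \<times> raw_node \<times> table_state. dag_step (snd (snd p)) (fst (snd p)))"
    unfolding dag_step_def by (intro ptime_intros)
qed

lemma length_dag_terms: "length (dag_terms nds) = length nds"
  unfolding dag_terms_def by (induction nds rule: rev_induct) auto

lemma dag_run:
  "topological nds \<Longrightarrow>
    \<exists>T tt is. dag_run (map raw_node nds) = (T, is) \<and> represents T tt \<and> stacked tt (rev is) (dag_terms nds)"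
proof (induction nds rule: rev_induct)
  case Nil
  then show ?case using represents_Nil by (auto simp: dag_run_def stacked_def dag_terms_def)
next
  case (snoc nd nds)
  have "topological nds"
    unfolding topological.simps
  proof (intro allI impI)
    fix k f js assume k: "k < length nds" "nds ! k = FunNode f js"
    then have "(nds @ [nd]) ! k = FunNode f js" "k < length (nds @ [nd])" by (auto simp: nth_append)
    then show "\<forall>j\<in>set js. j < k" using snoc.prems unfolding topological.simps by blast
  qed
  then obtain T tt js where 1: "dag_run (map raw_node nds) = (T, js)" "represents T tt"
    "stacked tt (rev js) (dag_terms nds)" using snoc.IH by blast
  have len: "length js = length nds"
    using 1(3) length_dag_terms[of nds] unfolding stacked_def by (metis length_map length_rev)
  let ?t = "node_term (dag_terms nds) nd"
  let ?k = "(fst (raw_node nd), fst (snd (raw_node nd)),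
      map (\<lambda>ds. get 0 (rev js) (unary (length js) ds)) (snd (snd (raw_node nd))))"
  have "is_key tt ?k ?t"
  proof (cases nd)
    case (FunNode f cs)
    have "(nds @ [nd]) ! length nds = FunNode f cs" using FunNode by simp
    then have cs: "\<forall>c\<in>set cs. c < length nds"
      using snoc.prems unfolding topological.simps by (metis length_append_singleton lessI)
    have "get 0 (rev js) (unary (length js) (digits c)) = rev js ! c" if "c \<in> set cs" for c
      using cs that len by (simp add: unary_digits)
    moreover have "rev js ! c < length tt" "tt ! (rev js ! c) = dag_terms nds ! c" if "c \<in> set cs" for c
    proof -
      have c: "c < length (rev js)" using cs that len by simp
      then have "rev js ! c \<in> set (rev js)" by (rule nth_mem)
      then show "rev js ! c < length tt" using 1(3) unfolding stacked_def by blast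
      show "tt ! (rev js ! c) = dag_terms nds ! c"
        using 1(3) c unfolding stacked_def by (metis nth_map)
    qed
    ultimately show ?thesis using FunNode by auto
  qed simp
  then obtain i T' tt' where p: "push_key ?k 0 (T, js) = (T', i # drop 0 js)" "represents T' tt'"
    "prefix tt tt'" "i < length tt'" "tt' ! i = ?t" by (rule push_key[OF 1(2)]) blast
  have "dag_run (map raw_node (nds @ [nd])) = (T', i # js)"
    using 1(1) p(1) by (simp add: dag_run_def dag_step_def)
  moreover have "stacked tt' (rev (i # js)) (dag_terms (nds @ [nd]))"
    using stacked_mono[OF 1(3) p(3)] p(4,5) by (auto simp: stacked_def dag_terms_def)
  ultimately show ?case using p(2) by blast
qed

section \<open>Algorithms on descriptions\<close>

definition describes ::
  "key list \<Rightarrow> (nat, nat) trm list \<Rightarrow> nat list \<Rightarrow> (nat \<times> nat) list \<Rightarrow>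
    (nat, nat) trm list \<Rightarrow> ((nat, nat) trm \<times> (nat, nat) trm) list \<Rightarrow> bool" where
  "describes T tt is ps ts ds \<longleftrightarrow> represents T tt \<and> stacked tt is ts \<and>
     (\<forall>(i, j)\<in>set ps. i < length tt \<and> j < length tt) \<and> map (map_prod ((!) tt) ((!) tt)) ps = ds"

text \<open>All tokens pass through one run, so that outputs and tests share a table. A test is read
  as two consecutive terms: hence twice the number of tests, and sides at \<open>m + 2 * i\<close>
  and its successor, behind the \<open>m\<close> outputs.\<close>

definition read_trees :: "bool list \<Rightarrow> key list \<times> nat list \<times> (nat \<times> nat) list" where
  "read_trees bs = (case parse_num bs of (c, r) \<Rightarrow>
     case parse_tokens (length bs) (unary (length bs) c) r of (toks, r1) \<Rightarrow>
     case parse_num r1 of (d, r2) \<Rightarrow>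
     let s = stack_run (toks @ fst (parse_tokens (length bs) (2 * unary (length bs) d) r2)) ([], []);
       m = unary (length bs) c
     in (fst s, take m (snd s),
       map (\<lambda>i. (get 0 (snd s) (m + 2 * i), get 0 (snd s) (Suc (m + 2 * i)))) [0..<unary (length bs) d]))"

lemma ptime_read_trees [ptime_intros]: "ptime read_trees"
  unfolding read_trees_def by (intro ptime_intros)

lemma read_trees:
  assumes "bs = enc_list enc_trm ts @ enc_list (enc_pair enc_trm enc_trm) ds"
  shows "\<exists>T tt is ps. read_trees bs = (T, is, ps) \<and> describes T tt is ps ts ds"
proof -
  define us where "us = concat (map (\<lambda>(u, v). [u, v]) ds)"
  have us_len: "length us = 2 * length ds" unfolding us_def by (induction ds) auto
  have us_enc: "concat (map (enc_pair enc_trm enc_trm) ds) = concat (map enc_trm us)"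
    unfolding us_def by (induction ds) (auto simp: enc_pair_def)
  have us_nth: "us ! (2 * i) = fst (ds ! i)" "us ! Suc (2 * i) = snd (ds ! i)" if "i < length ds" for i
  proof -
    have "i < length ds \<Longrightarrow> us ! (2 * i) = fst (ds ! i) \<and> us ! Suc (2 * i) = snd (ds ! i)"
      unfolding us_def
    proof (induction ds arbitrary: i)
      case (Cons d ds)
      then show ?case by (cases i; cases d) auto
    qed simp
    then show "us ! (2 * i) = fst (ds ! i)" "us ! Suc (2 * i) = snd (ds ! i)" using that by auto
  qed
  let ?cap = "length bs"
  have bs: "bs = enc_nat (length ts) @ concat (map enc_trm ts) @ enc_nat (length ds) @ concat (map enc_trm us) @ []"
    by (simp add: assms enc_list_def us_enc)
  have cap: "length (concat (map enc_trm ts)) \<le> ?cap" "length (concat (map enc_trm us)) \<le> ?cap"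
    by (simp_all add: bs)
  have un: "unary ?cap (digits (length ts)) = length ts" "unary ?cap (digits (length ds)) = length ds"
    using length_le_enc_trms[of ts] length_le_enc_trms[of us] cap us_len by (simp_all add: unary_digits)
  obtain T tt js where run: "stack_run (concat (map tokens (ts @ us))) ([], []) = (T, js @ [])"
    "represents T tt" "prefix [] tt" "stacked tt js (ts @ us)"
    using stack_run_terms[OF represents_Nil] by blast
  have js: "length js = length ts + length us" using run(4) unfolding stacked_def
    by (metis length_append length_map)
  let ?m = "length ts"
  define ps where "ps = map (\<lambda>i. (get 0 js (?m + 2 * i), get 0 js (Suc (?m + 2 * i)))) [0..<length ds]"
  have 1: "parse_num bs = (digits (length ts), concat (map enc_trm ts) @ enc_nat (length ds) @ concat (map enc_trm us) @ [])"
    by (subst bs) (rule parse_num)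
  have "read_trees bs = (T, take ?m js, ps)"
    unfolding read_trees_def 1 prod.case un parse_tokens[OF cap(1)] parse_num us_len[symmetric]
      parse_tokens[OF cap(2)]
    using run(1) by (simp add: ps_def Let_def)
  moreover have "stacked tt (take ?m js) ts"
    using run(4) unfolding stacked_def by (auto simp: take_map[symmetric] dest!: in_set_takeD)
  moreover have "(\<forall>(i, j)\<in>set ps. i < length tt \<and> j < length tt) \<and> map (map_prod ((!) tt) ((!) tt)) ps = ds"
  proof -
    have nth: "js ! k < length tt \<and> tt ! (js ! k) = (ts @ us) ! k" if "k < length js" for k
      using run(4) that unfolding stacked_def by (metis nth_map nth_mem)
    have ent: "get 0 js (?m + 2 * i) < length tt \<and> tt ! get 0 js (?m + 2 * i) = fst (ds ! i) \<and>
        get 0 js (Suc (?m + 2 * i)) < length tt \<and> tt ! get 0 js (Suc (?m + 2 * i)) = snd (ds ! i)"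
      if "i < length ds" for i
      using that nth[of "?m + 2 * i"] nth[of "Suc (?m + 2 * i)"] js us_len us_nth[OF that]
      by (simp add: nth_append)
    then have "map (map_prod ((!) tt) ((!) tt)) ps = map (\<lambda>i. ds ! i) [0..<length ds]"
      unfolding ps_def map_map by (intro map_cong) auto
    then show ?thesis using ent unfolding ps_def by (auto simp: map_nth)
  qed
  ultimately show ?thesis unfolding describes_def using run(2) by blast
qed

definition read_dag :: "bool list \<Rightarrow> key list \<times> nat list \<times> (nat \<times> nat) list" where
  "read_dag bs = (case parse_list parse_node bs of (nds, r) \<Rightarrow>
     case parse_list parse_num r of (os, r1) \<Rightarrow>
     case parse_list (parse_pair parse_num parse_num) r1 of (ds, r2) \<Rightarrow>
     let s = dag_run nds; env = rev (snd s) in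
       (fst s, map (\<lambda>j. get 0 env (unary (length env) j)) os,
        map (\<lambda>d. (get 0 env (unary (length env) (fst d)), get 0 env (unary (length env) (snd d)))) ds))"

lemmas ptime_parse_pairs = ptime_parse_list[OF ptime_parse_pair'[OF ptime_parse_num' ptime_parse_num']
    shrinking_parse_pair[OF shrinking_parse_num shrinking_parse_num]]

lemma ptime_read_dag [ptime_intros]: "ptime read_dag"
  unfolding read_dag_def
  by (intro ptime_intros ptime_parse_list[OF ptime_parse_node shrinking_parse_node]
      ptime_parse_list[OF ptime_parse_num' shrinking_parse_num] ptime_parse_pairs)

lemma parse_list_pairs:
  "parse_list (parse_pair parse_num parse_num) (enc_list (enc_pair enc_nat enc_nat) ps @ rest)
    = (map (map_prod digits digits) ps, rest)"
proof (rule parse_list)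
  fix p rest
  show "parse_pair parse_num parse_num (enc_pair enc_nat enc_nat p @ rest) = (map_prod digits digits p, rest)"
    by (rule parse_pair) simp_all
qed (simp add: enc_pair_def)

lemma read_dag:
  assumes bs: "bs = enc_list enc_node nds @ enc_list enc_nat os @ enc_list (enc_pair enc_nat enc_nat) ds"
    and top: "topological nds" and os: "\<forall>j\<in>set os. j < length nds"
    and ds: "\<forall>(i, j)\<in>set ds. i < length nds \<and> j < length nds"
  shows "\<exists>T tt is ps. read_dag bs = (T, is, ps) \<and> describes T tt is ps
    (map (\<lambda>j. dag_terms nds ! j) os) (map (\<lambda>(i, j). (dag_terms nds ! i, dag_terms nds ! j)) ds)"
proof -
  obtain T tt js where run: "dag_run (map raw_node nds) = (T, js)" "represents T tt"
    "stacked tt (rev js) (dag_terms nds)" using dag_run[OF top] by blast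
  have len: "length js = length nds"
    using run(3) length_dag_terms[of nds] unfolding stacked_def by (metis length_map length_rev)
  let ?e = "\<lambda>j. get 0 (rev js) (unary (length (rev js)) (digits j))"
  have e: "?e j < length tt \<and> tt ! ?e j = dag_terms nds ! j" if "j < length nds" for j
  proof -
    have "?e j = rev js ! j" using that len by (simp add: unary_digits)
    moreover have j: "j < length (rev js)" using that len by simp
    ultimately show ?thesis using run(3) nth_mem[OF j] nth_map[OF j, of "(!) tt"] unfolding stacked_def by auto
  qed
  have ds': "i < length nds" "j < length nds" if "(i, j) \<in> set ds" for i j using ds that by blast+
  have "enc_node nd \<noteq> []" for nd by (cases nd) auto
  then have p1: "parse_list parse_node (enc_list enc_node nds @ rest) = (map raw_node nds, rest)" for rest
    by (intro parse_list) auto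
  have p3: "parse_list (parse_pair parse_num parse_num) (enc_list (enc_pair enc_nat enc_nat) ds)
      = (map (map_prod digits digits) ds, [])" using parse_list_pairs[of ds "[]"] by simp
  have "read_dag bs = (T, map ?e os, map (map_prod ?e ?e) ds)"
    unfolding read_dag_def bs p1 prod.case parse_list_nums p3 run(1) Let_def
    by (auto simp: comp_def)
  moreover have "stacked tt (map ?e os) (map (\<lambda>j. dag_terms nds ! j) os)"
    using e os by (auto simp: stacked_def)
  moreover have "map (map_prod ((!) tt) ((!) tt)) (map (map_prod ?e ?e) ds) =
      map (\<lambda>(i, j). (dag_terms nds ! i, dag_terms nds ! j)) ds"
    unfolding map_map using e ds' by (intro map_cong) auto
  moreover have "\<forall>(i, j)\<in>set (map (map_prod ?e ?e) ds). i < length tt \<and> j < length tt"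
    using e ds' by auto
  ultimately show ?thesis using run(2) unfolding describes_def by blast
qed

text \<open>A declared variable is a vertex of the term graph even if no term contains it, so all of
  them are entered into the table explicitly.\<close>

definition push_vars :: "bool list list \<Rightarrow> key list \<Rightarrow> table_state" where
  "push_vars xs T = foldl (\<lambda>s x. push_key (False, x, []) 0 s) (T, []) xs"

lemma ptime_push_vars [ptime_intros]:
  assumes "ptime l" "ptime T" shows "ptime (\<lambda>x. push_vars (l x) (T x))"
  unfolding push_vars_def
proof (rule ptime_foldl_indexed[where
      N = "\<lambda>x. 1 + (tsize (l x) + tsize (T x)) * Suc (3 + tsize (l x) + tsize (T x)) +
        (tsize (l x) + tsize (T x)) * Suc (tsize (l x) + tsize (T x))" and
      J = "\<lambda>x i. table_bound (3 + tsize (l x) + tsize (T x)) (i + length (T x))"])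
  fix x
  let ?B = "3 + tsize (l x) + tsize (T x)"
  show "table_bound ?B (0 + length (T x)) (T x, [])"
  proof -
    have "tsize k \<le> ?B" if "k \<in> set (T x)" for k using tsize_mem_le[OF that] by simp
    then show ?thesis unfolding table_bound_def by (simp del: tsize_simps)
  qed
  fix i r
  assume J: "table_bound ?B (i + length (T x)) r"
  show "tsize r \<le> 1 + (tsize (l x) + tsize (T x)) * Suc ?B +
      (tsize (l x) + tsize (T x)) * Suc (tsize (l x) + tsize (T x))" if "i \<le> length (l x)"
    using table_bound_size[OF J, of "tsize (l x) + tsize (T x)"] that
      length_le_tsize[of "l x"] length_le_tsize[of "T x"] by linarith
  assume i: "i < length (l x)"
  have "tsize (False, l x ! i, [] :: nat list) \<le> ?B" using tsize_mem_le[OF nth_mem[OF i]] by simp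
  from table_bound_push_key[OF J this]
  show "table_bound ?B (Suc i + length (T x)) (push_key (False, l x ! i, []) 0 r)" by simp
qed (intro ptime_intros poly_bounds assms)+

lemma push_vars:
  "represents T tt \<Longrightarrow> \<exists>T' tt' is. push_vars (map digits xs) T = (T', is) \<and> represents T' tt' \<and>
    prefix tt tt' \<and> stacked tt' is (map Var (rev xs))"
proof (induction xs rule: rev_induct)
  case Nil
  then show ?case by (auto simp: push_vars_def stacked_def)
next
  case (snoc x xs)
  then obtain T1 tt1 js where 1: "push_vars (map digits xs) T = (T1, js)" "represents T1 tt1"
    "prefix tt tt1" "stacked tt1 js (map Var (rev xs))" by blast
  obtain i T' tt' where p: "push_key (False, digits x, []) 0 (T1, js) = (T', i # drop 0 js)" "represents T' tt'"
    "prefix tt1 tt'" "i < length tt'" "tt' ! i = Var x"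
    by (rule push_key[OF 1(2), where k = "(False, digits x, [])" and t = "Var x" and m = 0 and st = js]) auto
  have "push_vars (map digits (xs @ [x])) T = (T', i # js)"
    using 1(1) p(1) by (simp add: push_vars_def)
  moreover have "stacked tt' (i # js) (map Var (rev (xs @ [x])))"
    using p(4,5) stacked_mono[OF 1(4) p(3)] by (simp add: stacked_def)
  ultimately show ?case using p(2) prefix_order.trans[OF 1(3) p(3)] by blast
qed

definition read_description :: "bool list \<Rightarrow> key list \<times> nat list \<times> nat list \<times> (nat \<times> nat) list" where
  "read_description bs = (case parse_list parse_num bs of (xs, r) \<Rightarrow>
     case parse_list (parse_pair parse_num parse_num) r of (sig, r1) \<Rightarrow>
     case parse_flag r1 of (b, r2) \<Rightarrow>
     case (if b then read_dag r2 else read_trees r2) of (T, os, ds) \<Rightarrow>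
     case push_vars xs T of (T', vs) \<Rightarrow> (T', vs, os, ds))"

lemma ptime_read_description: "ptime read_description"
  unfolding read_description_def
  by (intro ptime_intros ptime_parse_list[OF ptime_parse_num' shrinking_parse_num] ptime_parse_pairs
      ptime_comp[OF ptime_read_dag] ptime_comp[OF ptime_read_trees])

lemma read_description:
  assumes wf: "wf_description d"
  obtains T tt vs os ds where "read_description (enc_description d) = (T, vs, os, ds)"
    "describes T tt os ds (outputs (described_problem d)) (tests (described_problem d))"
    "\<forall>i\<in>set vs. i < length tt" "(!) tt ` set vs = Var ` variables (described_problem d)"
proof -
  obtain xs sig bd where d: "d = Description xs sig bd" by (cases d)
  have "\<exists>T tt os ds. (if hd (enc_body bd) then read_dag (tl (enc_body bd)) else read_trees (tl (enc_body bd)))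
      = (T, os, ds) \<and> describes T tt os ds (body_outputs bd) (body_tests bd)"
  proof (cases bd)
    case (Trees ts ds)
    then show ?thesis using read_trees[OF refl, of ts ds] by simp
  next
    case (Dag nds os ds)
    then have "topological nds" "\<forall>j\<in>set os. j < length nds" "\<forall>(i, j)\<in>set ds. i < length nds \<and> j < length nds"
      using wf d by (auto simp: wf_description_def)
    then show ?thesis using read_dag[OF refl, of nds os ds] Dag by simp
  qed
  then obtain T tt os ds where 1: "(if hd (enc_body bd) then read_dag (tl (enc_body bd)) else read_trees (tl (enc_body bd)))
      = (T, os, ds)" "describes T tt os ds (body_outputs bd) (body_tests bd)" by blast
  obtain T' tt' vs where 2: "push_vars (map digits xs) T = (T', vs)" "represents T' tt'"
    "prefix tt tt'" "stacked tt' vs (map Var (rev xs))"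
    using push_vars[of T tt xs] 1(2) by (auto simp: describes_def)
  have enc: "enc_body bd = hd (enc_body bd) # tl (enc_body bd)" by (cases bd) auto
  have "read_description (enc_description d) = (T', vs, os, ds)"
    unfolding read_description_def enc_description_def d description.sel parse_list_nums prod.case
      parse_list_pairs
    by (subst enc) (simp add: 1(1) 2(1))
  moreover have "describes T' tt' os ds (body_outputs bd) (body_tests bd)"
    unfolding describes_def
  proof (intro conjI)
    show "stacked tt' os (body_outputs bd)" using 1(2) stacked_mono[OF _ 2(3)] by (auto simp: describes_def)
    show "\<forall>(i, j)\<in>set ds. i < length tt' \<and> j < length tt'"
      using 1(2) prefix_less[OF 2(3)] by (auto simp: describes_def)
    have "map (map_prod ((!) tt') ((!) tt')) ds = map (map_prod ((!) tt) ((!) tt)) ds"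
      using 1(2) nth_prefix[OF 2(3)] by (intro map_cong) (auto simp: describes_def)
    also have "\<dots> = body_tests bd" using 1(2) by (simp add: describes_def)
    finally show "map (map_prod ((!) tt') ((!) tt')) ds = body_tests bd" .
  qed (rule 2(2))
  moreover have "(!) tt' ` set vs = Var ` set xs"
    using 2(4) unfolding stacked_def by (metis image_set set_rev)
  ultimately show ?thesis using 2(4)
    by (intro that[of T' vs os ds tt']) (auto simp: d described_problem_def stacked_def)
qed

text \<open>The loops and argument edges between copies, read off the keys. The default key has no
  arguments, so it adds no edges.\<close>

definition node_adj :: "key list \<Rightarrow> nat \<Rightarrow> nat \<Rightarrow> bool" where
  "node_adj T i j \<longleftrightarrow> i = j \<or> i \<in> set (snd (snd (get (False, [], []) T j)))"

text \<open>Running time has to be bounded for arbitrary lists \<open>L\<close> and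
  \<open>R\<close>, whereas \<open>auction_inv\<close> presupposes distinct ones. This weaker
  invariant, which keeps entries within \<open>L\<close> and \<open>R\<close>, prices at most
  \<open>N\<close> and at most one owner, is enough for the size.\<close>

lemma auction_step_bound:
  fixes adj :: "'l::tree_encodable \<Rightarrow> 'r::tree_encodable \<Rightarrow> bool"
  defines "J L R N s \<equiv> length (fst s) \<le> length L \<and> set (fst s) \<subseteq> set L \<and> length (snd s) = length R \<and>
    (\<forall>e\<in>set (snd s). fst e \<in> set R \<and> fst (snd e) \<le> N \<and> length (snd (snd e)) \<le> 1 \<and> set (snd (snd e)) \<subseteq> set L)"
  shows "J L R N s \<Longrightarrow> J L R N (auction_step adj N s)"
    and "J L R N s \<Longrightarrow> tsize s \<le> 1 + length L * Suc (tsize L) + length R * Suc (3 + tsize R + N + tsize L)"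
proof -
  assume J: "J L R N s"
  show "J L R N (auction_step adj N s)"
  proof (cases "fst s")
    case (Cons u W)
    let ?C = "filter (\<lambda>e. adj u (fst e) \<and> fst (snd e) < N \<and>
            \<not> list_ex (\<lambda>e'. adj u (fst e') \<and> fst (snd e') < fst (snd e)) (snd s)) (snd s)"
    show ?thesis
    proof (cases ?C)
      case Nil
      then have "auction_step adj N s = (W, snd s)" unfolding auction_step_def Cons by simp
      then show ?thesis using J Cons unfolding J_def by simp
    next
      case C: (Cons e C')
      have "e \<in> set ?C" unfolding C by simp
      then have e: "e \<in> set (snd s)" "fst (snd e) < N" by simp_all
      have "auction_step adj N s = (snd (snd e) @ W,
          map (\<lambda>e'. if fst e' = fst e then (fst e, Suc (fst (snd e)), [u]) else e') (snd s))"
        unfolding auction_step_def Cons list.case C by simp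
      moreover have "length (snd (snd e) @ W) \<le> length L" using J Cons e(1) unfolding J_def by fastforce
      moreover have "set (snd (snd e) @ W) \<subseteq> set L" "u \<in> set L" using J Cons e(1) unfolding J_def by auto
      ultimately show ?thesis using J e unfolding J_def by auto
    qed
  qed (use J in \<open>simp add: auction_step_def\<close>)
next
  assume J: "J L R N s"
  have mem: "tsize u \<le> tsize L" if "u \<in> set L" for u using tsize_mem_le[OF that] by simp
  have "tsize (fst s) \<le> length (fst s) * Suc (tsize L)"
    using J mem unfolding J_def by (intro tsize_list_le) auto
  also have "\<dots> \<le> length L * Suc (tsize L)" using J unfolding J_def by (intro mult_right_mono) auto
  finally have 1: "tsize (fst s) \<le> length L * Suc (tsize L)" .
  have "tsize e \<le> 3 + tsize R + N + tsize L" if "e \<in> set (snd s)" for e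
  proof -
    obtain v p us where e: "e = (v, p, us)" by (cases e)
    have "fst e \<in> set R \<and> fst (snd e) \<le> N \<and> length (snd (snd e)) \<le> 1 \<and> set (snd (snd e)) \<subseteq> set L"
      using J that unfolding J_def by blast
    then have h: "v \<in> set R" "p \<le> N" "length us \<le> 1" "set us \<subseteq> set L" unfolding e by simp_all
    have "tsize us \<le> Suc (tsize L)" using h(3,4) mem by (cases us) auto
    moreover have "tsize v < tsize R" using tsize_mem_le[OF h(1)] .
    ultimately show ?thesis using h(2) by (simp add: e)
  qed
  then have "tsize (snd s) \<le> length (snd s) * Suc (3 + tsize R + N + tsize L)" by (rule tsize_list_le)
  then show "tsize s \<le> 1 + length L * Suc (tsize L) + length R * Suc (3 + tsize R + N + tsize L)"
    using 1 J unfolding J_def by (cases s) simp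
qed

lemma ptime_matching_size:
  assumes T: "ptime T" and L: "ptime L" and R: "ptime R"
  shows "ptime (\<lambda>x. matching_size (node_adj (T x)) (L x) (R x))"
proof -
  let ?J = "\<lambda>x s. length (fst s) \<le> length (L x) \<and> set (fst s) \<subseteq> set (L x) \<and> length (snd s) = length (R x) \<and>
    (\<forall>e\<in>set (snd s). fst e \<in> set (R x) \<and> fst (snd e) \<le> Suc (length (R x)) \<and>
      length (snd (snd e)) \<le> 1 \<and> set (snd (snd e)) \<subseteq> set (L x))"
  have "ptime (\<lambda>x. (auction_step (node_adj (T x)) (Suc (length (R x))) ^^
      (length (L x) + Suc (length (R x)) * length (R x))) (L x, map (\<lambda>v. (v, 0, [])) (R x)))"
  proof (rule ptime_funpow_indexed[where J = "\<lambda>x i. ?J x" and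
        N = "\<lambda>x. 1 + length (L x) * Suc (tsize (L x)) + length (R x) * Suc (3 + tsize (R x) + Suc (length (R x)) + tsize (L x))"])
    show "ptime (\<lambda>p. auction_step (node_adj (T (fst p))) (Suc (length (R (fst p)))) (snd p))"
      unfolding auction_step_def node_adj_def
      by (intro ptime_intros ptime_comp[OF T] ptime_comp[OF R])
    show "poly_bounded (\<lambda>x. 1 + length (L x) * Suc (tsize (L x)) +
        length (R x) * Suc (3 + tsize (R x) + Suc (length (R x)) + tsize (L x)))"
    proof (intro poly_bounds L R)
      show "poly_bounded (\<lambda>x. length (L x))" "poly_bounded (\<lambda>x. length (R x))"
        by (rule poly_bounded_mono[OF ptime_tsize length_le_tsize], rule L,
            rule poly_bounded_mono[OF ptime_tsize length_le_tsize], rule R)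
      show "poly_bounded (\<lambda>x. length (R x))"
        by (rule poly_bounded_mono[OF ptime_tsize length_le_tsize], rule R)
    qed
    show "?J x (auction_step (node_adj (T x)) (Suc (length (R x))) r)" if "?J x r" for x r
      using auction_step_bound(1)[of r "L x" "R x" "Suc (length (R x))" "node_adj (T x)"] that by blast
    show "tsize r \<le> 1 + length (L x) * Suc (tsize (L x)) +
        length (R x) * Suc (3 + tsize (R x) + Suc (length (R x)) + tsize (L x))" if "?J x r" for x r
      using auction_step_bound(2)[of r "L x" "R x" "Suc (length (R x))"] that by blast
  qed (intro ptime_intros L R | simp)+
  then show ?thesis unfolding matching_size_def auction_def by (intro ptime_intros)
qed

section \<open>The two algorithms and their correctness\<close>

definition identical_test_bits :: "bool list \<Rightarrow> bool list" where
  "identical_test_bits bs = (case read_description bs of (T, vs, os, ds) \<Rightarrow>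
     [list_ex (\<lambda>d. fst d = snd d) ds])"

text \<open>The formula of \<open>min_cut_size_matching\<close> with the whole table as vertex set;
  entries from nodes that nothing refers to leave its value unchanged. Repeated outputs are one
  vertex, hence \<open>remdups\<close>.\<close>

definition min_cut_bits :: "bool list \<Rightarrow> bool list" where
  "min_cut_bits bs = (case read_description bs of (T, vs, os, ds) \<Rightarrow>
     enc_nat (matching_size (node_adj T) (filter (\<lambda>i. i \<notin> set os) [0..<length T])
         (filter (\<lambda>i. i \<notin> set vs) [0..<length T])
       + length (remdups vs) + length (remdups os) - length T))"

lemma ptime_identical_test_bits: "ptime identical_test_bits"
  unfolding identical_test_bits_def by (intro ptime_intros ptime_read_description)

lemma ptime_min_cut_bits: "ptime min_cut_bits"
  unfolding min_cut_bits_def by (intro ptime_intros ptime_read_description ptime_matching_size)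

lemma identical_test_bits:
  assumes "wf_description d"
  shows "identical_test_bits (enc_description d) = [has_identical_test (described_problem d)]"
proof -
  obtain T tt vs os ds where r: "read_description (enc_description d) = (T, vs, os, ds)"
    "describes T tt os ds (outputs (described_problem d)) (tests (described_problem d))"
    by (rule read_description[OF assms])
  have inj: "tt ! i = tt ! j \<longleftrightarrow> i = j" if "(i, j) \<in> set ds" for i j
    using r(2) that by (auto simp: describes_def represents_def nth_eq_iff_index_eq)
  have "tests (described_problem d) = map (map_prod ((!) tt) ((!) tt)) ds"
    using r(2) by (simp add: describes_def)
  then have "has_identical_test (described_problem d) \<longleftrightarrow> (\<exists>(i, j)\<in>set ds. tt ! i = tt ! j)"
    unfolding has_identical_test_def by (auto simp: map_prod_def split: prod.splits)
  also have "\<dots> \<longleftrightarrow> (\<exists>(i, j)\<in>set ds. i = j)" using inj by auto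
  finally show ?thesis by (simp add: identical_test_bits_def r(1) list_ex_iff case_prod_unfold)
qed

text \<open>The matching and cover live on table positions; the injection of positions into terms
  carries them over to the set of table terms, which contains the term graph because the table is
  closed under subterms.\<close>

lemma min_cut_bits:
  assumes wf: "wf_description d"
  shows "min_cut_bits (enc_description d) = enc_nat (min_cut_size (described_problem d))"
proof -
  let ?P = "described_problem d"
  obtain T tt vs os ds where r: "read_description (enc_description d) = (T, vs, os, ds)"
    "describes T tt os ds (outputs ?P) (tests ?P)"
    "\<forall>i\<in>set vs. i < length tt" "(!) tt ` set vs = Var ` variables ?P"
    by (rule read_description[OF wf])
  have wfP: "wf_problem ?P" using wf by (simp add: wf_description_def)
  let ?n = "length T" and ?f = "(!) tt"
  have rep: "represents T tt" and len: "length tt = ?n" and dist: "distinct tt"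
    using r(2) by (auto simp: describes_def represents_def)
  have os: "\<forall>i\<in>set os. i < ?n" "?f ` set os = set (outputs ?P)"
    using r(2) len unfolding describes_def stacked_def by (auto simp flip: set_map)
  have vs: "\<forall>i\<in>set vs. i < ?n" using r(3) len by simp
  have V: "set tt = ?f ` {..<?n}" using len by (auto simp: set_conv_nth)
  have inj: "inj_on ?f {..<?n}" using dist len by (intro inj_on_nth) auto
  have injD: "i = j" if "?f i = ?f j" "i < ?n" "j < ?n" for i j using inj that by (auto dest: inj_onD)
  have sub: "term_vertices ?P \<subseteq> set tt"
  proof -
    have sub_out: "t \<in> set tt" if "t \<in> set (outputs ?P)" for t using that unfolding os(2)[symmetric] V using os(1) by auto
    have sub_test: "u \<in> set tt \<and> v \<in> set tt" if "(u, v) \<in> set (tests ?P)" for u v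
    proof -
      have "(u, v) \<in> set (map (map_prod ?f ?f) ds)" using r(2) that by (simp add: describes_def)
      then obtain i j where ij: "(i, j) \<in> set ds" "u = ?f i" "v = ?f j" by auto
      have "i < length tt \<and> j < length tt" using r(2) ij(1) unfolding describes_def by blast
      then show ?thesis using ij by simp
    qed
    have sub_var: "Var ` variables ?P \<subseteq> set tt" unfolding r(4)[symmetric] V using vs by auto
    note closed = subsetD[OF represents_subterms[OF rep]]
    show ?thesis
    proof
      fix t assume "t \<in> term_vertices ?P"
      then consider w where "w \<in> set (outputs ?P)" "t \<in> subterms w"
        | u v where "(u, v) \<in> set (tests ?P)" "t \<in> subterms u \<or> t \<in> subterms v"
        | "t \<in> Var ` variables ?P"
        unfolding term_vertices_def by auto
      then show "t \<in> set tt"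
      proof cases
        case 1
        then show ?thesis using closed[OF sub_out] by simp
      next
        case 2
        then show ?thesis using closed sub_test[OF 2(1)] by blast
      qed (use sub_var in auto)
    qed
  qed
  define L where "L = filter (\<lambda>i. i \<notin> set os) [0..<?n]"
  define R where "R = filter (\<lambda>i. i \<notin> set vs) [0..<?n]"
  have "distinct L" "distinct R" by (simp_all add: L_def R_def)
  then obtain M CL CR where K: "M \<subseteq> set L \<times> set R" "\<And>u v. (u, v) \<in> M \<Longrightarrow> node_adj T u v"
    "inj_on fst M" "inj_on snd M" "card M = matching_size (node_adj T) L R" "CL \<subseteq> set L" "CR \<subseteq> set R"
    "\<And>u v. u \<in> set L \<Longrightarrow> v \<in> set R \<Longrightarrow> node_adj T u v \<Longrightarrow> u \<in> CL \<or> v \<in> CR"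
    "card CL + card CR \<le> card M"
    by (rule matching_size_koenig[of L R "node_adj T"]) blast
  have image: "?f ` set (filter (\<lambda>i. i \<notin> set zs) [0..<?n]) = set tt - ?f ` set zs"
    if "\<forall>i\<in>set zs. i < ?n" for zs
  proof -
    have "set (filter (\<lambda>i. i \<notin> set zs) [0..<?n]) = {..<?n} - set zs" by auto
    also have "?f ` \<dots> = ?f ` {..<?n} - ?f ` set zs" using that by (intro inj_on_image_set_diff[OF inj]) auto
    finally show ?thesis using V by simp
  qed
  have L: "set L \<subseteq> {..<?n}" "?f ` set L = set tt - set (outputs ?P)"
    using image[OF os(1)] unfolding os(2) L_def by auto
  have R: "set R \<subseteq> {..<?n}" "?f ` set R = set tt - Var ` variables ?P"
    using image[OF vs] unfolding r(4) R_def by auto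
  have adj: "node_adj T i j \<longleftrightarrow> ?f i = ?f j \<or> arg_edge (?f i) (?f j)" if "i < ?n" "j < ?n" for i j
    using represents_children[OF rep that] injD that by (auto simp: node_adj_def)
  let ?M = "map_prod ?f ?f ` M"
  have fM: "inj_on (map_prod ?f ?f) M"
    by (rule inj_on_subset[OF map_prod_inj_on[OF inj inj]]) (use K(1) L(1) R(1) in auto)
  have bM: "i < ?n \<and> j < ?n" if "(i, j) \<in> M" for i j using K(1) L(1) R(1) that by auto
  have projM: "fst ` M \<subseteq> {..<?n}" "snd ` M \<subseteq> {..<?n}" using bM by auto
  have "min_cut_size ?P + card (set tt) = card ?M + card (variables ?P) + card (set (outputs ?P))"
  proof (rule min_cut_size_matching(1)[OF wfP _ sub, where CL = "?f ` CL" and CR = "?f ` CR"])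
    show "?M \<subseteq> (set tt - set (outputs ?P)) \<times> (set tt - Var ` variables ?P)"
      unfolding L(2)[symmetric] R(2)[symmetric] using K(1) by auto
    show "u = v \<or> arg_edge u v" if "(u, v) \<in> ?M" for u v
      using that K(2) adj bM by fastforce
    show "inj_on fst ?M"
      using comp_inj_on[OF K(3) inj_on_subset[OF inj projM(1)]]
      by (intro inj_on_imageI) (auto simp: comp_def)
    show "inj_on snd ?M"
      using comp_inj_on[OF K(4) inj_on_subset[OF inj projM(2)]]
      by (intro inj_on_imageI) (auto simp: comp_def)
    show "?f ` CL \<subseteq> set tt - set (outputs ?P)" "?f ` CR \<subseteq> set tt - Var ` variables ?P"
      unfolding L(2)[symmetric] R(2)[symmetric] using K(6,7) by auto
    show "u \<in> ?f ` CL \<or> v \<in> ?f ` CR"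
      if uv: "u \<in> set tt - set (outputs ?P)" "v \<in> set tt - Var ` variables ?P" "u = v \<or> arg_edge u v" for u v
    proof -
      obtain i j where ij: "i \<in> set L" "u = ?f i" "j \<in> set R" "v = ?f j"
        using uv(1,2) unfolding L(2)[symmetric] R(2)[symmetric] by auto
      then have "node_adj T i j" using adj[of i j] uv(3) L(1) R(1) by auto
      then show ?thesis using K(8)[OF ij(1,3)] ij by auto
    qed
    have "card (?f ` CL) + card (?f ` CR) \<le> card CL + card CR"
      using K(6,7) by (intro add_mono card_image_le) (auto intro: finite_subset)
    then show "card (?f ` CL) + card (?f ` CR) \<le> card ?M" using K(9) card_image[OF fM] by simp
  qed simp
  moreover have "card (set tt) = ?n" using distinct_card[OF dist] len by simp
  moreover have "card (variables ?P) = length (remdups vs)"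
  proof -
    have "card (variables ?P) = card (Var ` variables ?P :: (nat, nat) trm set)"
      by (simp add: card_image inj_on_def)
    also have "\<dots> = card (set vs)"
      unfolding r(4)[symmetric] by (rule card_image[OF inj_on_subset[OF inj]]) (use vs in auto)
    finally show ?thesis by (simp add: length_remdups_card_conv)
  qed
  moreover have "card (set (outputs ?P)) = length (remdups os)"
  proof -
    have "card (set (outputs ?P)) = card (set os)"
      unfolding os(2)[symmetric] by (rule card_image[OF inj_on_subset[OF inj]]) (use os in auto)
    then show ?thesis by (simp add: length_remdups_card_conv)
  qed
  ultimately have "min_cut_size ?P = matching_size (node_adj T) L R + length (remdups vs) + length (remdups os) - ?n"
    using card_image[OF fM] K(5) by simp
  then show ?thesis by (simp add: min_cut_bits_def r(1) L_def R_def)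
qed

theorem theorem3p1:
  shows
    "(\<forall>P :: ('f, 'x) problem. wf_problem P \<longrightarrow>
        (has_identical_test P \<longrightarrow> (\<forall>n\<ge>1. dispersion P n = 0)) \<and>
        (\<not> has_identical_test P \<longrightarrow>
           (\<forall>n\<ge>graph_size P.
              (n div graph_size P) ^ min_cut_size P \<le> dispersion P n \<and>
              dispersion P n \<le> n ^ min_cut_size P) \<and>
           (\<lambda>n. real (dispersion P n)) \<in> \<Theta>(\<lambda>n. real n ^ min_cut_size P) \<and>
           (\<lambda>n. ln (real (dispersion P n)) / ln (real n)) \<longlonglongrightarrow> real (min_cut_size P))) \<and>
     poly_time_computable enc_description {d. wf_description d}
       (\<lambda>d. [has_identical_test (described_problem d)]) \<and>
     poly_time_computable enc_description {d. wf_description d}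
       (\<lambda>d. enc_nat (min_cut_size (described_problem d)))"
proof (intro conjI)
  show "poly_time_computable enc_description {d. wf_description d}
       (\<lambda>d. [has_identical_test (described_problem d)])"
    by (rule poly_time_computableI[OF ptime_identical_test_bits]) (simp add: identical_test_bits)
  show "poly_time_computable enc_description {d. wf_description d}
       (\<lambda>d. enc_nat (min_cut_size (described_problem d)))"
    by (rule poly_time_computableI[OF ptime_min_cut_bits]) (simp add: min_cut_bits)
qed (use dispersion_identical dispersion_bounds dispersion_asymptotics in blast)

end
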